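(* Let $\pi:E\to M$ be an affine bundle equipped with a Leibniz bracket structure (as defined in the context; no Jacobi-type condition is assumed). Then the exterior derivative $d$ on forms on $Sec(\pi)$ satisfies $d^2=0$ if and only if the bracket satisfies the Jacobi identity $$[[\zeta_1,\zeta_2],\zeta_3]+[[\zeta_2,\zeta_3],\zeta_1]+[[\zeta_3,\zeta_1],\zeta_2]=\boldsymbol{0}\qquad\text{for all }\zeta_1,\zeta_2,\zeta_3\in Sec(\pi),$$ or, equivalently, if and only if $$[\zeta,[\boldsymbol{\sigma},\boldsymbol{\eta}]]=[[\zeta,\boldsymbol{\sigma}],\boldsymbol{\eta}]+[\boldsymbol{\sigma},[\zeta,\boldsymbol{\eta}]]\qquad\text{for all }\zeta\in Sec(\pi),\ \boldsymbol{\sigma},\boldsymbol{\eta}\in Sec(\bar\pi).$$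
   Context: $M$ is a smooth manifold fibred over $\mathbb{R}$ by $\tau:M\to\mathbb{R}$, with $t$ the coordinate on $\mathbb{R}$. $VM\subset TM$ is the bundle of $\tau$-vertical vectors, and $J^1M\to M$ is the first jet bundle of $\tau$, an affine bundle modelled on $VM$, identified with $\{X\in TM: dt(X)=1\}$. $\pi:E\to M$ is an affine bundle modelled on the vector bundle $\bar\pi:V\to M$. Boldface sections denote sections of $\bar\pi$. A hat denotes omission of an argument. Leibniz bracket structure (name used here for the setting of the statement): (1) a skew-symmetric $\mathbb{R}$-bilinear bracket $[\cdot,\cdot]$ on $Sec(\bar\pi)$; (2) a map $(\zeta,\boldsymbol{\sigma})\mapsto[\zeta,\boldsymbol{\sigma}]\in Sec(\bar\pi)$ for $\zeta\in Sec(\pi)$, $\boldsymbol{\sigma}\in Sec(\bar\pi)$ with $[\zeta,\boldsymbol{\sigma}_1+\boldsymbol{\sigma}_2]=[\zeta,\boldsymbol{\sigma}_1]+[\zeta,\boldsymbol{\sigma}_2]$ and $[\zeta+\boldsymbol{\sigma},\boldsymbol{\eta}]=[\zeta,\boldsymbol{\eta}]+[\boldsymbol{\sigma},\boldsymbol{\eta}]$; (3) an affine bundle map $\lambda:E\to J^1M$ over the identity with linear part $\rho:V\to VM$ such that $[\zeta,f\boldsymbol{\sigma}]=f[\zeta,\boldsymbol{\sigma}]+\lambda(\zeta)(f)\boldsymbol{\sigma}$ for all $f\in C^\infty(M)$ (and hence also $[\boldsymbol{\xi},f\boldsymbol{\sigma}]=f[\boldsymbol{\xi},\boldsymbol{\sigma}]+\rho(\boldsymbol{\xi})(f)\boldsymbol{\sigma}$).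 Here $\lambda(\zeta)$, $\rho(\boldsymbol{\sigma})$ are regarded as vector fields on $M$. (An affine Lie algebroid is such a structure which in addition satisfies the second displayed identity of the claim.) The bracket is extended by $[\boldsymbol{\sigma},\zeta]=-[\zeta,\boldsymbol{\sigma}]$ and, for $\zeta_1,\zeta_2\in Sec(\pi)$, $[\zeta_1,\zeta_2]=[\zeta_1,\zeta_2-\zeta_1]\in Sec(\bar\pi)$. A $k$-form on $Sec(\bar\pi)$ is a skew-symmetric $C^\infty(M)$-multilinear map $Sec(\bar\pi)^k\to C^\infty(M)$. A $k$-form on $Sec(\pi)$ ($k\ge1$) is a map $\omega:Sec(\pi)^k\to C^\infty(M)$ for which there exist a $k$-form $\boldsymbol{\omega}$ on $Sec(\bar\pi)$ and a map $\omega_0:Sec(\pi)\times Sec(\bar\pi)^{k-1}\to C^\infty(M)$ such that: (a) $\omega_0$ is skew-symmetric and $C^\infty(M)$-linear in its $k-1$ vector arguments; (b) $\omega_0(\zeta+\boldsymbol{\sigma},\boldsymbol{\zeta}_1,\ldots,\boldsymbol{\zeta}_{k-1})=\omega_0(\zeta,\boldsymbol{\zeta}_1,\ldots,\boldsymbol{\zeta}_{k-1})+\boldsymbol{\omega}(\boldsymbol{\sigma},\boldsymbol{\zeta}_1,\ldots,\boldsymbol{\zeta}_{k-1})$; (c) for any $\zeta_0\in Sec(\pi)$ and $\zeta_i=\zeta_0+\boldsymbol{\zeta}_i$: $\omega(\zeta_1,\ldots,\zeta_k)=\sum_{i=1}^k(-1)^{i-1}\omega_0(\zeta_0,\boldsymbol{\zeta}_1,\ldots,\widehat{\boldsymbol{\zeta}_i},\ldots,\boldsymbol{\zeta}_k)+\boldsymbol{\omega}(\boldsymbol{\zeta}_1,\ldots,\boldsymbol{\zeta}_k)$.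 A $0$-form is a function in $C^\infty(M)$. Evaluation on a vector section in the first argument: $\omega(\boldsymbol{\sigma},\zeta_2,\ldots,\zeta_k)=\omega(\zeta_1+\boldsymbol{\sigma},\zeta_2,\ldots,\zeta_k)-\omega(\zeta_1,\zeta_2,\ldots,\zeta_k)$, independent of the choice of $\zeta_1\in Sec(\pi)$. Exterior derivative: for a $k$-form $\omega$ on $Sec(\pi)$, $d\omega$ is the $(k+1)$-form $$d\omega(\zeta_1,\ldots,\zeta_{k+1})=\sum_{i=1}^{k+1}(-1)^{i-1}\lambda(\zeta_i)\big(\omega(\zeta_1,\ldots,\widehat{\zeta_i},\ldots,\zeta_{k+1})\big)+\sum_{1\le i<j\le k+1}(-1)^{i+j}\omega([\zeta_i,\zeta_j],\zeta_1,\ldots,\widehat{\zeta_i},\ldots,\widehat{\zeta_j},\ldots,\zeta_{k+1});$$ in particular $df(\zeta)=\lambda(\zeta)(f)$ for $f\in C^\infty(M)$. The condition $d^2=0$ means $d(d\omega)=0$ for all forms $\omega$ of all degrees $k\ge0$. *)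

theory Defs
  imports "HOL-Analysis.Analysis"
begin

section \<open>Smooth functions on open subsets of normed spaces\<close>

primrec Ck_on :: "nat \<Rightarrow> 'a::real_normed_vector set \<Rightarrow> ('a \<Rightarrow> 'b::real_normed_vector) \<Rightarrow> bool" where
  "Ck_on 0 S f \<longleftrightarrow> continuous_on S f"
| "Ck_on (Suc k) S f \<longleftrightarrow>
     (\<forall>x\<in>S. f differentiable (at x)) \<and> (\<forall>v. Ck_on k S (\<lambda>x. frechet_derivative f (at x) v))"

text \<open>Only used for finite-dimensional domains and open \<open>S\<close>, where this is the usual notion.\<close>

definition smooth_on :: "'a::real_normed_vector set \<Rightarrow> ('a \<Rightarrow> 'b::real_normed_vector) \<Rightarrow> bool" where
  "smooth_on S f \<longleftrightarrow> (\<forall>k. Ck_on k S f)"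


section \<open>Manifolds fibred over the real line\<close>

text \<open>
  The points of the manifold are all elements of the type \<open>'m\<close>, whose class carries the topology.
  A chart is a pair \<open>(W, c)\<close> of an open domain and a coordinate map; the values of \<open>c\<close> outside
  \<open>W\<close> are irrelevant.  The atlas need not be maximal.
\<close>

type_synonym ('m, 'a) chart = "'m set \<times> ('m \<Rightarrow> 'a)"

record ('m, 'a) fibred_mfd =
  charts :: "('m, 'a) chart set"
  time :: "'m \<Rightarrow> real"

definition smooth_manifold ::
    "('m::{t2_space,second_countable_topology}, 'a::euclidean_space, 'z) fibred_mfd_scheme \<Rightarrow> bool" where
  "smooth_manifold B \<longleftrightarrow>
     (\<forall>(W, c)\<in>charts B. open W \<and> open (c ` W) \<and> homeomorphism W (c ` W) c (inv_into W c)) \<and>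
     \<Union> (fst ` charts B) = UNIV \<and>
     (\<forall>(W, c)\<in>charts B. \<forall>(W', c')\<in>charts B. smooth_on (c ` (W \<inter> W')) (c' \<circ> inv_into W c))"

text \<open>Smoothness of a map defined on an open subset \<open>U\<close> of the manifold, respectively on
  \<open>U \<times> 'f\<close>, with values in a normed space.\<close>

definition smooth_map ::
    "('m, 'a::euclidean_space, 'z) fibred_mfd_scheme \<Rightarrow> 'm set \<Rightarrow> ('m \<Rightarrow> 'b::real_normed_vector) \<Rightarrow> bool" where
  "smooth_map B U g \<longleftrightarrow>
     (\<forall>(W, c)\<in>charts B. smooth_on (c ` (U \<inter> W)) (g \<circ> inv_into W c))"

definition smooth_map_times ::
    "('m, 'a::euclidean_space, 'z) fibred_mfd_scheme \<Rightarrow> 'm set \<Rightarrow>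
       ('m \<Rightarrow> 'f::real_normed_vector \<Rightarrow> 'b::real_normed_vector) \<Rightarrow> bool" where
  "smooth_map_times B U g \<longleftrightarrow>
     (\<forall>(W, c)\<in>charts B. smooth_on (c ` (U \<inter> W) \<times> UNIV) (\<lambda>(z, y). g (inv_into W c z) y))"

definition Cinf :: "('m, 'a::euclidean_space, 'z) fibred_mfd_scheme \<Rightarrow> ('m \<Rightarrow> real) set" where
  "Cinf B = {f. smooth_map B UNIV f}"

text \<open>
  A tangent vector at \<open>x\<close> is given by its components in all charts around \<open>x\<close>, subject to the
  usual transformation law.  The components in other charts are set to \<open>0\<close>, so that equality of
  tangent vectors is equality of functions.
\<close>

type_synonym ('m, 'a) tangent = "('m, 'a) chart \<Rightarrow> 'a"

definition tangent_space ::
    "('m, 'a::euclidean_space, 'z) fibred_mfd_scheme \<Rightarrow> 'm \<Rightarrow> ('m, 'a) tangent set" where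
  "tangent_space B x = {X.
     (\<forall>W c W' c'. (W, c) \<in> charts B \<longrightarrow> (W', c') \<in> charts B \<longrightarrow> x \<in> W \<longrightarrow> x \<in> W' \<longrightarrow>
        X (W', c') = frechet_derivative (c' \<circ> inv_into W c) (at (c x)) (X (W, c))) \<and>
     (\<forall>W c. (W, c) \<notin> charts B \<or> x \<notin> W \<longrightarrow> X (W, c) = 0)}"

text \<open>The derivative of a function along a tangent vector at \<open>x\<close>; by the chain rule it does not
  depend on the chart.\<close>

definition dir_deriv ::
    "('m, 'a::euclidean_space, 'z) fibred_mfd_scheme \<Rightarrow> 'm \<Rightarrow> ('m, 'a) tangent \<Rightarrow> ('m \<Rightarrow> real) \<Rightarrow> real" where
  "dir_deriv B x X f =
     (let (W, c) = (SOME ch. ch \<in> charts B \<and> x \<in> fst ch)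
      in frechet_derivative (f \<circ> inv_into W c) (at (c x)) (X (W, c)))"

definition fibred_manifold ::
    "('m::{t2_space,second_countable_topology}, 'a::euclidean_space, 'z) fibred_mfd_scheme \<Rightarrow> bool" where
  "fibred_manifold B \<longleftrightarrow>
     smooth_manifold B \<and> time B \<in> Cinf B \<and> surj (time B) \<and>
     (\<forall>x. (\<lambda>X. dir_deriv B x X (time B)) ` tangent_space B x = UNIV)"

definition vertical_space ::
    "('m, 'a::euclidean_space, 'z) fibred_mfd_scheme \<Rightarrow> 'm \<Rightarrow> ('m, 'a) tangent set" where
  "vertical_space B x = {X \<in> tangent_space B x. dir_deriv B x X (time B) = 0}"

definition jet_space ::
    "('m, 'a::euclidean_space, 'z) fibred_mfd_scheme \<Rightarrow> 'm \<Rightarrow> ('m, 'a) tangent set" where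
  "jet_space B x = {X \<in> tangent_space B x. dir_deriv B x X (time B) = 1}"


section \<open>Vector and affine bundles\<close>

text \<open>
  The total spaces are the types \<open>'v\<close> and \<open>'e\<close>; the fibrewise operations matter only on arguments
  in one fibre.  The typical fibre is a finite-dimensional inner product space \<open>'f\<close> rather than a
  \<open>euclidean_space\<close>, since the latter would exclude rank \<open>0\<close>.  The smooth structures of the total
  spaces are those determined by the local trivialisations; the fibrewise bijections \<open>vtriv\<close>
  transport the vector space axioms from \<open>'f\<close> to the fibres.
\<close>

record ('m, 'a, 'v, 'f) vec_bundle = "('m, 'a) fibred_mfd" +
  vproj :: "'v \<Rightarrow> 'm"
  vadd :: "'v \<Rightarrow> 'v \<Rightarrow> 'v"
  vscale :: "real \<Rightarrow> 'v \<Rightarrow> 'v"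
  vzero :: "'m \<Rightarrow> 'v"
  vtriv :: "('m set \<times> ('v \<Rightarrow> 'f)) set"

definition vfibre :: "('m, 'a, 'v, 'f, 'z) vec_bundle_scheme \<Rightarrow> 'm \<Rightarrow> 'v set" where
  "vfibre B x = {v. vproj B v = x}"

definition vector_bundle ::
    "('m::topological_space, 'a::euclidean_space, 'v, 'f::real_inner, 'z) vec_bundle_scheme \<Rightarrow> bool" where
  "vector_bundle B \<longleftrightarrow>
     (\<exists>S::'f set. finite S \<and> span S = UNIV) \<and>
     (\<forall>u v. vproj B u = vproj B v \<longrightarrow> vproj B (vadd B u v) = vproj B v) \<and>
     (\<forall>a v. vproj B (vscale B a v) = vproj B v) \<and>
     (\<forall>x. vproj B (vzero B x) = x) \<and>
     \<Union> (fst ` vtriv B) = UNIV \<and>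
     (\<forall>(U, \<phi>)\<in>vtriv B. open U \<and>
        (\<forall>x\<in>U. bij_betw \<phi> (vfibre B x) UNIV \<and>
           (\<forall>u\<in>vfibre B x. \<forall>v\<in>vfibre B x. \<phi> (vadd B u v) = \<phi> u + \<phi> v) \<and>
           (\<forall>a. \<forall>v\<in>vfibre B x. \<phi> (vscale B a v) = a *\<^sub>R \<phi> v) \<and>
           \<phi> (vzero B x) = 0)) \<and>
     (\<forall>(U, \<phi>)\<in>vtriv B. \<forall>(U', \<phi>')\<in>vtriv B.
        smooth_map_times B (U \<inter> U') (\<lambda>x y. \<phi>' (inv_into (vfibre B x) \<phi> y)))"

record ('m, 'a, 'v, 'f, 'e) aff_bundle = "('m, 'a, 'v, 'f) vec_bundle" +
  aproj :: "'e \<Rightarrow> 'm"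
  atrans :: "'e \<Rightarrow> 'v \<Rightarrow> 'e"
  atriv :: "('m set \<times> ('e \<Rightarrow> 'f)) set"

definition afibre :: "('m, 'a, 'v, 'f, 'e, 'z) aff_bundle_scheme \<Rightarrow> 'm \<Rightarrow> 'e set" where
  "afibre B x = {e. aproj B e = x}"

definition affine_bundle ::
    "('m::topological_space, 'a::euclidean_space, 'v, 'f::real_inner, 'e, 'z) aff_bundle_scheme \<Rightarrow> bool" where
  "affine_bundle B \<longleftrightarrow>
     vector_bundle B \<and>
     (\<forall>e v. aproj B e = vproj B v \<longrightarrow> aproj B (atrans B e v) = aproj B e) \<and>
     \<Union> (fst ` atriv B) = UNIV \<and>
     (\<forall>(U, \<psi>)\<in>atriv B. open U \<and>
        (\<forall>x\<in>U. bij_betw \<psi> (afibre B x) UNIV) \<and>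
        (\<exists>\<phi>. (U, \<phi>) \<in> vtriv B \<and>
           (\<forall>x\<in>U. \<forall>e\<in>afibre B x. \<forall>v\<in>vfibre B x. \<psi> (atrans B e v) = \<psi> e + \<phi> v))) \<and>
     (\<forall>(U, \<psi>)\<in>atriv B. \<forall>(U', \<psi>')\<in>atriv B.
        smooth_map_times B (U \<inter> U') (\<lambda>x y. \<psi>' (inv_into (afibre B x) \<psi> y)))"

definition vsec :: "('m, 'a::euclidean_space, 'v, 'f::real_inner, 'z) vec_bundle_scheme \<Rightarrow> ('m \<Rightarrow> 'v) set" where
  "vsec B = {\<sigma>. (\<forall>x. vproj B (\<sigma> x) = x) \<and> (\<forall>(U, \<phi>)\<in>vtriv B. smooth_map B U (\<phi> \<circ> \<sigma>))}"

definition asec :: "('m, 'a::euclidean_space, 'v, 'f::real_inner, 'e, 'z) aff_bundle_scheme \<Rightarrow> ('m \<Rightarrow> 'e) set" where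
  "asec B = {\<zeta>. (\<forall>x. aproj B (\<zeta> x) = x) \<and> (\<forall>(U, \<psi>)\<in>atriv B. smooth_map B U (\<psi> \<circ> \<zeta>))}"

definition sadd :: "('m, 'a, 'v, 'f, 'z) vec_bundle_scheme \<Rightarrow> ('m \<Rightarrow> 'v) \<Rightarrow> ('m \<Rightarrow> 'v) \<Rightarrow> 'm \<Rightarrow> 'v" where
  "sadd B \<sigma> \<eta> x = vadd B (\<sigma> x) (\<eta> x)"

definition sscale :: "('m, 'a, 'v, 'f, 'z) vec_bundle_scheme \<Rightarrow> ('m \<Rightarrow> real) \<Rightarrow> ('m \<Rightarrow> 'v) \<Rightarrow> 'm \<Rightarrow> 'v" where
  "sscale B f \<sigma> x = vscale B (f x) (\<sigma> x)"

definition sneg :: "('m, 'a, 'v, 'f, 'z) vec_bundle_scheme \<Rightarrow> ('m \<Rightarrow> 'v) \<Rightarrow> 'm \<Rightarrow> 'v" where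
  "sneg B \<sigma> = sscale B (\<lambda>_. - 1) \<sigma>"

definition strans :: "('m, 'a, 'v, 'f, 'e, 'z) aff_bundle_scheme \<Rightarrow> ('m \<Rightarrow> 'e) \<Rightarrow> ('m \<Rightarrow> 'v) \<Rightarrow> 'm \<Rightarrow> 'e" where
  "strans B \<zeta> \<sigma> x = atrans B (\<zeta> x) (\<sigma> x)"

text \<open>\<open>sdiff B \<zeta>\<^sub>2 \<zeta>\<^sub>1\<close> is the difference \<open>\<zeta>\<^sub>2 - \<zeta>\<^sub>1\<close>.\<close>

definition sdiff :: "('m, 'a, 'v, 'f, 'e, 'z) aff_bundle_scheme \<Rightarrow> ('m \<Rightarrow> 'e) \<Rightarrow> ('m \<Rightarrow> 'e) \<Rightarrow> 'm \<Rightarrow> 'v" where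
  "sdiff B \<zeta>\<^sub>2 \<zeta>\<^sub>1 x = (THE v. v \<in> vfibre B x \<and> atrans B (\<zeta>\<^sub>1 x) v = \<zeta>\<^sub>2 x)"


section \<open>Leibniz bracket structures\<close>

record ('m, 'a, 'v, 'f, 'e) leib_bundle = "('m, 'a, 'v, 'f, 'e) aff_bundle" +
  anchor :: "'e \<Rightarrow> ('m, 'a) tangent"
  lanchor :: "'v \<Rightarrow> ('m, 'a) tangent"
  vbr :: "('m \<Rightarrow> 'v) \<Rightarrow> ('m \<Rightarrow> 'v) \<Rightarrow> 'm \<Rightarrow> 'v"
  abr :: "('m \<Rightarrow> 'e) \<Rightarrow> ('m \<Rightarrow> 'v) \<Rightarrow> 'm \<Rightarrow> 'v"

text \<open>
  Smoothness of \<open>anchor\<close> is smoothness of its components in the charts of the tangent bundle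
  induced by \<open>charts B\<close>.  Smoothness of the linear part \<open>lanchor\<close> follows from it.
\<close>

definition affine_anchor ::
    "('m, 'a::euclidean_space, 'v, 'f::real_inner, 'e, 'z) leib_bundle_scheme \<Rightarrow> bool" where
  "affine_anchor B \<longleftrightarrow>
     (\<forall>e. anchor B e \<in> jet_space B (aproj B e)) \<and>
     (\<forall>v. lanchor B v \<in> vertical_space B (vproj B v)) \<and>
     (\<forall>u v ch. vproj B u = vproj B v \<longrightarrow> lanchor B (vadd B u v) ch = lanchor B u ch + lanchor B v ch) \<and>
     (\<forall>a v ch. lanchor B (vscale B a v) ch = a *\<^sub>R lanchor B v ch) \<and>
     (\<forall>e v ch. aproj B e = vproj B v \<longrightarrow> anchor B (atrans B e v) ch = anchor B e ch + lanchor B v ch) \<and>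
     (\<forall>(U, \<psi>)\<in>atriv B. \<forall>(W, c)\<in>charts B.
        smooth_map_times B (U \<inter> W) (\<lambda>x y. anchor B (inv_into (afibre B x) \<psi> y) (W, c)))"

text \<open>The function \<open>\<lambda>(\<zeta>)(f)\<close>.\<close>

definition anchor_act ::
    "('m, 'a::euclidean_space, 'v, 'f, 'e, 'z) leib_bundle_scheme \<Rightarrow> ('m \<Rightarrow> 'e) \<Rightarrow> ('m \<Rightarrow> real) \<Rightarrow> 'm \<Rightarrow> real" where
  "anchor_act B \<zeta> f x = dir_deriv B x (anchor B (\<zeta> x)) f"

definition leibniz_bracket_bundle ::
    "('m::{t2_space,second_countable_topology}, 'a::euclidean_space, 'v, 'f::real_inner, 'e, 'z) leib_bundle_scheme \<Rightarrow> bool" where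
  "leibniz_bracket_bundle B \<longleftrightarrow>
     fibred_manifold B \<and> affine_bundle B \<and>
     (\<forall>\<sigma>\<in>vsec B. \<forall>\<eta>\<in>vsec B. vbr B \<sigma> \<eta> \<in> vsec B \<and> vbr B \<sigma> \<eta> = sneg B (vbr B \<eta> \<sigma>)) \<and>
     (\<forall>\<sigma>\<in>vsec B. \<forall>\<sigma>'\<in>vsec B. \<forall>\<eta>\<in>vsec B.
        vbr B (sadd B \<sigma> \<sigma>') \<eta> = sadd B (vbr B \<sigma> \<eta>) (vbr B \<sigma>' \<eta>) \<and>
        vbr B \<eta> (sadd B \<sigma> \<sigma>') = sadd B (vbr B \<eta> \<sigma>) (vbr B \<eta> \<sigma>')) \<and>
     (\<forall>a. \<forall>\<sigma>\<in>vsec B. \<forall>\<eta>\<in>vsec B.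
        vbr B (sscale B (\<lambda>_. a) \<sigma>) \<eta> = sscale B (\<lambda>_. a) (vbr B \<sigma> \<eta>) \<and>
        vbr B \<eta> (sscale B (\<lambda>_. a) \<sigma>) = sscale B (\<lambda>_. a) (vbr B \<eta> \<sigma>)) \<and>
     (\<forall>\<zeta>\<in>asec B. \<forall>\<sigma>\<in>vsec B. abr B \<zeta> \<sigma> \<in> vsec B) \<and>
     (\<forall>\<zeta>\<in>asec B. \<forall>\<sigma>\<^sub>1\<in>vsec B. \<forall>\<sigma>\<^sub>2\<in>vsec B.
        abr B \<zeta> (sadd B \<sigma>\<^sub>1 \<sigma>\<^sub>2) = sadd B (abr B \<zeta> \<sigma>\<^sub>1) (abr B \<zeta> \<sigma>\<^sub>2)) \<and>
     (\<forall>\<zeta>\<in>asec B. \<forall>\<sigma>\<in>vsec B. \<forall>\<eta>\<in>vsec B.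
        abr B (strans B \<zeta> \<sigma>) \<eta> = sadd B (abr B \<zeta> \<eta>) (vbr B \<sigma> \<eta>)) \<and>
     affine_anchor B \<and>
     (\<forall>\<zeta>\<in>asec B. \<forall>\<sigma>\<in>vsec B. \<forall>f\<in>Cinf B.
        abr B \<zeta> (sscale B f \<sigma>) = sadd B (sscale B f (abr B \<zeta> \<sigma>)) (sscale B (anchor_act B \<zeta> f) \<sigma>))"

text \<open>The extended brackets \<open>[\<sigma>, \<zeta>]\<close> and \<open>[\<zeta>\<^sub>1, \<zeta>\<^sub>2]\<close>.\<close>

definition vabr ::
    "('m, 'a, 'v, 'f, 'e, 'z) leib_bundle_scheme \<Rightarrow> ('m \<Rightarrow> 'v) \<Rightarrow> ('m \<Rightarrow> 'e) \<Rightarrow> 'm \<Rightarrow> 'v" where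
  "vabr B \<sigma> \<zeta> = sneg B (abr B \<zeta> \<sigma>)"

definition aabr ::
    "('m, 'a, 'v, 'f, 'e, 'z) leib_bundle_scheme \<Rightarrow> ('m \<Rightarrow> 'e) \<Rightarrow> ('m \<Rightarrow> 'e) \<Rightarrow> 'm \<Rightarrow> 'v" where
  "aabr B \<zeta>\<^sub>1 \<zeta>\<^sub>2 = abr B \<zeta>\<^sub>1 (sdiff B \<zeta>\<^sub>2 \<zeta>\<^sub>1)"

definition jacobi_affine ::
    "('m, 'a::euclidean_space, 'v, 'f::real_inner, 'e, 'z) leib_bundle_scheme \<Rightarrow> bool" where
  "jacobi_affine B \<longleftrightarrow>
     (\<forall>\<zeta>\<^sub>1\<in>asec B. \<forall>\<zeta>\<^sub>2\<in>asec B. \<forall>\<zeta>\<^sub>3\<in>asec B.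
        sadd B (sadd B (vabr B (aabr B \<zeta>\<^sub>1 \<zeta>\<^sub>2) \<zeta>\<^sub>3) (vabr B (aabr B \<zeta>\<^sub>2 \<zeta>\<^sub>3) \<zeta>\<^sub>1))
          (vabr B (aabr B \<zeta>\<^sub>3 \<zeta>\<^sub>1) \<zeta>\<^sub>2) = vzero B)"

definition jacobi_mixed ::
    "('m, 'a::euclidean_space, 'v, 'f::real_inner, 'e, 'z) leib_bundle_scheme \<Rightarrow> bool" where
  "jacobi_mixed B \<longleftrightarrow>
     (\<forall>\<zeta>\<in>asec B. \<forall>\<sigma>\<in>vsec B. \<forall>\<eta>\<in>vsec B.
        abr B \<zeta> (vbr B \<sigma> \<eta>) = sadd B (vbr B (abr B \<zeta> \<sigma>) \<eta>) (vbr B \<sigma> (abr B \<zeta> \<eta>)))"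


section \<open>Forms and the exterior derivative\<close>

text \<open>
  Maps of \<open>k\<close> section arguments are functions on lists; only their values on lists of length \<open>k\<close>
  of sections matter.  Positions are counted from \<open>0\<close>, which turns the sign \<open>(-1)\<^sup>i\<^sup>-\<^sup>1\<close> of
  position \<open>i\<close> counted from \<open>1\<close> into \<open>(-1)\<^sup>i\<close> and leaves \<open>(-1)\<^sup>i\<^sup>+\<^sup>j\<close> unchanged.
\<close>

definition omit :: "nat \<Rightarrow> 'b list \<Rightarrow> 'b list" where
  "omit i xs = take i xs @ drop (Suc i) xs"

definition tuples :: "nat \<Rightarrow> 'b set \<Rightarrow> 'b list set" where
  "tuples k S = {xs. length xs = k \<and> set xs \<subseteq> S}"

definition vform ::
    "('m, 'a::euclidean_space, 'v, 'f::real_inner, 'z) vec_bundle_scheme \<Rightarrow> nat \<Rightarrow>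
       (('m \<Rightarrow> 'v) list \<Rightarrow> 'm \<Rightarrow> real) \<Rightarrow> bool" where
  "vform B k \<omega> \<longleftrightarrow>
     (\<forall>\<sigma>s\<in>tuples k (vsec B). \<omega> \<sigma>s \<in> Cinf B) \<and>
     (\<forall>\<sigma>s\<in>tuples k (vsec B). \<forall>i<k. \<forall>j<k. i \<noteq> j \<longrightarrow>
        (\<forall>x. \<omega> (\<sigma>s[i := \<sigma>s ! j, j := \<sigma>s ! i]) x = - \<omega> \<sigma>s x)) \<and>
     (\<forall>\<sigma>s\<in>tuples k (vsec B). \<forall>i<k. \<forall>\<sigma>\<in>vsec B. \<forall>\<eta>\<in>vsec B. \<forall>x.
        \<omega> (\<sigma>s[i := sadd B \<sigma> \<eta>]) x = \<omega> (\<sigma>s[i := \<sigma>]) x + \<omega> (\<sigma>s[i := \<eta>]) x) \<and>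
     (\<forall>\<sigma>s\<in>tuples k (vsec B). \<forall>i<k. \<forall>\<sigma>\<in>vsec B. \<forall>f\<in>Cinf B. \<forall>x.
        \<omega> (\<sigma>s[i := sscale B f \<sigma>]) x = f x * \<omega> (\<sigma>s[i := \<sigma>]) x)"

text \<open>Condition (a) on \<open>\<omega>\<^sub>0\<close> says that \<open>\<omega>\<^sub>0 \<zeta>\<close> is a form of degree \<open>k - 1\<close> on the vector sections for
  every \<open>\<zeta>\<close>.  A form of degree \<open>0\<close> is the function \<open>\<omega> []\<close>.\<close>

definition aform ::
    "('m, 'a::euclidean_space, 'v, 'f::real_inner, 'e, 'z) aff_bundle_scheme \<Rightarrow> nat \<Rightarrow>
       (('m \<Rightarrow> 'e) list \<Rightarrow> 'm \<Rightarrow> real) \<Rightarrow> bool" where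
  "aform B k \<omega> \<longleftrightarrow>
     (if k = 0 then \<omega> [] \<in> Cinf B
      else \<exists>\<omega>v \<omega>\<^sub>0. vform B k \<omega>v \<and>
        (\<forall>\<zeta>\<in>asec B. vform B (k - 1) (\<omega>\<^sub>0 \<zeta>)) \<and>
        (\<forall>\<zeta>\<in>asec B. \<forall>\<sigma>\<in>vsec B. \<forall>\<sigma>s\<in>tuples (k - 1) (vsec B). \<forall>x.
           \<omega>\<^sub>0 (strans B \<zeta> \<sigma>) \<sigma>s x = \<omega>\<^sub>0 \<zeta> \<sigma>s x + \<omega>v (\<sigma> # \<sigma>s) x) \<and>
        (\<forall>\<zeta>\<in>asec B. \<forall>\<sigma>s\<in>tuples k (vsec B). \<forall>x.
           \<omega> (map (strans B \<zeta>) \<sigma>s) x =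
             (\<Sum>i<k. (- 1) ^ i * \<omega>\<^sub>0 \<zeta> (omit i \<sigma>s) x) + \<omega>v \<sigma>s x))"

text \<open>Evaluation with a vector section as first argument; for a form the result does not depend on
  the chosen affine section.\<close>

definition eval_vec ::
    "('m, 'a::euclidean_space, 'v, 'f::real_inner, 'e, 'z) aff_bundle_scheme \<Rightarrow>
       (('m \<Rightarrow> 'e) list \<Rightarrow> 'm \<Rightarrow> real) \<Rightarrow> ('m \<Rightarrow> 'v) \<Rightarrow> ('m \<Rightarrow> 'e) list \<Rightarrow> 'm \<Rightarrow> real" where
  "eval_vec B \<omega> \<sigma> \<zeta>s x =
     (let \<zeta> = (SOME \<zeta>. \<zeta> \<in> asec B) in \<omega> (strans B \<zeta> \<sigma> # \<zeta>s) x - \<omega> (\<zeta> # \<zeta>s) x)"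

text \<open>The degree of the argument is read off from the number of sections it is evaluated on.\<close>

definition ext_deriv ::
    "('m, 'a::euclidean_space, 'v, 'f::real_inner, 'e, 'z) leib_bundle_scheme \<Rightarrow>
       (('m \<Rightarrow> 'e) list \<Rightarrow> 'm \<Rightarrow> real) \<Rightarrow> ('m \<Rightarrow> 'e) list \<Rightarrow> 'm \<Rightarrow> real" where
  "ext_deriv B \<omega> \<zeta>s x =
     (\<Sum>i<length \<zeta>s. (- 1) ^ i * anchor_act B (\<zeta>s ! i) (\<omega> (omit i \<zeta>s)) x) +
     (\<Sum>j<length \<zeta>s. \<Sum>i<j.
        (- 1) ^ (i + j) * eval_vec B \<omega> (aabr B (\<zeta>s ! i) (\<zeta>s ! j)) (omit i (omit j \<zeta>s)) x)"

definition ext_deriv_squared_zero ::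
    "('m, 'a::euclidean_space, 'v, 'f::real_inner, 'e, 'z) leib_bundle_scheme \<Rightarrow> bool" where
  "ext_deriv_squared_zero B \<longleftrightarrow>
     (\<forall>k \<omega>. aform B k \<omega> \<longrightarrow>
        (\<forall>\<zeta>s\<in>tuples (k + 2) (asec B). \<forall>x. ext_deriv B (ext_deriv B \<omega>) \<zeta>s x = 0))"

end

theory Submission
  imports Defs
begin

text \<open>
  Fix an affine section \<open>\<zeta>\<^sub>0\<close>; without one all three conditions hold vacuously.  The formal combinations
  \<open>a \<zeta>\<^sub>0 + \<sigma>\<close> form a vector space, the hull, in which the affine sections are the hyperplane \<open>a = 1\<close> and the
  vector sections the subspace \<open>a = 0\<close>.  Bracket and anchor extend to the hull by linearity.  The point of
  the hull is that a form on the affine sections is the restriction of an alternating additive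
  cochain on the hull (\<open>form_extension\<close>), and that the exterior derivative is the restriction of the
  Chevalley-Eilenberg differential of the hull acting on functions (\<open>ext_deriv_extension\<close>).  The
  asymmetry between affine and vector arguments disappears.

  For the Chevalley-Eilenberg differential one has Cartan's calculus.  Taking the formula
  \<open>\<iota>\<^sub>X d = L\<^sub>X - d \<iota>\<^sub>X\<close> as a recursive definition of \<open>d\<close>, the Jacobi identity and the compatibility of the
  action with the bracket give \<open>L\<^sub>X d = d L\<^sub>X\<close>, and then \<open>d\<^sup>2 = 0\<close>, by induction on the number of
  arguments (\<open>cdiff_cdiff_zero\<close>).  The mixed Jacobi identity implies the Jacobi identity of the hull
  (\<open>hull_jacobi\<close>).  It also implies the compatibility of the anchor with brackets: replacing \<open>\<sigma>\<close> by
  \<open>f \<sigma>\<close> and using the Leibniz rule leaves the defect of the anchor times \<open>\<sigma>\<close>, and in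
  positive rank some section \<open>\<sigma>\<close> does not vanish at the given point (\<open>anchor_morphism\<close>).

  Conversely, \<open>d\<^sup>2\<close> on functions is the defect of the anchor, and \<open>d\<^sup>2\<close> on \<open>1\<close>-forms is, once that
  defect vanishes, the value of the form on the Jacobiator (\<open>cdiff_cdiff_triple\<close>).  As \<open>1\<close>-forms separate
  points of the fibres, \<open>d\<^sup>2 = 0\<close> implies the Jacobi identity for affine sections
  (\<open>ext_deriv_squared_zero_imp_jacobi\<close>).  Evaluating the latter on \<open>\<zeta>\<^sub>0\<close>, \<open>\<zeta>\<^sub>0 + \<sigma>\<close>, \<open>\<zeta>\<^sub>0 + \<eta>\<close> yields the mixed
  identity, which closes the circle.

  All of this is algebra, and analysis enters twice.  Functions must stay smooth under
  \<open>\<lambda>(\<zeta>)\<close>, which needs the calculus of smooth maps and the chain rule; and both sections that do not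
  vanish at a point and separating \<open>1\<close>-forms are built from bump functions.
\<close>

section \<open>Calculus of smooth functions\<close>

lemma Ck_on_subset: "Ck_on k S f \<Longrightarrow> T \<subseteq> S \<Longrightarrow> Ck_on k T f"
  by (induction k arbitrary: f) (auto intro: continuous_on_subset)

lemma Ck_on_Suc_imp: "Ck_on (Suc k) S f \<Longrightarrow> Ck_on k S f"
proof (induction k arbitrary: f)
  case 0
  then show ?case
    by (auto intro!: continuous_at_imp_continuous_on differentiable_imp_continuous_within)
next
  case (Suc k)
  from Suc.prems have "\<forall>x\<in>S. f differentiable (at x)"
    and "\<And>v. Ck_on (Suc k) S (\<lambda>x. frechet_derivative f (at x) v)"
    using Ck_on.simps(2)[of "Suc k" S f] by blast+
  then show ?case using Suc.IH by (simp only: Ck_on.simps(2)[of k S f]) blast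
qed

lemma frechet_derivative_cong_open:
  assumes "open S" "x \<in> S" "\<And>y. y \<in> S \<Longrightarrow> f y = g y"
  shows "frechet_derivative f (at x) = frechet_derivative g (at x)"
proof -
  have "(f has_derivative D) (at x) \<longleftrightarrow> (g has_derivative D) (at x)" for D
    using assms has_derivative_transform_within_open by metis
  then show ?thesis unfolding frechet_derivative_def by presburger
qed

lemma differentiable_cong_open:
  assumes "open S" "x \<in> S" "\<And>y. y \<in> S \<Longrightarrow> f y = g y" "f differentiable (at x)"
  shows "g differentiable (at x)"
  using assms unfolding differentiable_def by (metis has_derivative_transform_within_open)

lemma Ck_on_cong:
  assumes "open S" "\<And>x. x \<in> S \<Longrightarrow> f x = g x" "Ck_on k S f"
  shows "Ck_on k S g"
  using assms(2,3)
proof (induction k arbitrary: f g)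
  case 0
  then show ?case using continuous_on_cong by (metis Ck_on.simps(1))
next
  case (Suc k)
  have "g differentiable (at x)" if "x \<in> S" for x
    by (rule differentiable_cong_open[OF assms(1) that Suc.prems(1)]) (use Suc.prems that in auto)
  moreover have "Ck_on k S (\<lambda>x. frechet_derivative g (at x) v)" for v
    by (rule Suc.IH[of "\<lambda>x. frechet_derivative f (at x) v"])
      (use Suc.prems frechet_derivative_cong_open[OF assms(1) _ Suc.prems(1)] in auto)
  ultimately show ?case by simp
qed

lemma Ck_on_local:
  assumes "\<And>x. x \<in> S \<Longrightarrow> \<exists>T. open T \<and> x \<in> T \<and> Ck_on k T f"
  shows "Ck_on k S f"
  using assms
proof (induction k arbitrary: f)
  case 0
  show ?case
    unfolding Ck_on.simps
  proof (intro continuous_at_imp_continuous_on ballI)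
    fix x assume "x \<in> S"
    then obtain T where "open T" "x \<in> T" "continuous_on T f" using 0 by auto
    then show "isCont f x" using continuous_on_eq_continuous_at by blast
  qed
next
  case (Suc k)
  have "f differentiable (at x)" if "x \<in> S" for x
    using Suc.prems[OF that] by auto
  moreover have "Ck_on k S (\<lambda>x. frechet_derivative f (at x) v)" for v
    by (rule Suc.IH) (use Suc.prems in fastforce)
  ultimately show ?case by simp
qed

lemma Ck_on_const [simp]: "Ck_on k S (\<lambda>_. c)"
  by (induction k arbitrary: c) auto

lemma Ck_on_SucI:
  assumes "open S" "\<And>x. x \<in> S \<Longrightarrow> (f has_derivative f' x) (at x)"
    and "\<And>v. Ck_on k S (\<lambda>x. f' x v)"
  shows "Ck_on (Suc k) S f"
proof -
  have "f differentiable (at x)" if "x \<in> S" for x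
    using assms(2)[OF that] differentiable_def by blast
  moreover have "Ck_on k S (\<lambda>x. frechet_derivative f (at x) v)" for v
    by (rule Ck_on_cong[OF assms(1) _ assms(3)[of v]])
      (use frechet_derivative_at[OF assms(2)] in simp)
  ultimately show ?thesis by simp
qed

lemma Ck_on_Suc_has_derivative:
  "Ck_on (Suc k) S f \<Longrightarrow> x \<in> S \<Longrightarrow> (f has_derivative frechet_derivative f (at x)) (at x)"
  using frechet_derivative_works by auto

lemma Ck_on_bounded_linear_comp:
  assumes "bounded_linear L" "open S" "Ck_on k S f"
  shows "Ck_on k S (\<lambda>x. L (f x))"
  using assms(3)
proof (induction k arbitrary: f)
  case 0
  then show ?case using bounded_linear.continuous_on[OF assms(1)] by simp
next
  case (Suc k)
  show ?case
    by (rule Ck_on_SucI[OF assms(2)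
          bounded_linear.has_derivative[OF assms(1) Ck_on_Suc_has_derivative[OF Suc.prems]]])
      (use Suc in auto)
qed

lemma Ck_on_bounded_linear: "bounded_linear L \<Longrightarrow> open S \<Longrightarrow> Ck_on k S L"
proof (induction k)
  case 0
  then show ?case by (simp add: linear_continuous_on)
next
  case (Suc k)
  show ?case
    by (rule Ck_on_SucI[OF Suc.prems(2) bounded_linear.has_derivative[OF Suc.prems(1) has_derivative_ident]])
      simp
qed

lemma Ck_on_add:
  assumes "open S" "Ck_on k S f" "Ck_on k S g"
  shows "Ck_on k S (\<lambda>x. f x + g x)"
  using assms(2,3)
proof (induction k arbitrary: f g)
  case 0
  then show ?case by (simp add: continuous_on_add)
next
  case (Suc k)
  show ?case
    by (rule Ck_on_SucI[OF assms(1) has_derivative_add[OF Ck_on_Suc_has_derivative[OF Suc.prems(1)]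
            Ck_on_Suc_has_derivative[OF Suc.prems(2)]]])
      (use Suc in auto)
qed

lemma Ck_on_sum:
  assumes "open S" "\<And>i. i \<in> I \<Longrightarrow> Ck_on k S (f i)"
  shows "Ck_on k S (\<lambda>x. \<Sum>i\<in>I. f i x)"
  using assms(2) by (induction I rule: infinite_finite_induct) (auto intro: Ck_on_add[OF assms(1)])

lemma Ck_on_bilinear:
  assumes "bounded_bilinear P" "open S" "Ck_on k S f" "Ck_on k S g"
  shows "Ck_on k S (\<lambda>x. P (f x) (g x))"
  using assms(3,4)
proof (induction k arbitrary: f g)
  case 0
  then show ?case using bounded_bilinear.continuous_on[OF assms(1)] by simp
next
  case (Suc k)
  have "Ck_on k S f" "Ck_on k S g"
    using Suc.prems Ck_on_Suc_imp by blast+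
  then show ?case
    by (intro Ck_on_SucI[OF assms(2) bounded_bilinear.FDERIV[OF assms(1)
            Ck_on_Suc_has_derivative[OF Suc.prems(1)] Ck_on_Suc_has_derivative[OF Suc.prems(2)]]]
          Ck_on_add[OF assms(2)] Suc.IH)
      (use Suc.prems in auto)
qed

text \<open>
  The chain rule expresses the derivative of a composition through the partial derivatives of the
  outer function, so the inner function must take values in a space with a finite basis.  The
  typical fibre of a bundle is only an inner product space with a finite spanning set, and therefore
  the basis is carried explicitly, in the form of the expansion that an orthonormal basis provides.
\<close>

definition inner_frame :: "'a::real_inner set \<Rightarrow> bool" where
  "inner_frame C \<longleftrightarrow> finite C \<and> (\<forall>x. (\<Sum>b\<in>C. (x \<bullet> b) *\<^sub>R b) = x)"

lemma inner_frame_expand: "inner_frame C \<Longrightarrow> (\<Sum>b\<in>C. (x \<bullet> b) *\<^sub>R b) = x"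
  by (simp add: inner_frame_def)

lemma inner_frame_Basis: "inner_frame (Basis :: 'a::euclidean_space set)"
  by (simp add: inner_frame_def euclidean_representation)

text \<open>Removing \<open>0\<close> from the second frame keeps the two images disjoint.\<close>

lemma inner_frame_Times:
  assumes "inner_frame C" "inner_frame D"
  shows "inner_frame ((\<lambda>b. (b, 0)) ` C \<union> Pair 0 ` (D - {0}))"
proof -
  have C: "finite C" "\<And>x. (\<Sum>b\<in>C. (x \<bullet> b) *\<^sub>R b) = x"
    and D: "finite D" "\<And>x. (\<Sum>b\<in>D. (x \<bullet> b) *\<^sub>R b) = x"
    using assms by (auto simp: inner_frame_expand) (auto simp: inner_frame_def)
  have D': "(\<Sum>b\<in>D-{0}. (x \<bullet> b) *\<^sub>R b) = x" for x
    using D by (subst sum.mono_neutral_left[of D]) auto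
  have "(\<Sum>b\<in>(\<lambda>b. (b, 0)) ` C \<union> Pair 0 ` (D - {0}). ((x, y) \<bullet> b) *\<^sub>R b) = (x, y)" for x y
  proof -
    have "(\<Sum>b\<in>(\<lambda>b. (b, 0)) ` C \<union> Pair 0 ` (D - {0}). ((x, y) \<bullet> b) *\<^sub>R b) =
        (\<Sum>b\<in>(\<lambda>b. (b, 0)) ` C. ((x, y) \<bullet> b) *\<^sub>R b) + (\<Sum>b\<in>Pair 0 ` (D - {0}). ((x, y) \<bullet> b) *\<^sub>R b)"
      using C D by (intro sum.union_disjoint) auto
    also have "\<dots> = (\<Sum>b\<in>C. ((x \<bullet> b) *\<^sub>R b, 0)) + (\<Sum>b\<in>D - {0}. (0, (y \<bullet> b) *\<^sub>R b))"
      by (subst sum.reindex, force simp: inj_on_def, subst sum.reindex) (auto simp: inj_on_def)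
    also have "\<dots> = (\<Sum>b\<in>C. (x \<bullet> b) *\<^sub>R b, \<Sum>b\<in>D - {0}. (y \<bullet> b) *\<^sub>R b)"
      by (simp add: prod_eq_iff fst_sum snd_sum)
    finally show ?thesis using C D' by simp
  qed
  then show ?thesis using C(1) D(1) by (auto simp: inner_frame_def)
qed

lemma inner_frame_exists:
  assumes "finite (S :: 'a::real_inner set)" "span S = UNIV"
  shows "\<exists>C :: 'a set. inner_frame C"
proof -
  obtain D where D: "finite D" "span D = (UNIV :: 'a set)" "pairwise orthogonal D"
    using basis_orthogonal[OF assms(1)] assms(2) by metis
  define e where "e = (\<lambda>b :: 'a. b /\<^sub>R norm b)"
  define P where "P = (\<lambda>x. \<Sum>b\<in>D - {0}. (x \<bullet> e b) *\<^sub>R e b)"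
  have ortho: "a \<bullet> b = 0" if "a \<in> D" "b \<in> D" "a \<noteq> b" for a b
    using that D(3) by (meson orthogonal_def pairwiseD)
  have inj: "inj_on e (D - {0})"
  proof
    fix a b assume ab: "a \<in> D - {0}" "b \<in> D - {0}" "e a = e b"
    show "a = b"
    proof (rule ccontr)
      assume "a \<noteq> b"
      then have "e a \<bullet> e b = 0" using ortho ab(1,2) unfolding e_def by simp
      then have "e a \<bullet> e a = 0" unfolding ab(3)[symmetric] .
      then show False using ab(1) unfolding e_def by simp
    qed
  qed
  have lin: "linear P"
    unfolding P_def
    by (intro linearI)
      (simp_all only: inner_add_left scaleR_add_left sum.distrib inner_scaleR_left scaleR_sum_right scaleR_scaleR)
  have "P a = a" if "a \<in> D" for a
  proof (cases "a = 0")
    case True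
    then show ?thesis using linear_0[OF lin] by simp
  next
    case False
    have "P a = (\<Sum>b\<in>{a}. (a \<bullet> e b) *\<^sub>R e b)"
      unfolding P_def
    proof (rule sum.mono_neutral_right)
      show "\<forall>b\<in>D - {0} - {a}. (a \<bullet> e b) *\<^sub>R e b = 0"
        using ortho[OF that] unfolding e_def by auto
    qed (use that False D(1) in auto)
    also have "\<dots> = (a \<bullet> e a) *\<^sub>R e a" by simp
    also have "a \<bullet> e a = norm a"
      using False unfolding e_def inner_scaleR_right dot_square_norm power2_eq_square by simp
    also have "norm a *\<^sub>R e a = a" using False unfolding e_def by simp
    finally show ?thesis .
  qed
  then have "P x = x" for x
    using linear_eq_on[OF lin linear_ident, of x D] D(2) by auto
  moreover have "(\<Sum>b\<in>e ` (D - {0}). (x \<bullet> b) *\<^sub>R b) = P x" for x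
    unfolding P_def sum.reindex[OF inj] o_def ..
  ultimately show ?thesis using D(1) unfolding inner_frame_def by (intro exI[of _ "e ` (D - {0})"]) simp
qed

lemma Ck_on_compose:
  fixes g :: "'a::real_normed_vector \<Rightarrow> 'b::real_inner" and h :: "'b \<Rightarrow> 'c::real_normed_vector"
    and C :: "'b set"
  assumes C: "inner_frame C" and S: "open S" and ST: "g ` S \<subseteq> T"
    and "Ck_on k T h" "Ck_on k S g"
  shows "Ck_on k S (\<lambda>x. h (g x))"
  using assms(4,5)
proof (induction k arbitrary: h)
  case 0
  then show ?case using ST by (auto intro: continuous_on_compose2)
next
  case (Suc k)
  let ?h = "\<lambda>y. frechet_derivative h (at y)" and ?g = "\<lambda>x. frechet_derivative g (at x)"
  have D: "((\<lambda>x. h (g x)) has_derivative (\<lambda>v. \<Sum>b\<in>C. (?g x v \<bullet> b) *\<^sub>R ?h (g x) b)) (at x)"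
    if "x \<in> S" for x
  proof -
    have Dh: "(h has_derivative ?h (g x)) (at (g x))"
      using Suc.prems(1) ST that by (intro Ck_on_Suc_has_derivative) auto
    have expand: "?h (g x) w = (\<Sum>b\<in>C. (w \<bullet> b) *\<^sub>R ?h (g x) b)" for w
    proof -
      interpret linear "?h (g x)" using Dh has_derivative_linear by blast
      have "(\<Sum>b\<in>C. (w \<bullet> b) *\<^sub>R ?h (g x) b) = ?h (g x) (\<Sum>b\<in>C. (w \<bullet> b) *\<^sub>R b)"
        by (simp add: sum scaleR)
      then show ?thesis unfolding inner_frame_expand[OF C] by (rule sym)
    qed
    have "?h (g x) \<circ> ?g x = (\<lambda>v. \<Sum>b\<in>C. (?g x v \<bullet> b) *\<^sub>R ?h (g x) b)"
      by (rule ext) (unfold o_apply, rule expand)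
    then show ?thesis
      using diff_chain_at[OF Ck_on_Suc_has_derivative[OF Suc.prems(2) that] Dh]
      by (simp only: o_def)
  qed
  have "Ck_on k S g" using Suc.prems(2) Ck_on_Suc_imp by blast
  then have "Ck_on k S (\<lambda>x. ?h (g x) b)" for b
    using Suc.prems(1) by (intro Suc.IH) auto
  moreover have "Ck_on k S (\<lambda>x. ?g x v \<bullet> b)" for v b
    by (rule Ck_on_bounded_linear_comp[OF bounded_linear_inner_left S]) (use Suc.prems(2) in simp)
  ultimately have "Ck_on k S (\<lambda>x. \<Sum>b\<in>C. (?g x v \<bullet> b) *\<^sub>R ?h (g x) b)" for v
    by (intro Ck_on_sum[OF S] Ck_on_bilinear[OF bounded_bilinear_scaleR S])
  with D show ?case
    by (intro Ck_on_SucI[OF S, of "\<lambda>x. h (g x)" "\<lambda>x v. \<Sum>b\<in>C. (?g x v \<bullet> b) *\<^sub>R ?h (g x) b"])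
qed

lemma Ck_on_Pair:
  fixes f :: "'a::real_normed_vector \<Rightarrow> 'b::real_inner" and g :: "'a \<Rightarrow> 'c::real_inner"
  assumes "open S" "Ck_on k S f" "Ck_on k S g"
  shows "Ck_on k S (\<lambda>x. (f x, g x))"
proof -
  have "Ck_on k S (\<lambda>x. (f x, 0) + (0, g x))"
    using assms by (intro Ck_on_add Ck_on_bounded_linear_comp[of "\<lambda>y. (y, 0)"]
        Ck_on_bounded_linear_comp[of "Pair 0"]) 
      (auto intro!: bounded_linear_Pair bounded_linear_ident bounded_linear_zero)
  then show ?thesis by simp
qed

lemma smooth_on_subset: "smooth_on S f \<Longrightarrow> T \<subseteq> S \<Longrightarrow> smooth_on T f"
  unfolding smooth_on_def using Ck_on_subset by blast

lemma smooth_on_cong: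
  "open S \<Longrightarrow> (\<And>x. x \<in> S \<Longrightarrow> f x = g x) \<Longrightarrow> smooth_on S f \<Longrightarrow> smooth_on S g"
  unfolding smooth_on_def using Ck_on_cong by blast

lemma smooth_on_local:
  assumes "\<And>x. x \<in> S \<Longrightarrow> \<exists>T. open T \<and> x \<in> T \<and> smooth_on T f"
  shows "smooth_on S f"
  unfolding smooth_on_def
proof
  fix k show "Ck_on k S f"
    by (rule Ck_on_local) (use assms in \<open>auto simp: smooth_on_def\<close>)
qed

lemma smooth_on_const [simp]: "smooth_on S (\<lambda>_. c)"
  by (simp add: smooth_on_def)

lemma smooth_on_bounded_linear_comp:
  "bounded_linear L \<Longrightarrow> open S \<Longrightarrow> smooth_on S f \<Longrightarrow> smooth_on S (\<lambda>x. L (f x))"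
  unfolding smooth_on_def using Ck_on_bounded_linear_comp by blast

lemma smooth_on_ident: "open S \<Longrightarrow> smooth_on S (\<lambda>x. x)"
  unfolding smooth_on_def using Ck_on_bounded_linear[OF bounded_linear_ident] by blast

lemma smooth_on_add:
  "open S \<Longrightarrow> smooth_on S f \<Longrightarrow> smooth_on S g \<Longrightarrow> smooth_on S (\<lambda>x. f x + g x)"
  unfolding smooth_on_def using Ck_on_add by blast

lemma smooth_on_bilinear:
  "bounded_bilinear P \<Longrightarrow> open S \<Longrightarrow> smooth_on S f \<Longrightarrow> smooth_on S g \<Longrightarrow>
    smooth_on S (\<lambda>x. P (f x) (g x))"
  unfolding smooth_on_def using Ck_on_bilinear by blast

lemma smooth_on_sum:
  "open S \<Longrightarrow> (\<And>i. i \<in> I \<Longrightarrow> smooth_on S (f i)) \<Longrightarrow> smooth_on S (\<lambda>x. \<Sum>i\<in>I. f i x)"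
  unfolding smooth_on_def by (intro allI Ck_on_sum) auto

lemma smooth_on_compose:
  fixes g :: "'a::real_normed_vector \<Rightarrow> 'b::real_inner" and h :: "'b \<Rightarrow> 'c::real_normed_vector"
  assumes "inner_frame (C :: 'b set)" "open S" "g ` S \<subseteq> T" "smooth_on T h" "smooth_on S g"
  shows "smooth_on S (\<lambda>x. h (g x))"
  using assms Ck_on_compose[OF assms(1-3)] unfolding smooth_on_def by blast

lemma smooth_on_Pair:
  fixes f :: "'a::real_normed_vector \<Rightarrow> 'b::real_inner" and g :: "'a \<Rightarrow> 'c::real_inner"
  shows "open S \<Longrightarrow> smooth_on S f \<Longrightarrow> smooth_on S g \<Longrightarrow> smooth_on S (\<lambda>x. (f x, g x))"
  unfolding smooth_on_def using Ck_on_Pair by blast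

lemma smooth_on_partial_derivative:
  "smooth_on S f \<Longrightarrow> smooth_on S (\<lambda>x. frechet_derivative f (at x) v)"
  unfolding smooth_on_def using Ck_on.simps(2) by blast

lemma smooth_on_has_derivative:
  "smooth_on S f \<Longrightarrow> x \<in> S \<Longrightarrow> (f has_derivative frechet_derivative f (at x)) (at x)"
  unfolding smooth_on_def using Ck_on_Suc_has_derivative by blast

lemma smooth_on_frechet_derivative:
  fixes f :: "'a::euclidean_space \<Rightarrow> 'b::real_normed_vector"
  assumes "open S" "smooth_on S f" "smooth_on S X"
  shows "smooth_on S (\<lambda>x. frechet_derivative f (at x) (X x))"
proof (rule smooth_on_cong[OF assms(1)])
  show "smooth_on S (\<lambda>x. \<Sum>b\<in>Basis. (X x \<bullet> b) *\<^sub>R frechet_derivative f (at x) b)"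
    by (intro smooth_on_sum smooth_on_bilinear[OF bounded_bilinear_scaleR] smooth_on_partial_derivative
        smooth_on_bounded_linear_comp[OF bounded_linear_inner_left] assms)
next
  fix x assume "x \<in> S"
  then interpret linear "frechet_derivative f (at x)"
    using smooth_on_has_derivative[OF assms(2)] has_derivative_linear by blast
  have "(\<Sum>b\<in>Basis. (X x \<bullet> b) *\<^sub>R frechet_derivative f (at x) b) =
      frechet_derivative f (at x) (\<Sum>b\<in>Basis. (X x \<bullet> b) *\<^sub>R b)"
    by (simp add: sum scaleR)
  then show "(\<Sum>b\<in>Basis. (X x \<bullet> b) *\<^sub>R frechet_derivative f (at x) b) =
      frechet_derivative f (at x) (X x)"
    unfolding euclidean_representation .
qed

text \<open>The functions \<open>exp (-1/t) / t^n\<close>, continued by \<open>0\<close>.  The derivative of each is a linear combination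
  of two others, so one induction on the order of differentiability treats all of them at once.\<close>

definition flat :: "nat \<Rightarrow> real \<Rightarrow> real" where
  "flat n t = (if t > 0 then exp (- (1 / t)) / t ^ n else 0)"

lemma flat_tendsto_0: "(flat n \<longlongrightarrow> 0) (at 0)"
proof (rule filterlim_split_at)
  have "\<forall>\<^sub>F t in at_left 0. flat n t = 0"
    by (auto simp: flat_def eventually_at_left_field intro!: exI[of _ "-1"])
  then show "(flat n \<longlongrightarrow> 0) (at_left 0)" by (simp add: tendsto_eventually)
  have "((\<lambda>t. (inverse t) ^ n / exp (inverse t)) \<longlongrightarrow> (0::real)) (at_right 0)"
    by (rule filterlim_compose[OF tendsto_power_div_exp_0 filterlim_inverse_at_top_right])
  moreover have "\<forall>\<^sub>F t in at_right 0. (inverse t) ^ n / exp (inverse t) = flat n t"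
    unfolding eventually_at_right_field
    by (intro exI[of _ 1]) (auto simp: flat_def exp_minus field_simps)
  ultimately show "(flat n \<longlongrightarrow> 0) (at_right 0)" by (rule Lim_transform_eventually)
qed

lemma flat_has_real_derivative:
  "(flat n has_real_derivative flat (n + 2) t - real n * flat (n + 1) t) (at t)"
proof (cases t "0 :: real" rule: linorder_cases)
  case less
  have "((\<lambda>_. 0 :: real) has_real_derivative 0) (at t)" by simp
  then have "(flat n has_real_derivative 0) (at t)"
    by (rule has_field_derivative_transform_within_open[of _ _ _ "{..<0}"]) (use less in \<open>auto simp: flat_def\<close>)
  then show ?thesis using less by (simp add: flat_def)
next
  case equal
  have "(\<lambda>h. (flat n (0 + h) - flat n 0) / h) = flat (n + 1)"
    by (auto simp: flat_def fun_eq_iff)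
  then have "(flat n has_real_derivative 0) (at 0)"
    unfolding DERIV_def using flat_tendsto_0 by simp
  then show ?thesis using equal by (simp add: flat_def)
next
  case greater
  define u where "u = inverse t"
  have D: "((\<lambda>u. exp (- u) * u ^ n) has_real_derivative exp (- u) * (real n * u ^ (n - 1) - u ^ n)) (at u)"
    by (auto intro!: derivative_eq_intros simp: right_diff_distrib)
  have "(inverse has_real_derivative - (u\<^sup>2)) (at t)"
    using DERIV_inverse[of t UNIV] greater by (simp add: u_def numeral_2_eq_2)
  from DERIV_chain2[OF D[unfolded u_def] this]
  have "((\<lambda>t. exp (- inverse t) * inverse t ^ n) has_real_derivative
      exp (- u) * (real n * u ^ (n - 1) - u ^ n) * - (u\<^sup>2)) (at t)"
    unfolding u_def .
  moreover have "exp (- u) * (real n * u ^ (n - 1) - u ^ n) * - (u\<^sup>2) =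
      exp (- u) * u ^ (n + 2) - real n * (exp (- u) * u ^ (n + 1))"
  proof -
    have "u ^ (n - 1) * real n * u\<^sup>2 = real n * u ^ (n + 1)"
    proof (cases n)
      case (Suc m)
      then show ?thesis by (simp only: power2_eq_square power_Suc diff_Suc_1 mult_ac Suc_eq_plus1[symmetric])
    qed simp
    moreover have "u ^ n * u\<^sup>2 = u ^ (n + 2)" by (simp only: power_add)
    moreover have "E * (N * a - b) * - c = E * (b * c) - E * (a * N * c)" for E N a b c :: real
      by algebra
    ultimately show ?thesis by (simp only: mult.left_commute)
  qed
  moreover have flat: "flat m s = exp (- inverse s) * inverse s ^ m" if "s > 0" for m s
    using that unfolding flat_def by (simp add: inverse_eq_divide power_one_over)
  ultimately have "((\<lambda>t. exp (- inverse t) * inverse t ^ n) has_real_derivative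
      flat (n + 2) t - real n * flat (n + 1) t) (at t)"
    unfolding flat[OF greater] u_def by (simp only:)
  then show ?thesis
    by (rule has_field_derivative_transform_within_open[of _ _ _ "{0<..}"]) (use greater flat in auto)
qed

lemma Ck_on_flat: "Ck_on k UNIV (flat n)"
proof (induction k arbitrary: n)
  case 0
  have "isCont (flat n) t" for t
    using flat_has_real_derivative DERIV_isCont by blast
  then show ?case by (simp add: continuous_at_imp_continuous_on)
next
  case (Suc k)
  have "Ck_on k UNIV (\<lambda>t. v *\<^sub>R (flat (n + 2) t + (- real n) *\<^sub>R flat (n + 1) t))" for v :: real
    using Suc.IH
    by (intro Ck_on_bounded_linear_comp[OF bounded_linear_scaleR_right] Ck_on_add open_UNIV)
  then show ?case
    by (intro Ck_on_SucI[of UNIV "flat n" "\<lambda>t v. v *\<^sub>R (flat (n + 2) t + (- real n) *\<^sub>R flat (n + 1) t)"])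
      (use flat_has_real_derivative in \<open>auto simp: has_field_derivative_def mult_commute_abs\<close>)
qed

text \<open>The square of the distance to \<open>p\<close>, subtracted from that of the radius of a small ball, is positive
  exactly inside the ball; composing it with the flat function gives the bump.\<close>

lemma bump_exists:
  fixes p :: "'a::euclidean_space"
  assumes "open S" "p \<in> S"
  obtains b :: "'a \<Rightarrow> real" and K where
    "smooth_on UNIV b" "compact K" "K \<subseteq> S" "b p \<noteq> 0" "\<And>z. z \<notin> K \<Longrightarrow> b z = 0"
proof -
  obtain r where r: "r > 0" "cball p r \<subseteq> S" using assms open_contains_cball by metis
  define b where "b z = flat 0 (r\<^sup>2 + - ((z + - p) \<bullet> (z + - p)))" for z
  have "smooth_on UNIV (\<lambda>z. r\<^sup>2 + - ((z + - p) \<bullet> (z + - p)))"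
    by (intro smooth_on_add smooth_on_const smooth_on_bilinear[OF bounded_bilinear_inner]
        smooth_on_bounded_linear_comp[of uminus] smooth_on_ident open_UNIV
        bounded_linear_minus bounded_linear_ident)
  moreover have "smooth_on UNIV (flat 0)" by (simp only: smooth_on_def Ck_on_flat simp_thms)
  ultimately have "smooth_on UNIV b"
    unfolding b_def[abs_def] using smooth_on_compose[OF inner_frame_Basis open_UNIV subset_UNIV] by blast
  moreover have "b p \<noteq> 0" using r by (simp add: b_def flat_def)
  moreover have "b z = 0" if "z \<notin> cball p r" for z
  proof -
    have "r < norm (z - p)" using that by (simp add: dist_norm norm_minus_commute)
    then have "r\<^sup>2 < (norm (z - p))\<^sup>2" using r by (intro power_strict_mono) auto
    then show ?thesis by (simp add: b_def flat_def power2_norm_eq_inner)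
  qed
  ultimately show ?thesis using r(2) that[of b "cball p r"] by auto
qed

section \<open>The cochain complex of a bracket acting on functions\<close>

lemma omit_Cons_0 [simp]: "omit 0 (X # Xs) = Xs"
  and omit_Cons_Suc [simp]: "omit (Suc i) (X # Xs) = X # omit i Xs"
  by (simp_all add: omit_def)

lemma set_omit_subset: "set (omit i Xs) \<subseteq> set Xs"
  unfolding omit_def by (auto dest: in_set_takeD in_set_dropD)

lemma omit_in_lists: "Xs \<in> lists S \<Longrightarrow> omit i Xs \<in> lists S"
  using set_omit_subset by fastforce

lemma omit_map: "omit i (map h Xs) = map h (omit i Xs)"
  by (simp add: omit_def take_map drop_map)

lemma omit_tuples: "xs \<in> tuples (Suc k) S \<Longrightarrow> i \<le> k \<Longrightarrow> omit i xs \<in> tuples k S"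
  unfolding tuples_def omit_def by (auto dest: in_set_takeD in_set_dropD)

text \<open>The bracket is only required to be additive and skew, and the action to be additive: the
  Jacobi identity and compatibility of the action with the bracket are hypotheses of individual
  lemmas, because the converse direction recovers them from the differential.\<close>

locale bracket_action =
  fixes G :: "'g set" and add :: "'g \<Rightarrow> 'g \<Rightarrow> 'g" (infixl "\<oplus>" 65) and zero :: 'g
    and br :: "'g \<Rightarrow> 'g \<Rightarrow> 'g"
    and act :: "'g \<Rightarrow> ('p \<Rightarrow> real) \<Rightarrow> 'p \<Rightarrow> real"
    and C :: "('p \<Rightarrow> real) set"
  assumes add_closed: "X \<in> G \<Longrightarrow> Y \<in> G \<Longrightarrow> X \<oplus> Y \<in> G"
    and zero_closed: "zero \<in> G"
    and br_closed: "X \<in> G \<Longrightarrow> Y \<in> G \<Longrightarrow> br X Y \<in> G"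
    and zero_add: "zero \<oplus> zero = zero"
    and br_add: "X \<in> G \<Longrightarrow> Y \<in> G \<Longrightarrow> Z \<in> G \<Longrightarrow> br (X \<oplus> Y) Z = br X Z \<oplus> br Y Z"
    and br_skew: "X \<in> G \<Longrightarrow> Y \<in> G \<Longrightarrow> br X Y \<oplus> br Y X = zero"
    and C_zero: "(\<lambda>p. 0) \<in> C"
    and C_plus: "f \<in> C \<Longrightarrow> g \<in> C \<Longrightarrow> (\<lambda>p. f p + g p) \<in> C"
    and C_minus: "f \<in> C \<Longrightarrow> g \<in> C \<Longrightarrow> (\<lambda>p. f p - g p) \<in> C"
    and act_closed: "X \<in> G \<Longrightarrow> f \<in> C \<Longrightarrow> act X f \<in> C"
    and act_plus: "X \<in> G \<Longrightarrow> f \<in> C \<Longrightarrow> g \<in> C \<Longrightarrow> act X (\<lambda>p. f p + g p) = (\<lambda>p. act X f p + act X g p)"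
    and act_add: "X \<in> G \<Longrightarrow> Y \<in> G \<Longrightarrow> f \<in> C \<Longrightarrow> act (X \<oplus> Y) f = (\<lambda>p. act X f p + act Y f p)"
begin

lemma act_minus:
  assumes "X \<in> G" "f \<in> C" "g \<in> C"
  shows "act X (\<lambda>p. f p - g p) = (\<lambda>p. act X f p - act X g p)"
  using act_plus[OF assms(1) C_minus[OF assms(2,3)] assms(3)] by (simp add: fun_eq_iff)

lemma act_zero: "X \<in> G \<Longrightarrow> act X (\<lambda>p. 0) = (\<lambda>p. 0)"
  using act_minus[OF _ C_zero C_zero] by simp

lemma act_uminus: "X \<in> G \<Longrightarrow> f \<in> C \<Longrightarrow> act X (\<lambda>p. - f p) = (\<lambda>p. - act X f p)"
  using act_minus[OF _ C_zero] by (simp add: act_zero)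

text \<open>Cochains of all degrees are functions on lists, so that every identity below can be proved by
  induction on the list of arguments.\<close>

definition cochain :: "('g list \<Rightarrow> 'p \<Rightarrow> real) \<Rightarrow> bool" where
  "cochain \<omega> \<longleftrightarrow> (\<forall>Xs\<in>lists G. \<omega> Xs \<in> C)"

definition slot_additive :: "('g list \<Rightarrow> 'p \<Rightarrow> real) \<Rightarrow> bool" where
  "slot_additive \<omega> \<longleftrightarrow> (\<forall>Us\<in>lists G. \<forall>X\<in>G. \<forall>Y\<in>G. \<forall>Vs\<in>lists G.
     \<omega> (Us @ (X \<oplus> Y) # Vs) = (\<lambda>p. \<omega> (Us @ X # Vs) p + \<omega> (Us @ Y # Vs) p))"

definition alternating :: "('g list \<Rightarrow> 'p \<Rightarrow> real) \<Rightarrow> bool" where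
  "alternating \<omega> \<longleftrightarrow> (\<forall>Us\<in>lists G. \<forall>X\<in>G. \<forall>Y\<in>G. \<forall>Vs\<in>lists G.
     \<omega> (Us @ X # Y # Vs) = (\<lambda>p. - \<omega> (Us @ Y # X # Vs) p))"

definition contract :: "'g \<Rightarrow> ('g list \<Rightarrow> 'p \<Rightarrow> real) \<Rightarrow> 'g list \<Rightarrow> 'p \<Rightarrow> real" where
  "contract X \<omega> Xs = \<omega> (X # Xs)"

text \<open>In closed form, the sum over all positions of the value of \<open>\<omega>\<close> after the entry \<open>Y\<close> in that
  position has been replaced by \<open>br X Y\<close>.\<close>

primrec br_sum :: "'g \<Rightarrow> ('g list \<Rightarrow> 'p \<Rightarrow> real) \<Rightarrow> 'g list \<Rightarrow> 'p \<Rightarrow> real" where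
  "br_sum X \<omega> [] = (\<lambda>p. 0)"
| "br_sum X \<omega> (Y # Ys) = (\<lambda>p. \<omega> (br X Y # Ys) p + br_sum X (contract Y \<omega>) Ys p)"

definition lie_deriv :: "'g \<Rightarrow> ('g list \<Rightarrow> 'p \<Rightarrow> real) \<Rightarrow> 'g list \<Rightarrow> 'p \<Rightarrow> real" where
  "lie_deriv X \<omega> Xs = (\<lambda>p. act X (\<omega> Xs) p - br_sum X \<omega> Xs p)"

text \<open>The differential, defined by Cartan's formula \<open>\<iota>\<^sub>X d = L\<^sub>X - d \<iota>\<^sub>X\<close>, which determines it by recursion
  on the number of arguments.\<close>

primrec cdiff :: "('g list \<Rightarrow> 'p \<Rightarrow> real) \<Rightarrow> 'g list \<Rightarrow> 'p \<Rightarrow> real" where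
  "cdiff \<omega> [] = (\<lambda>p. 0)"
| "cdiff \<omega> (X # Xs) = (\<lambda>p. lie_deriv X \<omega> Xs p - cdiff (contract X \<omega>) Xs p)"

lemma contract_cochain: "cochain \<omega> \<Longrightarrow> X \<in> G \<Longrightarrow> cochain (contract X \<omega>)"
  by (simp add: cochain_def contract_def)

lemma additiveD:
  "slot_additive \<omega> \<Longrightarrow> Us \<in> lists G \<Longrightarrow> X \<in> G \<Longrightarrow> Y \<in> G \<Longrightarrow> Vs \<in> lists G \<Longrightarrow>
    \<omega> (Us @ (X \<oplus> Y) # Vs) = (\<lambda>p. \<omega> (Us @ X # Vs) p + \<omega> (Us @ Y # Vs) p)"
  unfolding slot_additive_def by blast

lemma alternatingD:
  "alternating \<omega> \<Longrightarrow> Us \<in> lists G \<Longrightarrow> X \<in> G \<Longrightarrow> Y \<in> G \<Longrightarrow> Vs \<in> lists G \<Longrightarrow>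
    \<omega> (Us @ X # Y # Vs) = (\<lambda>p. - \<omega> (Us @ Y # X # Vs) p)"
  unfolding alternating_def by blast

lemma contract_additive:
  assumes "slot_additive \<omega>" "X \<in> G"
  shows "slot_additive (contract X \<omega>)"
  unfolding slot_additive_def contract_def
proof (intro ballI)
  fix Us Y Z Vs assume "Us \<in> lists G" "Y \<in> G" "Z \<in> G" "Vs \<in> lists G"
  then show "\<omega> (X # Us @ (Y \<oplus> Z) # Vs) = (\<lambda>p. \<omega> (X # Us @ Y # Vs) p + \<omega> (X # Us @ Z # Vs) p)"
    using additiveD[OF assms(1) lists.Cons[OF assms(2)], of Us Y Z Vs] by simp
qed

lemma contract_alternating:
  assumes "alternating \<omega>" "X \<in> G"
  shows "alternating (contract X \<omega>)"
  unfolding alternating_def contract_def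
proof (intro ballI)
  fix Us Y Z Vs assume "Us \<in> lists G" "Y \<in> G" "Z \<in> G" "Vs \<in> lists G"
  then show "\<omega> (X # Us @ Y # Z # Vs) = (\<lambda>p. - \<omega> (X # Us @ Z # Y # Vs) p)"
    using alternatingD[OF assms(1) lists.Cons[OF assms(2)], of Us Y Z Vs] by simp
qed

lemma additive_head:
  assumes "slot_additive \<omega>" "X \<in> G" "Y \<in> G" "Xs \<in> lists G"
  shows "\<omega> ((X \<oplus> Y) # Xs) = (\<lambda>p. \<omega> (X # Xs) p + \<omega> (Y # Xs) p)"
  using additiveD[OF assms(1) lists.Nil assms(2-4)] by simp

lemma alternating_head:
  assumes "alternating \<omega>" "X \<in> G" "Y \<in> G" "Xs \<in> lists G"
  shows "\<omega> (X # Y # Xs) = (\<lambda>p. - \<omega> (Y # X # Xs) p)"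
  using alternatingD[OF assms(1) lists.Nil assms(2-4)] by (simp only: append_Nil)

text \<open>Additivity alone gives \<open>\<omega> (zero # Xs) = 0\<close>, which turns skewness of the bracket into a sign.\<close>

lemma additive_br_skew:
  assumes "slot_additive \<omega>" "X \<in> G" "Y \<in> G" "Xs \<in> lists G"
  shows "\<omega> (br X Y # Xs) p = - \<omega> (br Y X # Xs) p"
proof -
  have "\<omega> (zero # Xs) p = \<omega> (zero # Xs) p + \<omega> (zero # Xs) p"
    using additive_head[OF assms(1) zero_closed zero_closed assms(4)] unfolding zero_add by metis
  moreover have "\<omega> (zero # Xs) p = \<omega> (br X Y # Xs) p + \<omega> (br Y X # Xs) p"
    using additive_head[OF assms(1) br_closed[OF assms(2,3)] br_closed[OF assms(3,2)] assms(4)]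
    unfolding br_skew[OF assms(2,3)] by metis
  ultimately show ?thesis by simp
qed

lemma contract_minus:
  "contract X (\<lambda>Xs p. \<omega> Xs p - \<omega>' Xs p) = (\<lambda>Xs p. contract X \<omega> Xs p - contract X \<omega>' Xs p)"
  by (simp add: contract_def fun_eq_iff)

lemma contract_lie_deriv:
  "contract Y (lie_deriv X \<omega>) =
    (\<lambda>Xs p. lie_deriv X (contract Y \<omega>) Xs p - contract (br X Y) \<omega> Xs p)"
  by (simp add: contract_def lie_deriv_def fun_eq_iff)

lemma contract_cdiff:
  "contract X (cdiff \<omega>) = (\<lambda>Xs p. lie_deriv X \<omega> Xs p - cdiff (contract X \<omega>) Xs p)"
  by (simp add: contract_def fun_eq_iff)

lemma br_sum_minus:
  "br_sum X (\<lambda>Xs p. \<omega> Xs p - \<omega>' Xs p) Xs = (\<lambda>p. br_sum X \<omega> Xs p - br_sum X \<omega>' Xs p)"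
  by (induction Xs arbitrary: \<omega> \<omega>') (simp_all add: contract_minus fun_eq_iff)

lemma br_sum_plus:
  "br_sum X (\<lambda>Xs p. \<omega> Xs p + \<omega>' Xs p) Xs = (\<lambda>p. br_sum X \<omega> Xs p + br_sum X \<omega>' Xs p)"
  using br_sum_minus[of X "\<lambda>Xs p. \<omega> Xs p + \<omega>' Xs p" \<omega>' Xs] by (simp add: fun_eq_iff)

lemma br_sum_zero: "br_sum X (\<lambda>Xs p. 0) Xs = (\<lambda>p. 0)"
  using br_sum_minus[of X "\<lambda>Xs p. 0" "\<lambda>Xs p. 0" Xs] by simp

lemma br_sum_cong:
  assumes "\<And>Xs. Xs \<in> lists G \<Longrightarrow> \<omega> Xs = \<omega>' Xs" "X \<in> G" "Xs \<in> lists G"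
  shows "br_sum X \<omega> Xs = br_sum X \<omega>' Xs"
  using assms(1,3)
proof (induction Xs arbitrary: \<omega> \<omega>')
  case (Cons Y Ys)
  have "br_sum X (contract Y \<omega>) Ys = br_sum X (contract Y \<omega>') Ys"
    by (rule Cons.IH) (use Cons.prems in \<open>auto simp: contract_def\<close>)
  then show ?case using Cons.prems br_closed[OF assms(2)] by simp
qed simp

lemma br_sum_closed:
  assumes "X \<in> G" "cochain \<omega>" "Xs \<in> lists G"
  shows "br_sum X \<omega> Xs \<in> C"
  using assms(2,3)
proof (induction Xs arbitrary: \<omega>)
  case (Cons Y Ys)
  then have "\<omega> (br X Y # Ys) \<in> C" "br_sum X (contract Y \<omega>) Ys \<in> C"
    using br_closed[OF assms(1)] contract_cochain by (auto simp: cochain_def)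
  then show ?case by (simp add: C_plus)
qed (simp add: C_zero)

lemma lie_deriv_cochain: "X \<in> G \<Longrightarrow> cochain \<omega> \<Longrightarrow> cochain (lie_deriv X \<omega>)"
  unfolding cochain_def lie_deriv_def
  by (intro ballI C_minus act_closed br_sum_closed) (auto simp: cochain_def)

lemma lie_deriv_minus:
  assumes "X \<in> G" "cochain \<omega>" "cochain \<omega>'" "Xs \<in> lists G"
  shows "lie_deriv X (\<lambda>Xs p. \<omega> Xs p - \<omega>' Xs p) Xs = (\<lambda>p. lie_deriv X \<omega> Xs p - lie_deriv X \<omega>' Xs p)"
  using assms by (simp add: lie_deriv_def br_sum_minus act_minus cochain_def fun_eq_iff)

lemma lie_deriv_cong:
  assumes "\<And>Xs. Xs \<in> lists G \<Longrightarrow> \<omega> Xs = \<omega>' Xs" "X \<in> G" "Xs \<in> lists G"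
  shows "lie_deriv X \<omega> Xs = lie_deriv X \<omega>' Xs"
  using assms br_sum_cong[OF assms] by (simp add: lie_deriv_def)

lemma cdiff_closed:
  assumes "cochain \<omega>" "Xs \<in> lists G"
  shows "cdiff \<omega> Xs \<in> C"
  using assms
proof (induction Xs arbitrary: \<omega>)
  case (Cons X Xs)
  then have "lie_deriv X \<omega> Xs \<in> C" "cdiff (contract X \<omega>) Xs \<in> C"
    using lie_deriv_cochain contract_cochain by (auto simp: cochain_def)
  then show ?case by (simp add: C_minus)
qed (simp add: C_zero)

lemma cdiff_cochain: "cochain \<omega> \<Longrightarrow> cochain (cdiff \<omega>)"
  using cdiff_closed by (simp add: cochain_def)

lemma cdiff_minus:
  assumes "cochain \<omega>" "cochain \<omega>'" "Xs \<in> lists G"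
  shows "cdiff (\<lambda>Xs p. \<omega> Xs p - \<omega>' Xs p) Xs = (\<lambda>p. cdiff \<omega> Xs p - cdiff \<omega>' Xs p)"
  using assms
proof (induction Xs arbitrary: \<omega> \<omega>')
  case (Cons X Xs)
  then have "cdiff (\<lambda>Xs p. contract X \<omega> Xs p - contract X \<omega>' Xs p) Xs =
      (\<lambda>p. cdiff (contract X \<omega>) Xs p - cdiff (contract X \<omega>') Xs p)"
    by (intro Cons.IH) (auto intro: contract_cochain)
  then show ?case
    using Cons.prems by (simp add: lie_deriv_minus contract_minus fun_eq_iff)
qed simp

lemma zero_cochain: "cochain (\<lambda>Xs p. 0)"
  by (simp add: cochain_def C_zero)

lemma cdiff_zero: "Xs \<in> lists G \<Longrightarrow> cdiff (\<lambda>Xs p. 0) Xs = (\<lambda>p. 0)"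
  using cdiff_minus[OF zero_cochain zero_cochain] by simp

lemma cdiff_cong:
  assumes "\<And>Xs. Xs \<in> lists G \<Longrightarrow> \<omega> Xs = \<omega>' Xs" "Xs \<in> lists G"
  shows "cdiff \<omega> Xs = cdiff \<omega>' Xs"
  using assms
proof (induction Xs arbitrary: \<omega> \<omega>')
  case (Cons X Xs)
  have "cdiff (contract X \<omega>) Xs = cdiff (contract X \<omega>') Xs"
    by (rule Cons.IH) (use Cons.prems in \<open>auto simp: contract_def\<close>)
  moreover have "lie_deriv X \<omega> Xs = lie_deriv X \<omega>' Xs"
    by (rule lie_deriv_cong) (use Cons.prems in auto)
  ultimately show ?case by simp
qed simp

lemma act_br_sum:
  assumes "X \<in> G" "Y \<in> G" "cochain \<omega>" "Xs \<in> lists G"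
  shows "act X (br_sum Y \<omega> Xs) = br_sum Y (\<lambda>Xs. act X (\<omega> Xs)) Xs"
  using assms(3,4)
proof (induction Xs arbitrary: \<omega>)
  case (Cons Z Zs)
  have "act X (br_sum Y (contract Z \<omega>) Zs) = br_sum Y (contract Z (\<lambda>Xs. act X (\<omega> Xs))) Zs"
    using Cons contract_cochain by (simp add: contract_def[abs_def])
  moreover have "\<omega> (br Y Z # Zs) \<in> C" "br_sum Y (contract Z \<omega>) Zs \<in> C"
    using Cons.prems assms br_closed contract_cochain br_sum_closed by (auto simp: cochain_def)
  ultimately show ?case using assms by (simp add: act_plus)
qed (use assms act_zero in simp)

text \<open>How far \<open>L\<close> is from being a representation: the defect is that of the action, together with a
  term in which the Jacobi identity is tested in every argument.\<close>

lemma lie_deriv_commutator: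
  assumes "X \<in> G" "Y \<in> G" "cochain \<omega>" "Xs \<in> lists G"
  shows "lie_deriv X (lie_deriv Y \<omega>) Xs p - lie_deriv Y (lie_deriv X \<omega>) Xs p
      - lie_deriv (br X Y) \<omega> Xs p =
    (act X (act Y (\<omega> Xs)) p - act Y (act X (\<omega> Xs)) p - act (br X Y) (\<omega> Xs) p)
    + (br_sum X (br_sum Y \<omega>) Xs p - br_sum Y (br_sum X \<omega>) Xs p + br_sum (br X Y) \<omega> Xs p)"
proof -
  have *: "lie_deriv X (lie_deriv Y \<omega>) Xs p =
      act X (act Y (\<omega> Xs)) p - act X (br_sum Y \<omega> Xs) p - act Y (br_sum X \<omega> Xs) p
      + br_sum X (br_sum Y \<omega>) Xs p" if "X \<in> G" "Y \<in> G" for X Y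
  proof -
    have "\<omega> Xs \<in> C" using assms by (simp add: cochain_def)
    then have "act X (lie_deriv Y \<omega> Xs) = (\<lambda>p. act X (act Y (\<omega> Xs)) p - act X (br_sum Y \<omega> Xs) p)"
      unfolding lie_deriv_def using that assms act_closed br_sum_closed by (intro act_minus) auto
    moreover have "br_sum X (lie_deriv Y \<omega>) Xs =
        (\<lambda>p. act Y (br_sum X \<omega> Xs) p - br_sum X (br_sum Y \<omega>) Xs p)"
      unfolding lie_deriv_def[abs_def] br_sum_minus
      using that assms by (simp add: act_br_sum)
    ultimately show ?thesis by (simp add: lie_deriv_def)
  qed
  show ?thesis using *[OF assms(1,2)] *[OF assms(2,1)] by (simp add: lie_deriv_def)
qed

lemma cdiff_cdiff_Cons:
  assumes "cochain \<omega>" "X \<in> G" "Xs \<in> lists G"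
  shows "cdiff (cdiff \<omega>) (X # Xs) p =
    lie_deriv X (cdiff \<omega>) Xs p - cdiff (lie_deriv X \<omega>) Xs p + cdiff (cdiff (contract X \<omega>)) Xs p"
  using assms
  by (simp add: contract_cdiff cdiff_minus lie_deriv_cochain cdiff_cochain contract_cochain)

text \<open>Contracting with \<open>Y\<close> and applying Cartan's formula on both sides expresses the commutator of \<open>L\<^sub>X\<close> and
  \<open>d\<close> by the same commutator in one degree less; the terms with \<open>\<iota>\<close> of the bracket cancel.\<close>

lemma lie_deriv_cdiff_Cons:
  assumes "cochain \<omega>" "X \<in> G" "Y \<in> G" "Ys \<in> lists G"
  shows "lie_deriv X (cdiff \<omega>) (Y # Ys) p - cdiff (lie_deriv X \<omega>) (Y # Ys) p =
    lie_deriv X (lie_deriv Y \<omega>) Ys p - lie_deriv Y (lie_deriv X \<omega>) Ys p - lie_deriv (br X Y) \<omega> Ys p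
    - (lie_deriv X (cdiff (contract Y \<omega>)) Ys p - cdiff (lie_deriv X (contract Y \<omega>)) Ys p)"
proof -
  have Y: "cochain (contract Y \<omega>)" and XY: "br X Y \<in> G" "cochain (contract (br X Y) \<omega>)"
    using assms contract_cochain br_closed by auto
  have "lie_deriv X (cdiff \<omega>) (Y # Ys) p = contract Y (lie_deriv X (cdiff \<omega>)) Ys p"
    by (simp add: contract_def)
  also have "\<dots> = lie_deriv X (contract Y (cdiff \<omega>)) Ys p - contract (br X Y) (cdiff \<omega>) Ys p"
    by (simp add: contract_lie_deriv)
  also have "\<dots> = lie_deriv X (lie_deriv Y \<omega>) Ys p - lie_deriv X (cdiff (contract Y \<omega>)) Ys p
      - (lie_deriv (br X Y) \<omega> Ys p - cdiff (contract (br X Y) \<omega>) Ys p)"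
    unfolding contract_cdiff using assms Y by (simp add: lie_deriv_minus lie_deriv_cochain cdiff_cochain)
  finally have 1: "lie_deriv X (cdiff \<omega>) (Y # Ys) p = \<dots>" .
  have "cdiff (lie_deriv X \<omega>) (Y # Ys) p =
      lie_deriv Y (lie_deriv X \<omega>) Ys p - cdiff (contract Y (lie_deriv X \<omega>)) Ys p"
    by simp
  also have "cdiff (contract Y (lie_deriv X \<omega>)) Ys p =
      cdiff (lie_deriv X (contract Y \<omega>)) Ys p - cdiff (contract (br X Y) \<omega>) Ys p"
    unfolding contract_lie_deriv using assms Y XY by (simp add: cdiff_minus lie_deriv_cochain)
  finally show ?thesis using 1 by simp
qed

lemma br_sum_jacobi:
  assumes "X \<in> G" "Y \<in> G" "slot_additive \<omega>" "Xs \<in> lists G"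
    and jacobi: "\<And>Z. Z \<in> G \<Longrightarrow> br X (br Y Z) = br (br X Y) Z \<oplus> br Y (br X Z)"
  shows "br_sum X (br_sum Y \<omega>) Xs p - br_sum Y (br_sum X \<omega>) Xs p + br_sum (br X Y) \<omega> Xs p = 0"
  using assms(3,4)
proof (induction Xs arbitrary: \<omega>)
  case (Cons Z Zs)
  have *: "br_sum X (br_sum Y \<omega>) (Z # Zs) p = \<omega> (br Y (br X Z) # Zs) p
      + br_sum Y (contract (br X Z) \<omega>) Zs p + br_sum X (contract (br Y Z) \<omega>) Zs p
      + br_sum X (br_sum Y (contract Z \<omega>)) Zs p" for X Y
  proof -
    have "contract Z (br_sum Y \<omega>) =
        (\<lambda>Zs p. contract (br Y Z) \<omega> Zs p + br_sum Y (contract Z \<omega>) Zs p)"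
      by (simp add: contract_def fun_eq_iff)
    then show ?thesis by (simp add: br_sum_plus)
  qed
  have "\<omega> (br X (br Y Z) # Zs) p = \<omega> (br (br X Y) Z # Zs) p + \<omega> (br Y (br X Z) # Zs) p"
    using Cons.prems assms(1,2) jacobi[of Z] by (simp add: additive_head br_closed)
  moreover have "br_sum X (br_sum Y (contract Z \<omega>)) Zs p - br_sum Y (br_sum X (contract Z \<omega>)) Zs p
      + br_sum (br X Y) (contract Z \<omega>) Zs p = 0"
    using Cons contract_additive by simp
  ultimately show ?case unfolding * by simp
qed simp

text \<open>By Cartan's formula, \<open>L\<^sub>X d = d L\<^sub>X\<close> for a list follows from the same equation for its tail and
  from \<open>[L\<^sub>X, L\<^sub>Y] = L\<close> of the bracket; granted that, \<open>d\<^sup>2 = 0\<close> also passes from the tail to the list.\<close>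

lemma cdiff_cdiff_zero:
  assumes jacobi: "\<And>X Y Z. X \<in> G \<Longrightarrow> Y \<in> G \<Longrightarrow> Z \<in> G \<Longrightarrow> br X (br Y Z) = br (br X Y) Z \<oplus> br Y (br X Z)"
    and rep: "\<And>X Y f p. X \<in> G \<Longrightarrow> Y \<in> G \<Longrightarrow> f \<in> C \<Longrightarrow>
      act X (act Y f) p - act Y (act X f) p = act (br X Y) f p"
    and "cochain \<omega>" "slot_additive \<omega>" "Xs \<in> lists G"
  shows "cdiff (cdiff \<omega>) Xs p = 0"
proof -
  have L: "lie_deriv X (cdiff \<omega>) Xs p - cdiff (lie_deriv X \<omega>) Xs p = 0"
    if "cochain \<omega>" "slot_additive \<omega>" "Xs \<in> lists G" "X \<in> G" for X \<omega> Xs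
    using that
  proof (induction Xs arbitrary: \<omega>)
    case Nil
    then show ?case by (simp add: lie_deriv_def act_zero)
  next
    case (Cons Y Ys)
    have Y: "Y \<in> G" "Ys \<in> lists G" using Cons.prems by auto
    have "lie_deriv X (lie_deriv Y \<omega>) Ys p - lie_deriv Y (lie_deriv X \<omega>) Ys p
        - lie_deriv (br X Y) \<omega> Ys p = 0"
      unfolding lie_deriv_commutator[OF Cons.prems(4) Y(1) Cons.prems(1) Y(2)]
      using br_sum_jacobi[OF Cons.prems(4) Y(1) Cons.prems(2) Y(2) jacobi] rep Cons.prems Y
      by (simp add: cochain_def)
    moreover have "lie_deriv X (cdiff (contract Y \<omega>)) Ys p - cdiff (lie_deriv X (contract Y \<omega>)) Ys p = 0"
      using Cons Y contract_cochain contract_additive by simp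
    ultimately show ?case
      using lie_deriv_cdiff_Cons[OF Cons.prems(1,4) Y, of p] by linarith
  qed
  show ?thesis
    using assms(3-5)
  proof (induction Xs arbitrary: \<omega>)
    case (Cons X Xs)
    then have X: "X \<in> G" "Xs \<in> lists G" by auto
    have "cdiff (cdiff (contract X \<omega>)) Xs p = 0"
      using Cons X contract_cochain contract_additive by blast
    then show ?case
      unfolding cdiff_cdiff_Cons[OF Cons.prems(1) X] using L[OF Cons.prems(1,2) X(2,1)] by simp
  qed simp
qed

text \<open>The converse direction needs the square of the differential only in degrees \<open>0\<close> and \<open>1\<close>, where it
  isolates first the defect of the action and then the Jacobiator.\<close>

lemma cdiff_cdiff_pair:
  assumes "cochain \<omega>" "X \<in> G" "Y \<in> G"
  shows "cdiff (cdiff \<omega>) [X, Y] p =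
    act X (act Y (\<omega> [])) p - act Y (act X (\<omega> [])) p - act (br X Y) (\<omega> []) p"
proof -
  have zero: "cdiff (cdiff \<omega>) [X] p = 0" if "X \<in> G" for \<omega> X
    using that by (simp add: lie_deriv_def act_zero)
  have "cdiff (cdiff \<omega>) [X, Y] p = lie_deriv X (cdiff \<omega>) [Y] p - cdiff (lie_deriv X \<omega>) [Y] p"
    using cdiff_cdiff_Cons[of \<omega> X "[Y]"] assms zero by simp
  also have "\<dots> = lie_deriv X (lie_deriv Y \<omega>) [] p - lie_deriv Y (lie_deriv X \<omega>) [] p
      - lie_deriv (br X Y) \<omega> [] p"
    using lie_deriv_cdiff_Cons[of \<omega> X Y "[]"] assms by (simp add: lie_deriv_def act_zero)
  also have "\<dots> = act X (act Y (\<omega> [])) p - act Y (act X (\<omega> [])) p - act (br X Y) (\<omega> []) p"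
    using lie_deriv_commutator[OF assms(2,3,1), of "[]"] by simp
  finally show ?thesis .
qed

lemma cdiff_cdiff_triple:
  assumes "cochain \<omega>" "X \<in> G" "Y \<in> G" "Z \<in> G"
    and rep: "\<And>U V f p. U \<in> {X, Y, Z} \<Longrightarrow> V \<in> {X, Y, Z} \<Longrightarrow> f \<in> C \<Longrightarrow>
      act U (act V f) p - act V (act U f) p = act (br U V) f p"
  shows "cdiff (cdiff \<omega>) [X, Y, Z] p =
    \<omega> [br (br X Y) Z] p + \<omega> [br Y (br X Z)] p - \<omega> [br X (br Y Z)] p"
proof -
  have G: "br X Y \<in> G" and mem: "[Z] \<in> lists G" "[Y, Z] \<in> lists G" using assms br_closed by auto
  have comm: "lie_deriv X (lie_deriv Z \<omega>) [] p - lie_deriv Z (lie_deriv X \<omega>) [] p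
      - lie_deriv (br X Z) \<omega> [] p = 0" if "cochain \<omega>" for \<omega>
    using lie_deriv_commutator[OF assms(2,4) that, of "[]"] rep[of X Z "\<omega> []"] that
    by (simp add: cochain_def)
  have "cdiff (cdiff \<omega>) [X, Y, Z] p =
      lie_deriv X (cdiff \<omega>) [Y, Z] p - cdiff (lie_deriv X \<omega>) [Y, Z] p"
    using cdiff_cdiff_Cons[OF assms(1,2) mem(2)] rep[of Y Z "\<omega> [X]"] assms
      cdiff_cdiff_pair[of "contract X \<omega>" Y Z] contract_cochain[of \<omega> X]
    by (simp add: contract_def cochain_def)
  also have "\<dots> = lie_deriv X (lie_deriv Y \<omega>) [Z] p - lie_deriv Y (lie_deriv X \<omega>) [Z] p
      - lie_deriv (br X Y) \<omega> [Z] p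
      - (lie_deriv X (cdiff (contract Y \<omega>)) [Z] p - cdiff (lie_deriv X (contract Y \<omega>)) [Z] p)"
    by (rule lie_deriv_cdiff_Cons[OF assms(1-3) mem(1)])
  also have "lie_deriv X (cdiff (contract Y \<omega>)) [Z] p - cdiff (lie_deriv X (contract Y \<omega>)) [Z] p = 0"
    using lie_deriv_cdiff_Cons[of "contract Y \<omega>" X Z "[]"] comm[of "contract Y \<omega>"]
      assms contract_cochain
    by (simp add: lie_deriv_def[of X "cdiff _"] lie_deriv_def[of X "cdiff _", symmetric] act_zero)
  also have "lie_deriv X (lie_deriv Y \<omega>) [Z] p - lie_deriv Y (lie_deriv X \<omega>) [Z] p
      - lie_deriv (br X Y) \<omega> [Z] p =
      \<omega> [br (br X Y) Z] p + \<omega> [br Y (br X Z)] p - \<omega> [br X (br Y Z)] p"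
    using lie_deriv_commutator[OF assms(2,3,1) mem(1)] rep[of X Y "\<omega> [Z]"] assms
    by (simp add: cochain_def contract_def br_sum_zero)
  finally show ?thesis by simp
qed

text \<open>The next lemmas make it possible to apply the explicit formula to a differential in turn:
  evaluation on the bracket of two affine sections needs additivity in the first argument, and
  comparing that evaluation with the recursive definition needs the sign rule.\<close>

lemma cdiff_additive_head:
  assumes "cochain \<omega>" "slot_additive \<omega>" "X \<in> G" "Y \<in> G" "Xs \<in> lists G"
  shows "cdiff \<omega> ((X \<oplus> Y) # Xs) p = cdiff \<omega> (X # Xs) p + cdiff \<omega> (Y # Xs) p"
proof -
  have sum: "br_sum (X \<oplus> Y) \<omega> Xs p = br_sum X \<omega> Xs p + br_sum Y \<omega> Xs p"
    using assms(2,5)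
  proof (induction Xs arbitrary: \<omega>)
    case (Cons Z Zs)
    then show ?case
      using assms(3,4) by (simp add: br_add additive_head br_closed contract_additive)
  qed simp
  have "lie_deriv (X \<oplus> Y) \<omega> Xs p = lie_deriv X \<omega> Xs p + lie_deriv Y \<omega> Xs p"
    using assms sum by (simp add: lie_deriv_def act_add cochain_def)
  moreover have "cdiff (contract X \<omega>) Xs = cdiff (\<lambda>Xs p. contract (X \<oplus> Y) \<omega> Xs p - contract Y \<omega> Xs p) Xs"
    using assms by (intro cdiff_cong) (auto simp: contract_def additive_head)
  moreover have "\<dots> = (\<lambda>p. cdiff (contract (X \<oplus> Y) \<omega>) Xs p - cdiff (contract Y \<omega>) Xs p)"
    using assms by (intro cdiff_minus contract_cochain add_closed)
  ultimately show ?thesis by simp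
qed

lemma contract_contract_swap:
  assumes "alternating \<omega>" "X \<in> G" "Y \<in> G" "Xs \<in> lists G"
  shows "contract Y (contract X \<omega>) Xs = (\<lambda>p. 0 - contract X (contract Y \<omega>) Xs p)"
  using alternating_head[OF assms] by (simp add: contract_def)

lemma br_sum_alternating:
  assumes "alternating \<omega>" "Z \<in> G" "X \<in> G" "Y \<in> G" "Us \<in> lists G" "Vs \<in> lists G"
  shows "br_sum Z \<omega> (Us @ X # Y # Vs) = (\<lambda>p. - br_sum Z \<omega> (Us @ Y # X # Vs) p)"
  using assms(1,5)
proof (induction Us arbitrary: \<omega>)
  case Nil
  have "br_sum Z (contract Y (contract X \<omega>)) Vs = (\<lambda>p. 0 - br_sum Z (contract X (contract Y \<omega>)) Vs p)"
    using br_sum_cong[OF contract_contract_swap[OF Nil(1) assms(3,4)] assms(2,6)]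
    by (simp only: br_sum_minus br_sum_zero)
  moreover have "\<omega> (br Z X # Y # Vs) = (\<lambda>p. - \<omega> (Y # br Z X # Vs) p)"
    "\<omega> (br Z Y # X # Vs) = (\<lambda>p. - \<omega> (X # br Z Y # Vs) p)"
    using alternating_head[OF Nil(1)] assms br_closed by blast+
  ultimately show ?case by (simp add: contract_def fun_eq_iff)
next
  case (Cons U Us)
  have "\<omega> (br Z U # Us @ X # Y # Vs) = (\<lambda>p. - \<omega> (br Z U # Us @ Y # X # Vs) p)"
    using alternatingD[OF Cons.prems(1), of "br Z U # Us" X Y Vs] Cons.prems assms br_closed by simp
  moreover have "br_sum Z (contract U \<omega>) (Us @ X # Y # Vs) =
      (\<lambda>p. - br_sum Z (contract U \<omega>) (Us @ Y # X # Vs) p)"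
    using Cons contract_alternating by simp
  ultimately show ?case by (simp only: append_Cons br_sum.simps) (simp add: fun_eq_iff)
qed

lemma cdiff_alternating:
  assumes "cochain \<omega>" "slot_additive \<omega>" "alternating \<omega>"
  shows "alternating (cdiff \<omega>)"
  unfolding alternating_def
proof (intro ballI)
  fix Us X Y Vs assume mem: "Us \<in> lists G" "X \<in> G" "Y \<in> G" "Vs \<in> lists G"
  show "cdiff \<omega> (Us @ X # Y # Vs) = (\<lambda>p. - cdiff \<omega> (Us @ Y # X # Vs) p)"
    using assms mem(1)
  proof (induction Us arbitrary: \<omega>)
    case Nil
    have c: "cochain (contract X (contract Y \<omega>))" using Nil mem contract_cochain by simp
    have "cdiff (contract Y (contract X \<omega>)) Vs = cdiff (\<lambda>Xs p. 0 - contract X (contract Y \<omega>) Xs p) Vs"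
      by (rule cdiff_cong[OF contract_contract_swap]) (use Nil mem in auto)
    also have "\<dots> = (\<lambda>p. 0 - cdiff (contract X (contract Y \<omega>)) Vs p)"
      using cdiff_minus[OF zero_cochain c mem(4)] by (simp add: cdiff_zero mem(4))
    finally have "cdiff (contract Y (contract X \<omega>)) Vs = \<dots>" .
    then show ?case
      using additive_br_skew[OF Nil(2) mem(2-4)]
      by (simp add: contract_def lie_deriv_def fun_eq_iff)
  next
    case (Cons U Us)
    have "\<omega> (Us @ X # Y # Vs) = (\<lambda>p. - \<omega> (Us @ Y # X # Vs) p)"
      by (rule alternatingD[OF Cons.prems(3)]) (use Cons.prems mem in auto)
    moreover have "\<omega> (Us @ Y # X # Vs) \<in> C"
      using Cons.prems mem by (simp add: cochain_def)
    moreover have "br_sum U \<omega> (Us @ X # Y # Vs) = (\<lambda>p. - br_sum U \<omega> (Us @ Y # X # Vs) p)"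
      by (rule br_sum_alternating[OF Cons.prems(3)]) (use Cons.prems mem in auto)
    ultimately have "lie_deriv U \<omega> (Us @ X # Y # Vs) = (\<lambda>p. - lie_deriv U \<omega> (Us @ Y # X # Vs) p)"
      using Cons.prems(4) act_uminus[of U "\<omega> (Us @ Y # X # Vs)"]
      unfolding lie_deriv_def by simp
    moreover have "cdiff (contract U \<omega>) (Us @ X # Y # Vs) =
        (\<lambda>p. - cdiff (contract U \<omega>) (Us @ Y # X # Vs) p)"
      using Cons contract_cochain contract_additive contract_alternating by simp
    ultimately show ?case by (simp only: append_Cons cdiff.simps) (simp add: fun_eq_iff)
  qed
qed

text \<open>Moving the bracket from position \<open>j\<close> to the front costs the sign \<open>(-1)^j\<close>.\<close>

lemma br_sum_explicit:
  assumes "alternating \<omega>" "X \<in> G" "Xs \<in> lists G"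
  shows "br_sum X \<omega> Xs p = (\<Sum>j<length Xs. (- 1) ^ j * \<omega> (br X (Xs ! j) # omit j Xs) p)"
  using assms(1,3)
proof (induction Xs arbitrary: \<omega>)
  case (Cons Y Ys)
  have "br_sum X (contract Y \<omega>) Ys p =
      (\<Sum>j<length Ys. (- 1) ^ j * contract Y \<omega> (br X (Ys ! j) # omit j Ys) p)"
    using Cons contract_alternating by simp
  also have "\<dots> = (\<Sum>j<length Ys. (- 1) ^ Suc j * \<omega> (br X (Ys ! j) # Y # omit j Ys) p)"
  proof (rule sum.cong)
    fix j assume "j \<in> {..<length Ys}"
    then have "Ys ! j \<in> G" using Cons.prems by auto
    then have "\<omega> (Y # br X (Ys ! j) # omit j Ys) p = - \<omega> (br X (Ys ! j) # Y # omit j Ys) p"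
      using alternating_head[OF Cons.prems(1) _ br_closed[OF assms(2)] omit_in_lists]
        Cons.prems(2) by (metis Cons_in_lists_iff)
    then show "(- 1) ^ j * contract Y \<omega> (br X (Ys ! j) # omit j Ys) p =
        (- 1) ^ Suc j * \<omega> (br X (Ys ! j) # Y # omit j Ys) p"
      by (simp add: contract_def)
  qed simp
  finally show ?case by (simp add: sum.lessThan_Suc_shift del: sum.lessThan_Suc)
qed simp

text \<open>In the explicit formula the terms that involve the first argument make up the Lie derivative, and
  the others are the formula for the contraction, with the opposite sign.\<close>

lemma cdiff_explicit:
  assumes "alternating \<omega>" "Xs \<in> lists G"
  shows "cdiff \<omega> Xs p = (\<Sum>i<length Xs. (- 1) ^ i * act (Xs ! i) (\<omega> (omit i Xs)) p) +
     (\<Sum>j<length Xs. \<Sum>i<j. (- 1) ^ (i + j) * \<omega> (br (Xs ! i) (Xs ! j) # omit i (omit j Xs)) p)"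
  using assms
proof (induction Xs arbitrary: \<omega>)
  case (Cons X Xs)
  have swap: "contract X \<omega> (br (Xs ! i) (Xs ! j) # omit i (omit j Xs)) p =
      - \<omega> (br (Xs ! i) (Xs ! j) # X # omit i (omit j Xs)) p" if "j < length Xs" "i < j" for i j
  proof -
    have "Xs ! i \<in> G" "Xs ! j \<in> G" using Cons.prems that by auto
    then show ?thesis
      using alternating_head[OF Cons.prems(1) _ br_closed omit_in_lists[OF omit_in_lists]]
        Cons.prems(2) unfolding contract_def by (metis Cons_in_lists_iff)
  qed
  have "cdiff (contract X \<omega>) Xs p =
      (\<Sum>i<length Xs. (- 1) ^ i * act (Xs ! i) (\<omega> (X # omit i Xs)) p) +
      (\<Sum>j<length Xs. \<Sum>i<j. (- 1) ^ (i + j) * contract X \<omega> (br (Xs ! i) (Xs ! j) # omit i (omit j Xs)) p)"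
    using Cons.IH[OF contract_alternating[OF Cons.prems(1), of X]] Cons.prems(2)
    by (simp add: contract_def[abs_def])
  also have "\<dots> = (\<Sum>i<length Xs. (- 1) ^ i * act (Xs ! i) (\<omega> (X # omit i Xs)) p) -
      (\<Sum>j<length Xs. \<Sum>i<j. (- 1) ^ (i + j) * \<omega> (br (Xs ! i) (Xs ! j) # X # omit i (omit j Xs)) p)"
    using swap by (simp add: sum_negf)
  finally show ?case
    using br_sum_explicit[of \<omega> X Xs p] Cons.prems
    by (simp add: lie_deriv_def sum.lessThan_Suc_shift sum.distrib sum_negf sum_subtractf del: sum.lessThan_Suc)
qed simp

end

section \<open>Smooth maps and directional derivatives on a manifold\<close>

lemma chartD:
  assumes "smooth_manifold B" "(W, c) \<in> charts B"
  shows "open W" "open (c ` W)" "homeomorphism W (c ` W) c (inv_into W c)"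
  using assms unfolding smooth_manifold_def by auto

lemma chart_transition:
  assumes "smooth_manifold B" "(W, c) \<in> charts B" "(W', c') \<in> charts B"
  shows "smooth_on (c ` (W \<inter> W')) (c' \<circ> inv_into W c)"
  using assms unfolding smooth_manifold_def by fast

lemma chart_inverse:
  "smooth_manifold B \<Longrightarrow> (W, c) \<in> charts B \<Longrightarrow> x \<in> W \<Longrightarrow> inv_into W c (c x) = x"
  using homeomorphism_apply1[OF chartD(3)] .

lemma chart_exists:
  assumes "smooth_manifold B"
  obtains W c where "(W, c) \<in> charts B" "x \<in> W"
proof -
  have "x \<in> \<Union> (fst ` charts B)" using assms by (simp add: smooth_manifold_def)
  then show ?thesis using that by force
qed

lemma open_chart_image:
  assumes "smooth_manifold B" "(W, c) \<in> charts B" "open U"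
  shows "open (c ` (U \<inter> W))"
proof -
  have "openin (top_of_set (c ` W)) (c ` (U \<inter> W))"
    using homeomorphism_imp_open_map[OF chartD(3)[OF assms(1,2)] openin_open_Int[OF assms(3)]]
    by (simp only: inf_commute)
  then show ?thesis using chartD(2)[OF assms(1,2)] openin_open_eq by blast
qed

lemma smooth_mapD:
  "smooth_map B U g \<Longrightarrow> (W, c) \<in> charts B \<Longrightarrow> smooth_on (c ` (U \<inter> W)) (\<lambda>z. g (inv_into W c z))"
  unfolding smooth_map_def o_def by fast

lemma smooth_mapI:
  "(\<And>W c. (W, c) \<in> charts B \<Longrightarrow> smooth_on (c ` (U \<inter> W)) (\<lambda>z. g (inv_into W c z))) \<Longrightarrow> smooth_map B U g"
  unfolding smooth_map_def o_def by fast

lemma smooth_map_subset: "smooth_map B U g \<Longrightarrow> V \<subseteq> U \<Longrightarrow> smooth_map B V g"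
  by (rule smooth_mapI, erule smooth_on_subset[OF smooth_mapD]) auto

lemma smooth_map_cong:
  assumes "smooth_manifold B" "open U" "\<And>x. x \<in> U \<Longrightarrow> f x = g x" "smooth_map B U f"
  shows "smooth_map B U g"
proof (rule smooth_mapI)
  fix W c assume W: "(W, c) \<in> charts B"
  show "smooth_on (c ` (U \<inter> W)) (\<lambda>z. g (inv_into W c z))"
    by (rule smooth_on_cong[OF open_chart_image[OF assms(1) W assms(2)] _ smooth_mapD[OF assms(4) W]])
      (use assms(3) chart_inverse[OF assms(1) W] in auto)
qed

lemma smooth_map_local:
  assumes "smooth_manifold B" "\<And>x. x \<in> U \<Longrightarrow> \<exists>V. open V \<and> x \<in> V \<and> smooth_map B V g"
  shows "smooth_map B U g"
proof (rule smooth_mapI, rule smooth_on_local)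
  fix W c z assume W: "(W, c) \<in> charts B" and "z \<in> c ` (U \<inter> W)"
  then obtain x where x: "z = c x" "x \<in> U" "x \<in> W" by auto
  then obtain V where V: "open V" "x \<in> V" "smooth_map B V g" using assms(2) by blast
  show "\<exists>T. open T \<and> z \<in> T \<and> smooth_on T (\<lambda>z. g (inv_into W c z))"
    using open_chart_image[OF assms(1) W V(1)] smooth_mapD[OF V(3) W] V(2) x by blast
qed

text \<open>The transition maps transport smoothness from one chart to all others.\<close>

lemma smooth_map_in_chart:
  assumes "smooth_manifold B" "(W, c) \<in> charts B" "open U" "U \<subseteq> W" "smooth_on (c ` U) h"
    and "\<And>x. x \<in> U \<Longrightarrow> g x = h (c x)"
  shows "smooth_map B U g"
proof (rule smooth_mapI)
  fix W' c' assume W': "(W', c') \<in> charts B"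
  have op: "open (c' ` (U \<inter> W'))" by (rule open_chart_image[OF assms(1) W' assms(3)])
  have "smooth_on (c' ` (U \<inter> W')) (\<lambda>z. h ((c \<circ> inv_into W' c') z))"
  proof (rule smooth_on_compose[OF inner_frame_Basis op _ assms(5)])
    show "(c \<circ> inv_into W' c') ` c' ` (U \<inter> W') \<subseteq> c ` U"
      using chart_inverse[OF assms(1) W'] by auto
    show "smooth_on (c' ` (U \<inter> W')) (c \<circ> inv_into W' c')"
      by (rule smooth_on_subset[OF chart_transition[OF assms(1) W' assms(2)]]) (use assms(4) in auto)
  qed
  then show "smooth_on (c' ` (U \<inter> W')) (\<lambda>z. g (inv_into W' c' z))"
    by (rule smooth_on_cong[OF op, rotated]) (use assms(6) chart_inverse[OF assms(1) W'] in auto)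
qed

lemma smooth_map_const: "smooth_map B U (\<lambda>_. a)"
  by (rule smooth_mapI) simp

lemma smooth_map_add:
  assumes "smooth_manifold B" "open U" "smooth_map B U f" "smooth_map B U g"
  shows "smooth_map B U (\<lambda>x. f x + g x)"
  by (intro smooth_mapI smooth_on_add[OF open_chart_image[OF assms(1) _ assms(2)]]
      smooth_mapD[OF assms(3)] smooth_mapD[OF assms(4)])

lemma smooth_map_bilinear:
  assumes "bounded_bilinear P" "smooth_manifold B" "open U" "smooth_map B U f" "smooth_map B U g"
  shows "smooth_map B U (\<lambda>x. P (f x) (g x))"
  by (intro smooth_mapI smooth_on_bilinear[OF assms(1) open_chart_image[OF assms(2) _ assms(3)]]
      smooth_mapD[OF assms(4)] smooth_mapD[OF assms(5)])

lemma smooth_map_bounded_linear: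
  assumes "bounded_linear L" "smooth_manifold B" "open U" "smooth_map B U f"
  shows "smooth_map B U (\<lambda>x. L (f x))"
  by (intro smooth_mapI smooth_on_bounded_linear_comp[OF assms(1) open_chart_image[OF assms(2) _ assms(3)]]
      smooth_mapD[OF assms(4)])

lemma smooth_map_times_apply:
  fixes g :: "'m::{t2_space,second_countable_topology} \<Rightarrow> 'f::real_inner \<Rightarrow> 'b::real_normed_vector"
    and B :: "('m, 'a::euclidean_space, 'z) fibred_mfd_scheme" and C :: "'f set"
  assumes "inner_frame C" "smooth_manifold B" "open U" "smooth_map_times B U g" "smooth_map B U s"
  shows "smooth_map B U (\<lambda>x. g x (s x))"
proof (rule smooth_mapI)
  fix W c assume W: "(W, c) \<in> charts B"
  have op: "open (c ` (U \<inter> W))" by (rule open_chart_image[OF assms(2) W assms(3)])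
  have "smooth_on (c ` (U \<inter> W)) (\<lambda>z. (z, s (inv_into W c z)))"
    by (rule smooth_on_Pair[OF op smooth_on_ident[OF op] smooth_mapD[OF assms(5) W]])
  moreover have "smooth_on (c ` (U \<inter> W) \<times> UNIV) (\<lambda>(z, y). g (inv_into W c z) y)"
    using assms(4) W unfolding smooth_map_times_def by fast
  moreover have "(\<lambda>z. (z, s (inv_into W c z))) ` c ` (U \<inter> W) \<subseteq> c ` (U \<inter> W) \<times> UNIV"
    by auto
  ultimately have "smooth_on (c ` (U \<inter> W)) (\<lambda>z. (\<lambda>(z, y). g (inv_into W c z) y) (z, s (inv_into W c z)))"
    using smooth_on_compose[OF inner_frame_Times[OF inner_frame_Basis assms(1)] op] by blast
  then show "smooth_on (c ` (U \<inter> W)) (\<lambda>z. g (inv_into W c z) (s (inv_into W c z)))" by simp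
qed

lemma Cinf_const: "(\<lambda>_. a) \<in> Cinf B"
  by (simp add: Cinf_def smooth_map_const)

lemma Cinf_add: "smooth_manifold B \<Longrightarrow> f \<in> Cinf B \<Longrightarrow> g \<in> Cinf B \<Longrightarrow> (\<lambda>x. f x + g x) \<in> Cinf B"
  unfolding Cinf_def by (auto intro: smooth_map_add)

lemma Cinf_mult: "smooth_manifold B \<Longrightarrow> f \<in> Cinf B \<Longrightarrow> g \<in> Cinf B \<Longrightarrow> (\<lambda>x. f x * g x) \<in> Cinf B"
  unfolding Cinf_def by (auto intro: smooth_map_bilinear[OF bounded_bilinear_mult])

lemma Cinf_cmult: "smooth_manifold B \<Longrightarrow> f \<in> Cinf B \<Longrightarrow> (\<lambda>x. a * f x) \<in> Cinf B"
  by (rule Cinf_mult[OF _ Cinf_const])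

lemma Cinf_minus: "smooth_manifold B \<Longrightarrow> f \<in> Cinf B \<Longrightarrow> g \<in> Cinf B \<Longrightarrow> (\<lambda>x. f x - g x) \<in> Cinf B"
  using Cinf_add[of B f "\<lambda>x. (- 1) * g x"] Cinf_cmult[of B g "- 1"] by simp

lemma Cinf_has_derivative:
  assumes "smooth_manifold B" "f \<in> Cinf B" "(W, c) \<in> charts B" "x \<in> W"
  shows "((f \<circ> inv_into W c) has_derivative frechet_derivative (f \<circ> inv_into W c) (at (c x))) (at (c x))"
proof -
  have "smooth_map B UNIV f" using assms(2) by (simp add: Cinf_def)
  from smooth_on_has_derivative[OF smooth_mapD[OF this assms(3)]] show ?thesis
    unfolding o_def using assms(4) by blast
qed

lemma dir_deriv_some_chart:
  assumes "smooth_manifold B"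
  obtains W c where "(W, c) \<in> charts B" "x \<in> W"
    "\<And>X f. dir_deriv B x X f = frechet_derivative (f \<circ> inv_into W c) (at (c x)) (X (W, c))"
proof -
  obtain W c where Wc: "(SOME ch. ch \<in> charts B \<and> x \<in> fst ch) = (W, c)" by fastforce
  obtain W' c' where "(W', c') \<in> charts B" "x \<in> W'" using chart_exists[OF assms] .
  then have "\<exists>ch. ch \<in> charts B \<and> x \<in> fst ch" by force
  from someI_ex[OF this] have "(W, c) \<in> charts B \<and> x \<in> fst (W, c)" unfolding Wc .
  then show ?thesis using that[of W c] by (simp add: dir_deriv_def Wc)
qed

text \<open>The chain rule for the change of charts cancels against the transformation law of tangent
  vectors.\<close>

lemma dir_deriv_chart:
  assumes B: "smooth_manifold B" and f: "f \<in> Cinf B" and X: "X \<in> tangent_space B x"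
    and W: "(W, c) \<in> charts B" "x \<in> W"
  shows "dir_deriv B x X f = frechet_derivative (f \<circ> inv_into W c) (at (c x)) (X (W, c))"
proof -
  obtain W' c' where W': "(W', c') \<in> charts B" "x \<in> W'"
    and d: "dir_deriv B x X f = frechet_derivative (f \<circ> inv_into W' c') (at (c' x)) (X (W', c'))"
    using dir_deriv_some_chart[OF B, of x] by metis
  have op: "open (c ` (W \<inter> W'))"
    using open_chart_image[OF B W(1) chartD(1)[OF B W'(1)]] by (simp add: inf_commute)
  have "((f \<circ> inv_into W' c') \<circ> (c' \<circ> inv_into W c) has_derivative
      frechet_derivative (f \<circ> inv_into W' c') (at (c' x)) \<circ>
      frechet_derivative (c' \<circ> inv_into W c) (at (c x))) (at (c x))"
  proof (rule diff_chain_at)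
    show "((c' \<circ> inv_into W c) has_derivative frechet_derivative (c' \<circ> inv_into W c) (at (c x))) (at (c x))"
      by (rule smooth_on_has_derivative[OF chart_transition[OF B W(1) W'(1)]]) (use W W' in auto)
    show "(f \<circ> inv_into W' c' has_derivative frechet_derivative (f \<circ> inv_into W' c') (at (c' x)))
        (at ((c' \<circ> inv_into W c) (c x)))"
      using Cinf_has_derivative[OF B f W'] by (simp add: chart_inverse[OF B W])
  qed
  then have "((f \<circ> inv_into W c) has_derivative
      frechet_derivative (f \<circ> inv_into W' c') (at (c' x)) \<circ>
      frechet_derivative (c' \<circ> inv_into W c) (at (c x))) (at (c x))"
    by (rule has_derivative_transform_within_open[OF _ op])
      (use W W' chart_inverse[OF B W(1)] chart_inverse[OF B W'(1)] in auto)
  then have "frechet_derivative (f \<circ> inv_into W c) (at (c x)) =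
      frechet_derivative (f \<circ> inv_into W' c') (at (c' x)) \<circ>
      frechet_derivative (c' \<circ> inv_into W c) (at (c x))"
    by (rule frechet_derivative_at[symmetric])
  moreover have "X (W', c') = frechet_derivative (c' \<circ> inv_into W c) (at (c x)) (X (W, c))"
    using X W W' unfolding tangent_space_def by blast
  ultimately show ?thesis using d by simp
qed

lemma dir_deriv_add_fun:
  assumes "smooth_manifold B" "f \<in> Cinf B" "g \<in> Cinf B"
  shows "dir_deriv B x X (\<lambda>y. f y + g y) = dir_deriv B x X f + dir_deriv B x X g"
proof -
  obtain W c where W: "(W, c) \<in> charts B" "x \<in> W"
    and d: "\<And>X f. dir_deriv B x X f = frechet_derivative (f \<circ> inv_into W c) (at (c x)) (X (W, c))"
    using dir_deriv_some_chart[OF assms(1)] by blast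
  have "((\<lambda>y. (f \<circ> inv_into W c) y + (g \<circ> inv_into W c) y) has_derivative
      (\<lambda>v. frechet_derivative (f \<circ> inv_into W c) (at (c x)) v
        + frechet_derivative (g \<circ> inv_into W c) (at (c x)) v)) (at (c x))"
    by (rule has_derivative_add[OF Cinf_has_derivative[OF assms(1,2) W] Cinf_has_derivative[OF assms(1,3) W]])
  from frechet_derivative_at[OF this, symmetric] show ?thesis unfolding d by (simp add: o_def)
qed

lemma dir_deriv_cmult_fun:
  assumes "smooth_manifold B" "f \<in> Cinf B"
  shows "dir_deriv B x X (\<lambda>y. a * f y) = a * dir_deriv B x X f"
proof -
  obtain W c where W: "(W, c) \<in> charts B" "x \<in> W"
    and d: "\<And>X f. dir_deriv B x X f = frechet_derivative (f \<circ> inv_into W c) (at (c x)) (X (W, c))"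
    using dir_deriv_some_chart[OF assms(1)] by blast
  have "((\<lambda>y. a * (f \<circ> inv_into W c) y) has_derivative
      (\<lambda>v. a * frechet_derivative (f \<circ> inv_into W c) (at (c x)) v)) (at (c x))"
    by (rule has_derivative_mult_right[OF Cinf_has_derivative[OF assms W]])
  from frechet_derivative_at[OF this, symmetric] show ?thesis unfolding d by (simp add: o_def)
qed

lemma dir_deriv_add_vec:
  assumes "smooth_manifold B" "f \<in> Cinf B" "\<And>ch. Z ch = X ch + Y ch"
  shows "dir_deriv B x Z f = dir_deriv B x X f + dir_deriv B x Y f"
proof -
  obtain W c where W: "(W, c) \<in> charts B" "x \<in> W"
    and d: "\<And>X f. dir_deriv B x X f = frechet_derivative (f \<circ> inv_into W c) (at (c x)) (X (W, c))"
    using dir_deriv_some_chart[OF assms(1)] by blast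
  show ?thesis
    unfolding d assms(3)
    using has_derivative_linear[OF Cinf_has_derivative[OF assms(1,2) W]] by (rule linear_add)
qed

lemma dir_deriv_scale_vec:
  assumes "smooth_manifold B" "f \<in> Cinf B" "\<And>ch. Z ch = a *\<^sub>R X ch"
  shows "dir_deriv B x Z f = a * dir_deriv B x X f"
proof -
  obtain W c where W: "(W, c) \<in> charts B" "x \<in> W"
    and d: "\<And>X f. dir_deriv B x X f = frechet_derivative (f \<circ> inv_into W c) (at (c x)) (X (W, c))"
    using dir_deriv_some_chart[OF assms(1)] by blast
  show ?thesis
    unfolding d assms(3)
    using linear_scale[OF has_derivative_linear[OF Cinf_has_derivative[OF assms(1,2) W]]] by simp
qed

text \<open>The bump function of a chart vanishes off the preimage \<open>K\<close> of a compact set.  As the manifold is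
  Hausdorff, \<open>K\<close> is closed, so the extension by \<open>0\<close> is smooth on the open complement of \<open>K\<close> too.\<close>

lemma Cinf_bump:
  fixes B :: "('m::{t2_space,second_countable_topology}, 'a::euclidean_space, 'z) fibred_mfd_scheme"
  assumes "smooth_manifold B" "open S" "x \<in> S"
  obtains \<beta> K where "\<beta> \<in> Cinf B" "closed K" "K \<subseteq> S" "\<beta> x \<noteq> 0" "\<And>y. y \<notin> K \<Longrightarrow> \<beta> y = 0"
proof -
  obtain W c where W: "(W, c) \<in> charts B" "x \<in> W" using chart_exists[OF assms(1)] .
  note hom = chartD(3)[OF assms(1) W(1)] and inv = chart_inverse[OF assms(1) W(1)]
  obtain b :: "'a \<Rightarrow> real" and K\<^sub>0 where b: "smooth_on UNIV b" "compact K\<^sub>0" "K\<^sub>0 \<subseteq> c ` (S \<inter> W)" "b (c x) \<noteq> 0"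
    "\<And>z. z \<notin> K\<^sub>0 \<Longrightarrow> b z = 0"
    using bump_exists[OF open_chart_image[OF assms(1) W(1) assms(2)], of "c x"] W(2) assms(3) by auto
  define K where "K = inv_into W c ` K\<^sub>0"
  define \<beta> where "\<beta> y = (if y \<in> W then b (c y) else 0)" for y
  have "compact K"
    unfolding K_def
    by (intro compact_continuous_image b(2) continuous_on_subset[OF homeomorphism_cont2[OF hom]]) (use b(3) in auto)
  then have cl: "closed K" by (rule compact_imp_closed)
  have sub: "K \<subseteq> S \<inter> W"
    unfolding K_def using b(3) inv by fastforce
  have zero: "\<beta> y = 0" if "y \<notin> K" for y
  proof (cases "y \<in> W")
    case True
    then have "c y \<notin> K\<^sub>0" using that inv unfolding K_def by (metis image_eqI)
    then show ?thesis by (simp add: \<beta>_def b(5))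
  qed (simp add: \<beta>_def)
  have "smooth_map B W \<beta>"
    by (rule smooth_map_in_chart[OF assms(1) W(1) chartD(1)[OF assms(1) W(1)] subset_refl
          smooth_on_subset[OF b(1) subset_UNIV]]) (simp add: \<beta>_def)
  moreover have "smooth_map B (- K) \<beta>"
    by (rule smooth_map_cong[OF assms(1) _ _ smooth_map_const[of B _ 0]]) (use cl zero in auto)
  ultimately have "smooth_map B UNIV \<beta>"
    by (intro smooth_map_local[OF assms(1)])
      (metis (no_types) ComplI IntD2 UNIV_I chartD(1)[OF assms(1) W(1)] cl open_Compl sub subsetD)
  then show ?thesis
    using that[of \<beta> K] cl sub zero b(4) W(2) by (auto simp: Cinf_def \<beta>_def)
qed

lemma smooth_map_cutoff:
  assumes "smooth_manifold B" "\<beta> \<in> Cinf B" "closed K" "K \<subseteq> S" "open S" "\<And>y. y \<notin> K \<Longrightarrow> \<beta> y = 0"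
    and "smooth_map B S g"
  shows "smooth_map B UNIV (\<lambda>y. if y \<in> S then \<beta> y *\<^sub>R g y else 0)" (is "smooth_map B UNIV ?h")
proof -
  have "smooth_map B S (\<lambda>y. \<beta> y *\<^sub>R g y)"
    using assms(2) smooth_map_subset[of B UNIV \<beta> S]
    by (intro smooth_map_bilinear[OF bounded_bilinear_scaleR assms(1,5) _ assms(7)]) (auto simp: Cinf_def)
  then have "smooth_map B S ?h"
    by (rule smooth_map_cong[OF assms(1,5), rotated]) simp
  moreover have "smooth_map B (- K) ?h"
    by (rule smooth_map_cong[OF assms(1) _ _ smooth_map_const[of B _ 0]]) (use assms(3,6) in auto)
  ultimately show ?thesis
    by (intro smooth_map_local[OF assms(1)])
      (metis (no_types) ComplI UNIV_I assms(3-5) open_Compl subsetD)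
qed

section \<open>Sections of vector and affine bundles\<close>

lemma vbundle_trivialisation:
  assumes "vector_bundle B"
  obtains U \<phi> where "(U, \<phi>) \<in> vtriv B" "x \<in> U"
proof -
  have "x \<in> \<Union> (fst ` vtriv B)" using assms by (simp add: vector_bundle_def)
  then show ?thesis using that by force
qed

lemma vtrivD:
  assumes "vector_bundle B" "(U, \<phi>) \<in> vtriv B"
  shows "open U"
    and "x \<in> U \<Longrightarrow> bij_betw \<phi> (vfibre B x) UNIV"
    and "x \<in> U \<Longrightarrow> vproj B u = x \<Longrightarrow> vproj B v = x \<Longrightarrow> \<phi> (vadd B u v) = \<phi> u + \<phi> v"
    and "x \<in> U \<Longrightarrow> vproj B v = x \<Longrightarrow> \<phi> (vscale B a v) = a *\<^sub>R \<phi> v"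
    and "x \<in> U \<Longrightarrow> \<phi> (vzero B x) = 0"
proof -
  have "\<forall>(U, \<phi>)\<in>vtriv B. open U \<and>
        (\<forall>x\<in>U. bij_betw \<phi> (vfibre B x) UNIV \<and>
           (\<forall>u\<in>vfibre B x. \<forall>v\<in>vfibre B x. \<phi> (vadd B u v) = \<phi> u + \<phi> v) \<and>
           (\<forall>a. \<forall>v\<in>vfibre B x. \<phi> (vscale B a v) = a *\<^sub>R \<phi> v) \<and>
           \<phi> (vzero B x) = 0)"
    using assms(1) unfolding vector_bundle_def by blast
  then have *: "open U \<and>
        (\<forall>x\<in>U. bij_betw \<phi> (vfibre B x) UNIV \<and>
           (\<forall>u\<in>vfibre B x. \<forall>v\<in>vfibre B x. \<phi> (vadd B u v) = \<phi> u + \<phi> v) \<and>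
           (\<forall>a. \<forall>v\<in>vfibre B x. \<phi> (vscale B a v) = a *\<^sub>R \<phi> v) \<and>
           \<phi> (vzero B x) = 0)"
    using assms(2) by blast
  show "open U" using * by blast
  show "x \<in> U \<Longrightarrow> bij_betw \<phi> (vfibre B x) UNIV" using * by blast
  show "x \<in> U \<Longrightarrow> vproj B u = x \<Longrightarrow> vproj B v = x \<Longrightarrow> \<phi> (vadd B u v) = \<phi> u + \<phi> v"
    using * unfolding vfibre_def by blast
  show "x \<in> U \<Longrightarrow> vproj B v = x \<Longrightarrow> \<phi> (vscale B a v) = a *\<^sub>R \<phi> v"
    using * unfolding vfibre_def by blast
  show "x \<in> U \<Longrightarrow> \<phi> (vzero B x) = 0" using * by blast
qed

lemma vtriv_transition:
  assumes "vector_bundle B" "(U, \<phi>) \<in> vtriv B" "(U', \<phi>') \<in> vtriv B"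
  shows "smooth_map_times B (U \<inter> U') (\<lambda>x y. \<phi>' (inv_into (vfibre B x) \<phi> y))"
proof -
  have "\<forall>(U, \<phi>)\<in>vtriv B. \<forall>(U', \<phi>')\<in>vtriv B.
      smooth_map_times B (U \<inter> U') (\<lambda>x y. \<phi>' (inv_into (vfibre B x) \<phi> y))"
    using assms(1) unfolding vector_bundle_def by (elim conjE)
  then show ?thesis using assms(2,3) by blast
qed

lemma vtriv_inv:
  assumes "vector_bundle B" "(U, \<phi>) \<in> vtriv B" "x \<in> U"
  shows "vproj B v = x \<Longrightarrow> inv_into (vfibre B x) \<phi> (\<phi> v) = v"
    and "\<phi> (inv_into (vfibre B x) \<phi> y) = y"
    and "vproj B (inv_into (vfibre B x) \<phi> y) = x"
proof -
  note bij = vtrivD(2)[OF assms]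
  show "vproj B v = x \<Longrightarrow> inv_into (vfibre B x) \<phi> (\<phi> v) = v"
    using bij_betw_inv_into_left[OF bij] by (simp add: vfibre_def)
  show "\<phi> (inv_into (vfibre B x) \<phi> y) = y"
    using bij_betw_inv_into_right[OF bij] by simp
  show "vproj B (inv_into (vfibre B x) \<phi> y) = x"
    using bij_betwE[OF bij_betw_inv_into[OF bij]] by (simp add: vfibre_def)
qed

lemma vbundle_frame:
  fixes B :: "('m::topological_space, 'a::euclidean_space, 'v, 'f::real_inner, 'z) vec_bundle_scheme"
  assumes "vector_bundle B"
  obtains C :: "'f set" where "inner_frame C"
proof -
  have "\<exists>S :: 'f set. finite S \<and> span S = UNIV"
    using assms unfolding vector_bundle_def by (elim conjE)
  then show ?thesis using inner_frame_exists that by metis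
qed

lemma vsec_proj: "\<sigma> \<in> vsec B \<Longrightarrow> vproj B (\<sigma> x) = x"
  by (simp add: vsec_def)

lemma asec_proj: "\<zeta> \<in> asec B \<Longrightarrow> aproj B (\<zeta> x) = x"
  by (simp add: asec_def)

lemma vsec_smooth: "\<sigma> \<in> vsec B \<Longrightarrow> (U, \<phi>) \<in> vtriv B \<Longrightarrow> smooth_map B U (\<lambda>x. \<phi> (\<sigma> x))"
  unfolding vsec_def o_def by fast

lemma asec_smooth: "\<zeta> \<in> asec B \<Longrightarrow> (U, \<psi>) \<in> atriv B \<Longrightarrow> smooth_map B U (\<lambda>x. \<psi> (\<zeta> x))"
  unfolding asec_def o_def by fast

lemma vsecI:
  assumes "\<And>x. vproj B (\<sigma> x) = x"
    "\<And>U \<phi>. (U, \<phi>) \<in> vtriv B \<Longrightarrow> smooth_map B U (\<lambda>x. \<phi> (\<sigma> x))"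
  shows "\<sigma> \<in> vsec B"
  using assms unfolding vsec_def o_def by auto

lemma asecI:
  assumes "\<And>x. aproj B (\<zeta> x) = x"
    "\<And>U \<psi>. (U, \<psi>) \<in> atriv B \<Longrightarrow> smooth_map B U (\<lambda>x. \<psi> (\<zeta> x))"
  shows "\<zeta> \<in> asec B"
  using assms unfolding asec_def o_def by auto

text \<open>The coordinate of a section in a trivialisation chosen separately at each point.  It turns
  identities between sections into identities in the typical fibre.\<close>

definition crd :: "('m, 'a::euclidean_space, 'v, 'f::real_inner, 'z) vec_bundle_scheme \<Rightarrow> ('m \<Rightarrow> 'v) \<Rightarrow> 'm \<Rightarrow> 'f" where
  "crd B \<sigma> x = snd (SOME T. T \<in> vtriv B \<and> x \<in> fst T) (\<sigma> x)"

lemma crd_trivialisation: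
  assumes "vector_bundle B"
  obtains U \<phi> where "(U, \<phi>) \<in> vtriv B" "x \<in> U" "\<And>\<sigma>. crd B \<sigma> x = \<phi> (\<sigma> x)"
proof -
  obtain U \<phi> where T: "(SOME T. T \<in> vtriv B \<and> x \<in> fst T) = (U, \<phi>)" by fastforce
  obtain U' \<phi>' where "(U', \<phi>') \<in> vtriv B" "x \<in> U'" using vbundle_trivialisation[OF assms] .
  then have "\<exists>T. T \<in> vtriv B \<and> x \<in> fst T" by force
  from someI_ex[OF this] have "(U, \<phi>) \<in> vtriv B \<and> x \<in> fst (U, \<phi>)" unfolding T .
  then show ?thesis using that[of U \<phi>] by (simp add: crd_def T)
qed

lemma section_eqI:
  assumes "vector_bundle B" "\<sigma> \<in> vsec B" "\<eta> \<in> vsec B" "\<And>x. crd B \<sigma> x = crd B \<eta> x"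
  shows "\<sigma> = \<eta>"
proof
  fix x
  obtain U \<phi> where U: "(U, \<phi>) \<in> vtriv B" "x \<in> U" and c: "\<And>\<sigma>. crd B \<sigma> x = \<phi> (\<sigma> x)"
    using crd_trivialisation[OF assms(1)] by blast
  have "\<phi> (\<sigma> x) = \<phi> (\<eta> x)" using assms(4)[of x] c by simp
  then show "\<sigma> x = \<eta> x"
    using vtriv_inv(1)[OF assms(1) U vsec_proj[OF assms(2)]]
      vtriv_inv(1)[OF assms(1) U vsec_proj[OF assms(3)]] by metis
qed

lemma crd_sadd:
  assumes "vector_bundle B" "\<sigma> \<in> vsec B" "\<eta> \<in> vsec B"
  shows "crd B (sadd B \<sigma> \<eta>) x = crd B \<sigma> x + crd B \<eta> x"
proof -
  obtain U \<phi> where U: "(U, \<phi>) \<in> vtriv B" "x \<in> U" and c: "\<And>\<sigma>. crd B \<sigma> x = \<phi> (\<sigma> x)"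
    using crd_trivialisation[OF assms(1)] by blast
  show ?thesis unfolding c sadd_def by (rule vtrivD(3)[OF assms(1) U]) (simp_all add: assms vsec_proj)
qed

lemma crd_sscale:
  assumes "vector_bundle B" "\<sigma> \<in> vsec B"
  shows "crd B (sscale B f \<sigma>) x = f x *\<^sub>R crd B \<sigma> x"
proof -
  obtain U \<phi> where U: "(U, \<phi>) \<in> vtriv B" "x \<in> U" and c: "\<And>\<sigma>. crd B \<sigma> x = \<phi> (\<sigma> x)"
    using crd_trivialisation[OF assms(1)] by blast
  show ?thesis unfolding c sscale_def by (rule vtrivD(4)[OF assms(1) U]) (simp_all add: assms vsec_proj)
qed

lemma crd_sneg: "vector_bundle B \<Longrightarrow> \<sigma> \<in> vsec B \<Longrightarrow> crd B (sneg B \<sigma>) x = - crd B \<sigma> x"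
  by (simp add: sneg_def crd_sscale)

lemma crd_vzero: "vector_bundle B \<Longrightarrow> crd B (vzero B) x = 0"
  by (metis crd_trivialisation vtrivD(5))

lemma sadd_vsec:
  assumes B: "vector_bundle B" "smooth_manifold B" and s: "\<sigma> \<in> vsec B" "\<eta> \<in> vsec B"
  shows "sadd B \<sigma> \<eta> \<in> vsec B"
proof (rule vsecI)
  show "vproj B (sadd B \<sigma> \<eta> x) = x" for x
    using B(1) s by (simp add: vector_bundle_def sadd_def vsec_proj)
  fix U \<phi> assume U: "(U, \<phi>) \<in> vtriv B"
  show "smooth_map B U (\<lambda>x. \<phi> (sadd B \<sigma> \<eta> x))"
    by (rule smooth_map_cong[OF B(2) vtrivD(1)[OF B(1) U] _
          smooth_map_add[OF B(2) vtrivD(1)[OF B(1) U] vsec_smooth[OF s(1) U] vsec_smooth[OF s(2) U]]])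
      (simp add: sadd_def vtrivD(3)[OF B(1) U] s vsec_proj)
qed

lemma sscale_vsec:
  assumes B: "vector_bundle B" "smooth_manifold B" and s: "\<sigma> \<in> vsec B" "f \<in> Cinf B"
  shows "sscale B f \<sigma> \<in> vsec B"
proof (rule vsecI)
  show "vproj B (sscale B f \<sigma> x) = x" for x
    using B(1) s by (simp add: vector_bundle_def sscale_def vsec_proj)
  fix U \<phi> assume U: "(U, \<phi>) \<in> vtriv B"
  have "smooth_map B U f" using s(2) smooth_map_subset[of B UNIV f U] by (simp add: Cinf_def)
  then have sm: "smooth_map B U (\<lambda>x. f x *\<^sub>R \<phi> (\<sigma> x))"
    by (rule smooth_map_bilinear[OF bounded_bilinear_scaleR B(2) vtrivD(1)[OF B(1) U] _ vsec_smooth[OF s(1) U]])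
  show "smooth_map B U (\<lambda>x. \<phi> (sscale B f \<sigma> x))"
    by (rule smooth_map_cong[OF B(2) vtrivD(1)[OF B(1) U] _ sm])
      (simp add: sscale_def vtrivD(4)[OF B(1) U] s vsec_proj)
qed

lemma sneg_vsec:
  "vector_bundle B \<Longrightarrow> smooth_manifold B \<Longrightarrow> \<sigma> \<in> vsec B \<Longrightarrow> sneg B \<sigma> \<in> vsec B"
  unfolding sneg_def by (rule sscale_vsec[OF _ _ _ Cinf_const])

lemma vzero_vsec:
  assumes B: "vector_bundle B" "smooth_manifold B"
  shows "vzero B \<in> vsec B"
proof (rule vsecI)
  show "vproj B (vzero B x) = x" for x
    using B(1) by (simp add: vector_bundle_def)
  fix U \<phi> assume U: "(U, \<phi>) \<in> vtriv B"
  show "smooth_map B U (\<lambda>x. \<phi> (vzero B x))"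
    by (rule smooth_map_cong[OF B(2) vtrivD(1)[OF B(1) U] _ smooth_map_const[of B _ 0]])
      (simp add: vtrivD(5)[OF B(1) U])
qed

text \<open>Smoothness of a section near a point in one trivialisation implies it in every other, because
  the transition maps are jointly smooth.\<close>

lemma vsec_local:
  fixes B :: "('m::{t2_space,second_countable_topology}, 'a::euclidean_space, 'v, 'f::real_inner, 'z) vec_bundle_scheme"
  assumes B: "vector_bundle B" "smooth_manifold B"
    and proj: "\<And>x. vproj B (\<sigma> x) = x"
    and loc: "\<And>x. \<exists>V U \<phi>. open V \<and> x \<in> V \<and> V \<subseteq> U \<and> (U, \<phi>) \<in> vtriv B \<and> smooth_map B V (\<lambda>y. \<phi> (\<sigma> y))"
  shows "\<sigma> \<in> vsec B"
proof (rule vsecI[OF proj], rule smooth_map_local[OF B(2)])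
  fix U' \<phi>' x assume U': "(U', \<phi>') \<in> vtriv B" and x: "x \<in> U'"
  obtain C :: "'f set" where C: "inner_frame C" using vbundle_frame[OF B(1)] .
  obtain V U \<phi> where V: "open V" "x \<in> V" "V \<subseteq> U" and U: "(U, \<phi>) \<in> vtriv B"
    and sm: "smooth_map B V (\<lambda>y. \<phi> (\<sigma> y))"
    using loc[of x] by - (elim exE conjE, rule that)
  have op: "open (V \<inter> U')" using V(1) vtrivD(1)[OF B(1) U'] by auto
  have "smooth_map_times B (V \<inter> U') (\<lambda>x y. \<phi>' (inv_into (vfibre B x) \<phi> y))"
    unfolding smooth_map_times_def
  proof clarify
    fix W c assume "(W, c) \<in> charts B"
    then have "smooth_on (c ` (U \<inter> U' \<inter> W) \<times> UNIV)
        (\<lambda>(z, y). \<phi>' (inv_into (vfibre B (inv_into W c z)) \<phi> y))"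
      using vtriv_transition[OF B(1) U U'] unfolding smooth_map_times_def by fast
    then show "smooth_on (c ` (V \<inter> U' \<inter> W) \<times> UNIV)
        (\<lambda>(z, y). \<phi>' (inv_into (vfibre B (inv_into W c z)) \<phi> y))"
      by (rule smooth_on_subset) (use V(3) in auto)
  qed
  then have "smooth_map B (V \<inter> U') (\<lambda>y. \<phi>' (inv_into (vfibre B y) \<phi> (\<phi> (\<sigma> y))))"
    by (rule smooth_map_times_apply[OF C B(2) op]) (rule smooth_map_subset[OF sm], auto)
  then have "smooth_map B (V \<inter> U') (\<lambda>y. \<phi>' (\<sigma> y))"
    by (rule smooth_map_cong[OF B(2) op, rotated]) (use vtriv_inv(1)[OF B(1) U] proj V(3) in auto)
  then show "\<exists>V. open V \<and> x \<in> V \<and> smooth_map B V (\<lambda>y. \<phi>' (\<sigma> y))"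
    using op V(2) x by blast
qed

text \<open>A vector of the typical fibre, multiplied by a bump function, extends to a global section.\<close>

lemma vsec_nonzero_at:
  fixes B :: "('m::{t2_space,second_countable_topology}, 'a::euclidean_space, 'v, 'f::real_inner, 'z) vec_bundle_scheme"
  assumes B: "vector_bundle B" "smooth_manifold B" and w: "w \<noteq> (0 :: 'f)"
  obtains \<sigma> where "\<sigma> \<in> vsec B" "crd B \<sigma> x \<noteq> 0"
proof -
  obtain U \<phi> where U: "(U, \<phi>) \<in> vtriv B" "x \<in> U" and c: "\<And>\<sigma>. crd B \<sigma> x = \<phi> (\<sigma> x)"
    using crd_trivialisation[OF B(1)] by blast
  note inv = vtriv_inv[OF B(1) U(1)]
  obtain \<beta> K where \<beta>: "\<beta> \<in> Cinf B" "closed K" "K \<subseteq> U" "\<beta> x \<noteq> 0" "\<And>y. y \<notin> K \<Longrightarrow> \<beta> y = 0"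
    using Cinf_bump[OF B(2) vtrivD(1)[OF B(1) U(1)] U(2)] by metis
  define \<sigma> where "\<sigma> y = (if y \<in> U then inv_into (vfibre B y) \<phi> (\<beta> y *\<^sub>R w) else vzero B y)" for y
  have proj: "vproj B (\<sigma> y) = y" for y
    using inv(3) vsec_proj[OF vzero_vsec[OF B]] by (simp add: \<sigma>_def)
  have in_U: "\<phi> (\<sigma> y) = \<beta> y *\<^sub>R w" if "y \<in> U" for y
    using that inv(2) by (simp add: \<sigma>_def)
  have off_K: "\<sigma> y = vzero B y" if "y \<notin> K" for y
  proof (cases "y \<in> U")
    case True
    have "\<phi> (\<sigma> y) = \<phi> (vzero B y)" using in_U[OF True] \<beta>(5)[OF that] vtrivD(5)[OF B(1) U(1) True] by simp
    then show ?thesis using inv(1)[OF True] proj vsec_proj[OF vzero_vsec[OF B]] by metis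
  qed (simp add: \<sigma>_def)
  have "\<sigma> \<in> vsec B"
  proof (rule vsec_local[OF B proj])
    fix y
    show "\<exists>V U \<phi>. open V \<and> y \<in> V \<and> V \<subseteq> U \<and> (U, \<phi>) \<in> vtriv B \<and> smooth_map B V (\<lambda>y. \<phi> (\<sigma> y))"
    proof (cases "y \<in> U")
      case True
      have op: "open U" by (rule vtrivD(1)[OF B(1) U(1)])
      have "smooth_map B U (\<lambda>y. \<beta> y *\<^sub>R w)"
        using smooth_map_subset[of B UNIV \<beta> U] \<beta>(1)
        by (intro smooth_map_bounded_linear[OF bounded_linear_scaleR_left B(2) op]) (simp add: Cinf_def)
      then have "smooth_map B U (\<lambda>y. \<phi> (\<sigma> y))"
        by (rule smooth_map_cong[OF B(2) op, rotated]) (simp add: in_U)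
      then show ?thesis using U op True by blast
    next
      case False
      then have y: "y \<in> - K" using \<beta>(3) by auto
      obtain U' \<phi>' where U': "(U', \<phi>') \<in> vtriv B" "y \<in> U'" using vbundle_trivialisation[OF B(1)] .
      have op: "open (U' \<inter> - K)" using \<beta>(2) vtrivD(1)[OF B(1) U'(1)] by auto
      have "smooth_map B (U' \<inter> - K) (\<lambda>y. \<phi>' (\<sigma> y))"
        by (rule smooth_map_cong[OF B(2) op _ smooth_map_const[of B _ 0]])
          (simp add: off_K vtrivD(5)[OF B(1) U'(1)])
      then show ?thesis using op y U' by blast
    qed
  qed
  moreover have "crd B \<sigma> x \<noteq> 0" using c in_U[OF U(2)] \<beta>(4) w by simp
  ultimately show ?thesis by (rule that)
qed

lemma affine_vector_bundle: "affine_bundle B \<Longrightarrow> vector_bundle B"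
  by (simp add: affine_bundle_def)

lemma abundle_trivialisation:
  assumes "affine_bundle B"
  obtains U \<psi> where "(U, \<psi>) \<in> atriv B" "x \<in> U"
proof -
  have "x \<in> \<Union> (fst ` atriv B)" using assms by (simp add: affine_bundle_def)
  then show ?thesis using that by force
qed

lemma atrivD:
  assumes "affine_bundle B" "(U, \<psi>) \<in> atriv B"
  shows "open U"
    and "x \<in> U \<Longrightarrow> bij_betw \<psi> (afibre B x) UNIV"
    and "\<exists>\<phi>. (U, \<phi>) \<in> vtriv B \<and>
      (\<forall>x\<in>U. \<forall>e\<in>afibre B x. \<forall>v\<in>vfibre B x. \<psi> (atrans B e v) = \<psi> e + \<phi> v)"
proof -
  have "\<forall>(U, \<psi>)\<in>atriv B. open U \<and>
        (\<forall>x\<in>U. bij_betw \<psi> (afibre B x) UNIV) \<and>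
        (\<exists>\<phi>. (U, \<phi>) \<in> vtriv B \<and>
           (\<forall>x\<in>U. \<forall>e\<in>afibre B x. \<forall>v\<in>vfibre B x. \<psi> (atrans B e v) = \<psi> e + \<phi> v))"
    using assms(1) unfolding affine_bundle_def by (elim conjE)
  then have "open U \<and>
        (\<forall>x\<in>U. bij_betw \<psi> (afibre B x) UNIV) \<and>
        (\<exists>\<phi>. (U, \<phi>) \<in> vtriv B \<and>
           (\<forall>x\<in>U. \<forall>e\<in>afibre B x. \<forall>v\<in>vfibre B x. \<psi> (atrans B e v) = \<psi> e + \<phi> v))"
    using assms(2) by blast
  then show "open U" "x \<in> U \<Longrightarrow> bij_betw \<psi> (afibre B x) UNIV"
    "\<exists>\<phi>. (U, \<phi>) \<in> vtriv B \<and>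
      (\<forall>x\<in>U. \<forall>e\<in>afibre B x. \<forall>v\<in>vfibre B x. \<psi> (atrans B e v) = \<psi> e + \<phi> v)"
    by (elim conjE; blast)+
qed

lemma atriv_linear_part:
  assumes "affine_bundle B" "(U, \<psi>) \<in> atriv B"
  obtains \<phi> where "(U, \<phi>) \<in> vtriv B"
    "\<And>e v. aproj B e \<in> U \<Longrightarrow> vproj B v = aproj B e \<Longrightarrow> \<psi> (atrans B e v) = \<psi> e + \<phi> v"
  using atrivD(3)[OF assms] unfolding afibre_def vfibre_def by blast

lemma atriv_inv:
  assumes "affine_bundle B" "(U, \<psi>) \<in> atriv B" "x \<in> U" "aproj B e = x"
  shows "inv_into (afibre B x) \<psi> (\<psi> e) = e"
  using bij_betw_inv_into_left[OF atrivD(2)[OF assms(1-3)]] assms(4) by (simp add: afibre_def)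

lemma atriv_eqI:
  assumes "affine_bundle B" "(U, \<psi>) \<in> atriv B" "x \<in> U" "aproj B e = x" "aproj B e' = x" "\<psi> e = \<psi> e'"
  shows "e = e'"
  using atriv_inv[OF assms(1-3)] assms(4-6) by metis

lemma atrans_proj:
  "affine_bundle B \<Longrightarrow> aproj B e = vproj B v \<Longrightarrow> aproj B (atrans B e v) = aproj B e"
  by (simp add: affine_bundle_def)

lemma strans_asec:
  assumes A: "affine_bundle B" "smooth_manifold B" and s: "\<zeta> \<in> asec B" "\<sigma> \<in> vsec B"
  shows "strans B \<zeta> \<sigma> \<in> asec B"
proof (rule asecI)
  show "aproj B (strans B \<zeta> \<sigma> x) = x" for x
    using atrans_proj[OF A(1)] s by (simp add: strans_def vsec_proj asec_proj)
  fix U \<psi> assume U: "(U, \<psi>) \<in> atriv B"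
  obtain \<phi> where \<phi>: "(U, \<phi>) \<in> vtriv B"
    "\<And>e v. aproj B e \<in> U \<Longrightarrow> vproj B v = aproj B e \<Longrightarrow> \<psi> (atrans B e v) = \<psi> e + \<phi> v"
    using atriv_linear_part[OF A(1) U] by blast
  show "smooth_map B U (\<lambda>x. \<psi> (strans B \<zeta> \<sigma> x))"
    by (rule smooth_map_cong[OF A(2) atrivD(1)[OF A(1) U] _
          smooth_map_add[OF A(2) atrivD(1)[OF A(1) U] asec_smooth[OF s(1) U] vsec_smooth[OF s(2) \<phi>(1)]]])
      (simp add: strans_def \<phi>(2) s vsec_proj asec_proj)
qed

lemma sdiff_trivialisation:
  assumes A: "affine_bundle B" and z: "\<zeta>\<^sub>1 \<in> asec B" "\<zeta>\<^sub>2 \<in> asec B"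
    and U: "(U, \<psi>) \<in> atriv B" "(U, \<phi>) \<in> vtriv B" "x \<in> U"
      "\<And>e v. aproj B e \<in> U \<Longrightarrow> vproj B v = aproj B e \<Longrightarrow> \<psi> (atrans B e v) = \<psi> e + \<phi> v"
  shows "vproj B (sdiff B \<zeta>\<^sub>2 \<zeta>\<^sub>1 x) = x" "atrans B (\<zeta>\<^sub>1 x) (sdiff B \<zeta>\<^sub>2 \<zeta>\<^sub>1 x) = \<zeta>\<^sub>2 x"
    "\<phi> (sdiff B \<zeta>\<^sub>2 \<zeta>\<^sub>1 x) = \<psi> (\<zeta>\<^sub>2 x) - \<psi> (\<zeta>\<^sub>1 x)"
proof -
  note inv = vtriv_inv[OF affine_vector_bundle[OF A] U(2,3)]
  define v where "v = inv_into (vfibre B x) \<phi> (\<psi> (\<zeta>\<^sub>2 x) - \<psi> (\<zeta>\<^sub>1 x))"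
  have v: "vproj B v = x" "\<phi> v = \<psi> (\<zeta>\<^sub>2 x) - \<psi> (\<zeta>\<^sub>1 x)" unfolding v_def by (rule inv)+
  have psi: "\<psi> (atrans B (\<zeta>\<^sub>1 x) u) = \<psi> (\<zeta>\<^sub>1 x) + \<phi> u" if "vproj B u = x" for u
    using U(3,4) z that by (simp add: asec_proj)
  have "atrans B (\<zeta>\<^sub>1 x) v = \<zeta>\<^sub>2 x"
    by (rule atriv_eqI[OF A U(1,3)]) (use atrans_proj[OF A] psi v z in \<open>simp_all add: asec_proj\<close>)
  moreover have "u = v" if "u \<in> vfibre B x" "atrans B (\<zeta>\<^sub>1 x) u = \<zeta>\<^sub>2 x" for u
  proof -
    have u: "vproj B u = x" using that(1) by (simp add: vfibre_def)
    have "\<phi> u = \<phi> v" using psi[OF u] that(2) v(2) by simp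
    from arg_cong[OF this, of "inv_into (vfibre B x) \<phi>"] show ?thesis
      unfolding inv(1)[OF u] inv(1)[OF v(1)] .
  qed
  moreover have "v \<in> vfibre B x" using v(1) by (simp add: vfibre_def)
  ultimately have eq: "sdiff B \<zeta>\<^sub>2 \<zeta>\<^sub>1 x = v"
    unfolding sdiff_def by (intro the_equality) blast+
  then show "vproj B (sdiff B \<zeta>\<^sub>2 \<zeta>\<^sub>1 x) = x" "atrans B (\<zeta>\<^sub>1 x) (sdiff B \<zeta>\<^sub>2 \<zeta>\<^sub>1 x) = \<zeta>\<^sub>2 x"
    "\<phi> (sdiff B \<zeta>\<^sub>2 \<zeta>\<^sub>1 x) = \<psi> (\<zeta>\<^sub>2 x) - \<psi> (\<zeta>\<^sub>1 x)"
    using v \<open>atrans B (\<zeta>\<^sub>1 x) v = \<zeta>\<^sub>2 x\<close> by simp_all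
qed

lemma sdiff_vsec:
  fixes B :: "('m::{t2_space,second_countable_topology}, 'a::euclidean_space, 'v, 'f::real_inner, 'e, 'z) aff_bundle_scheme"
  assumes A: "affine_bundle B" "smooth_manifold B" and z: "\<zeta>\<^sub>1 \<in> asec B" "\<zeta>\<^sub>2 \<in> asec B"
  shows "sdiff B \<zeta>\<^sub>2 \<zeta>\<^sub>1 \<in> vsec B"
proof (rule vsec_local[OF affine_vector_bundle[OF A(1)] A(2)])
  fix x
  obtain U \<psi> where U: "(U, \<psi>) \<in> atriv B" "x \<in> U" using abundle_trivialisation[OF A(1)] .
  obtain \<phi> where \<phi>: "(U, \<phi>) \<in> vtriv B"
    "\<And>e v. aproj B e \<in> U \<Longrightarrow> vproj B v = aproj B e \<Longrightarrow> \<psi> (atrans B e v) = \<psi> e + \<phi> v"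
    using atriv_linear_part[OF A(1) U(1)] by blast
  note diff = sdiff_trivialisation[OF A(1) z U(1) \<phi>(1) _ \<phi>(2)]
  show "vproj B (sdiff B \<zeta>\<^sub>2 \<zeta>\<^sub>1 x) = x" using diff(1) U(2) by blast
  have op: "open U" by (rule atrivD(1)[OF A(1) U(1)])
  have "smooth_map B U (\<lambda>x. \<psi> (\<zeta>\<^sub>2 x) + - \<psi> (\<zeta>\<^sub>1 x))"
    by (rule smooth_map_add[OF A(2) op asec_smooth[OF z(2) U(1)]
          smooth_map_bounded_linear[OF bounded_linear_minus[OF bounded_linear_ident] A(2) op
            asec_smooth[OF z(1) U(1)]]])
  then have "smooth_map B U (\<lambda>x. \<phi> (sdiff B \<zeta>\<^sub>2 \<zeta>\<^sub>1 x))"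
    by (rule smooth_map_cong[OF A(2) op, rotated]) (simp add: diff(3))
  then show "\<exists>V U \<phi>. open V \<and> x \<in> V \<and> V \<subseteq> U \<and> (U, \<phi>) \<in> vtriv B \<and>
      smooth_map B V (\<lambda>y. \<phi> (sdiff B \<zeta>\<^sub>2 \<zeta>\<^sub>1 y))"
    using U(2) op \<phi>(1) by blast
qed

lemma strans_sdiff:
  assumes A: "affine_bundle B" and z: "\<zeta>\<^sub>1 \<in> asec B" "\<zeta>\<^sub>2 \<in> asec B"
  shows "strans B \<zeta>\<^sub>1 (sdiff B \<zeta>\<^sub>2 \<zeta>\<^sub>1) = \<zeta>\<^sub>2"
proof
  fix x
  obtain U \<psi> where U: "(U, \<psi>) \<in> atriv B" "x \<in> U" using abundle_trivialisation[OF A(1)] .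
  obtain \<phi> where \<phi>: "(U, \<phi>) \<in> vtriv B"
    "\<And>e v. aproj B e \<in> U \<Longrightarrow> vproj B v = aproj B e \<Longrightarrow> \<psi> (atrans B e v) = \<psi> e + \<phi> v"
    using atriv_linear_part[OF A(1) U(1)] by blast
  show "strans B \<zeta>\<^sub>1 (sdiff B \<zeta>\<^sub>2 \<zeta>\<^sub>1) x = \<zeta>\<^sub>2 x"
    unfolding strans_def by (rule sdiff_trivialisation(2)[OF A(1) z U(1) \<phi>(1) U(2) \<phi>(2)])
qed

text \<open>Translation and difference are determined at each point by an affine coordinate whose linear
  part is a coordinate of the vector bundle.\<close>

lemma abundle_coordinate:
  fixes B :: "('m::{t2_space,second_countable_topology}, 'a::euclidean_space, 'v, 'f::real_inner, 'e, 'z) aff_bundle_scheme"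
  assumes A: "affine_bundle B"
  obtains \<psi> :: "'e \<Rightarrow> 'f" and \<phi> :: "'v \<Rightarrow> 'f" where
    "\<And>\<zeta>\<^sub>1 \<zeta>\<^sub>2. \<zeta>\<^sub>1 \<in> asec B \<Longrightarrow> \<zeta>\<^sub>2 \<in> asec B \<Longrightarrow> \<phi> (sdiff B \<zeta>\<^sub>2 \<zeta>\<^sub>1 x) = \<psi> (\<zeta>\<^sub>2 x) - \<psi> (\<zeta>\<^sub>1 x)"
    "\<And>\<zeta> \<sigma>. \<zeta> \<in> asec B \<Longrightarrow> \<sigma> \<in> vsec B \<Longrightarrow> \<psi> (strans B \<zeta> \<sigma> x) = \<psi> (\<zeta> x) + \<phi> (\<sigma> x)"
    "\<And>\<sigma> \<eta>. \<sigma> \<in> vsec B \<Longrightarrow> \<eta> \<in> vsec B \<Longrightarrow> \<phi> (sadd B \<sigma> \<eta> x) = \<phi> (\<sigma> x) + \<phi> (\<eta> x)"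
    "\<And>\<sigma>. \<sigma> \<in> vsec B \<Longrightarrow> \<phi> (sneg B \<sigma> x) = - \<phi> (\<sigma> x)"
    "\<And>\<sigma> \<eta>. \<sigma> \<in> vsec B \<Longrightarrow> \<eta> \<in> vsec B \<Longrightarrow> \<phi> (\<sigma> x) = \<phi> (\<eta> x) \<Longrightarrow> \<sigma> x = \<eta> x"
proof -
  note V = affine_vector_bundle[OF A]
  obtain U \<psi> where U: "(U, \<psi>) \<in> atriv B" "x \<in> U" using abundle_trivialisation[OF A(1)] .
  obtain \<phi> where \<phi>: "(U, \<phi>) \<in> vtriv B"
    "\<And>e v. aproj B e \<in> U \<Longrightarrow> vproj B v = aproj B e \<Longrightarrow> \<psi> (atrans B e v) = \<psi> e + \<phi> v"
    using atriv_linear_part[OF A(1) U(1)] by blast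
  show ?thesis
  proof (rule that[of \<phi> \<psi>])
    fix \<zeta>\<^sub>1 \<zeta>\<^sub>2 assume z: "\<zeta>\<^sub>1 \<in> asec B" "\<zeta>\<^sub>2 \<in> asec B"
    show "\<phi> (sdiff B \<zeta>\<^sub>2 \<zeta>\<^sub>1 x) = \<psi> (\<zeta>\<^sub>2 x) - \<psi> (\<zeta>\<^sub>1 x)"
      by (rule sdiff_trivialisation(3)[OF A z U(1) \<phi>(1) U(2) \<phi>(2)])
  next
    fix \<zeta> \<sigma> assume "\<zeta> \<in> asec B" "\<sigma> \<in> vsec B"
    then show "\<psi> (strans B \<zeta> \<sigma> x) = \<psi> (\<zeta> x) + \<phi> (\<sigma> x)"
      using \<phi>(2) U(2) by (simp add: strans_def asec_proj vsec_proj)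
  next
    fix \<sigma> \<eta> assume s: "\<sigma> \<in> vsec B" "\<eta> \<in> vsec B"
    show "\<phi> (sadd B \<sigma> \<eta> x) = \<phi> (\<sigma> x) + \<phi> (\<eta> x)"
      unfolding sadd_def by (rule vtrivD(3)[OF V \<phi>(1) U(2)]) (simp_all add: s vsec_proj)
    assume "\<phi> (\<sigma> x) = \<phi> (\<eta> x)"
    from arg_cong[OF this, of "inv_into (vfibre B x) \<phi>"] show "\<sigma> x = \<eta> x"
      unfolding vtriv_inv(1)[OF V \<phi>(1) U(2) vsec_proj[OF s(1)]]
        vtriv_inv(1)[OF V \<phi>(1) U(2) vsec_proj[OF s(2)]] .
  next
    fix \<sigma> assume "\<sigma> \<in> vsec B"
    then show "\<phi> (sneg B \<sigma> x) = - \<phi> (\<sigma> x)"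
      unfolding sneg_def sscale_def using vtrivD(4)[OF V \<phi>(1) U(2)] by (simp add: vsec_proj)
  qed
qed

section \<open>The Lie algebra hull of the affine sections\<close>

locale leibniz_bracket =
  fixes B :: "('m::{t2_space,second_countable_topology}, 'a::euclidean_space, 'v, 'f::real_inner, 'e, 'z) leib_bundle_scheme"
  assumes leibniz: "leibniz_bracket_bundle B"
begin

lemma smooth_mfd: "smooth_manifold B"
  using leibniz unfolding leibniz_bracket_bundle_def fibred_manifold_def by (elim conjE)

lemma affine: "affine_bundle B"
  using leibniz unfolding leibniz_bracket_bundle_def by (elim conjE)

lemma vec: "vector_bundle B"
  using affine by (rule affine_vector_bundle)

lemmas section_simps [simp] =
  sadd_vsec[OF vec smooth_mfd] sscale_vsec[OF vec smooth_mfd] sneg_vsec[OF vec smooth_mfd]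
  vzero_vsec[OF vec smooth_mfd] strans_asec[OF affine smooth_mfd] sdiff_vsec[OF affine smooth_mfd]
  Cinf_const Cinf_add[OF smooth_mfd] Cinf_cmult[OF smooth_mfd] Cinf_minus[OF smooth_mfd]
  Cinf_mult[OF smooth_mfd]

lemma vbr_closed [simp]: "\<sigma> \<in> vsec B \<Longrightarrow> \<eta> \<in> vsec B \<Longrightarrow> vbr B \<sigma> \<eta> \<in> vsec B"
  and vbr_skew: "\<sigma> \<in> vsec B \<Longrightarrow> \<eta> \<in> vsec B \<Longrightarrow> vbr B \<sigma> \<eta> = sneg B (vbr B \<eta> \<sigma>)"
proof -
  have "\<forall>\<sigma>\<in>vsec B. \<forall>\<eta>\<in>vsec B. vbr B \<sigma> \<eta> \<in> vsec B \<and> vbr B \<sigma> \<eta> = sneg B (vbr B \<eta> \<sigma>)"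
    using leibniz unfolding leibniz_bracket_bundle_def by (elim conjE)
  then show "\<sigma> \<in> vsec B \<Longrightarrow> \<eta> \<in> vsec B \<Longrightarrow> vbr B \<sigma> \<eta> \<in> vsec B"
    "\<sigma> \<in> vsec B \<Longrightarrow> \<eta> \<in> vsec B \<Longrightarrow> vbr B \<sigma> \<eta> = sneg B (vbr B \<eta> \<sigma>)" by blast+
qed

lemma vbr_add:
  assumes "\<sigma> \<in> vsec B" "\<sigma>' \<in> vsec B" "\<eta> \<in> vsec B"
  shows "vbr B (sadd B \<sigma> \<sigma>') \<eta> = sadd B (vbr B \<sigma> \<eta>) (vbr B \<sigma>' \<eta>)"
    and "vbr B \<eta> (sadd B \<sigma> \<sigma>') = sadd B (vbr B \<eta> \<sigma>) (vbr B \<eta> \<sigma>')"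
proof -
  have "\<forall>\<sigma>\<in>vsec B. \<forall>\<sigma>'\<in>vsec B. \<forall>\<eta>\<in>vsec B.
        vbr B (sadd B \<sigma> \<sigma>') \<eta> = sadd B (vbr B \<sigma> \<eta>) (vbr B \<sigma>' \<eta>) \<and>
        vbr B \<eta> (sadd B \<sigma> \<sigma>') = sadd B (vbr B \<eta> \<sigma>) (vbr B \<eta> \<sigma>')"
    using leibniz unfolding leibniz_bracket_bundle_def by (elim conjE)
  then show "vbr B (sadd B \<sigma> \<sigma>') \<eta> = sadd B (vbr B \<sigma> \<eta>) (vbr B \<sigma>' \<eta>)"
    "vbr B \<eta> (sadd B \<sigma> \<sigma>') = sadd B (vbr B \<eta> \<sigma>) (vbr B \<eta> \<sigma>')"
    using assms by blast+
qed

lemma vbr_scale: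
  assumes "\<sigma> \<in> vsec B" "\<eta> \<in> vsec B"
  shows "vbr B (sscale B (\<lambda>_. a) \<sigma>) \<eta> = sscale B (\<lambda>_. a) (vbr B \<sigma> \<eta>)"
    and "vbr B \<eta> (sscale B (\<lambda>_. a) \<sigma>) = sscale B (\<lambda>_. a) (vbr B \<eta> \<sigma>)"
proof -
  have "\<forall>a. \<forall>\<sigma>\<in>vsec B. \<forall>\<eta>\<in>vsec B.
        vbr B (sscale B (\<lambda>_. a) \<sigma>) \<eta> = sscale B (\<lambda>_. a) (vbr B \<sigma> \<eta>) \<and>
        vbr B \<eta> (sscale B (\<lambda>_. a) \<sigma>) = sscale B (\<lambda>_. a) (vbr B \<eta> \<sigma>)"
    using leibniz unfolding leibniz_bracket_bundle_def by (elim conjE)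
  then show "vbr B (sscale B (\<lambda>_. a) \<sigma>) \<eta> = sscale B (\<lambda>_. a) (vbr B \<sigma> \<eta>)"
    "vbr B \<eta> (sscale B (\<lambda>_. a) \<sigma>) = sscale B (\<lambda>_. a) (vbr B \<eta> \<sigma>)"
    using assms by blast+
qed

lemma abr_closed [simp]: "\<zeta> \<in> asec B \<Longrightarrow> \<sigma> \<in> vsec B \<Longrightarrow> abr B \<zeta> \<sigma> \<in> vsec B"
proof -
  have "\<forall>\<zeta>\<in>asec B. \<forall>\<sigma>\<in>vsec B. abr B \<zeta> \<sigma> \<in> vsec B"
    using leibniz unfolding leibniz_bracket_bundle_def by (elim conjE)
  then show "\<zeta> \<in> asec B \<Longrightarrow> \<sigma> \<in> vsec B \<Longrightarrow> abr B \<zeta> \<sigma> \<in> vsec B" by blast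
qed

lemma abr_add:
  assumes "\<zeta> \<in> asec B" "\<sigma> \<in> vsec B" "\<eta> \<in> vsec B"
  shows "abr B \<zeta> (sadd B \<sigma> \<eta>) = sadd B (abr B \<zeta> \<sigma>) (abr B \<zeta> \<eta>)"
proof -
  have "\<forall>\<zeta>\<in>asec B. \<forall>\<sigma>\<^sub>1\<in>vsec B. \<forall>\<sigma>\<^sub>2\<in>vsec B.
        abr B \<zeta> (sadd B \<sigma>\<^sub>1 \<sigma>\<^sub>2) = sadd B (abr B \<zeta> \<sigma>\<^sub>1) (abr B \<zeta> \<sigma>\<^sub>2)"
    using leibniz unfolding leibniz_bracket_bundle_def by (elim conjE)
  then show ?thesis using assms by blast
qed

lemma abr_strans:
  assumes "\<zeta> \<in> asec B" "\<sigma> \<in> vsec B" "\<eta> \<in> vsec B"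
  shows "abr B (strans B \<zeta> \<sigma>) \<eta> = sadd B (abr B \<zeta> \<eta>) (vbr B \<sigma> \<eta>)"
proof -
  have "\<forall>\<zeta>\<in>asec B. \<forall>\<sigma>\<in>vsec B. \<forall>\<eta>\<in>vsec B.
        abr B (strans B \<zeta> \<sigma>) \<eta> = sadd B (abr B \<zeta> \<eta>) (vbr B \<sigma> \<eta>)"
    using leibniz unfolding leibniz_bracket_bundle_def by (elim conjE)
  then show ?thesis using assms by blast
qed

lemma abr_leibniz:
  assumes "\<zeta> \<in> asec B" "\<sigma> \<in> vsec B" "f \<in> Cinf B"
  shows "abr B \<zeta> (sscale B f \<sigma>) = sadd B (sscale B f (abr B \<zeta> \<sigma>)) (sscale B (anchor_act B \<zeta> f) \<sigma>)"
proof -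
  have "\<forall>\<zeta>\<in>asec B. \<forall>\<sigma>\<in>vsec B. \<forall>f\<in>Cinf B.
        abr B \<zeta> (sscale B f \<sigma>) = sadd B (sscale B f (abr B \<zeta> \<sigma>)) (sscale B (anchor_act B \<zeta> f) \<sigma>)"
    using leibniz unfolding leibniz_bracket_bundle_def by (elim conjE)
  then show ?thesis using assms by blast
qed

lemma anchorD:
  shows "anchor B e \<in> tangent_space B (aproj B e)"
    and "vproj B u = vproj B v \<Longrightarrow> lanchor B (vadd B u v) ch = lanchor B u ch + lanchor B v ch"
    and "lanchor B (vscale B a v) ch = a *\<^sub>R lanchor B v ch"
    and "aproj B e = vproj B v \<Longrightarrow> anchor B (atrans B e v) ch = anchor B e ch + lanchor B v ch"
    and "(U, \<psi>) \<in> atriv B \<Longrightarrow> (W, c) \<in> charts B \<Longrightarrow>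
      smooth_map_times B (U \<inter> W) (\<lambda>x y. anchor B (inv_into (afibre B x) \<psi> y) (W, c))"
proof -
  have A: "affine_anchor B"
    using leibniz unfolding leibniz_bracket_bundle_def by (elim conjE)
  note defs = A[unfolded affine_anchor_def]
  have "\<forall>e. anchor B e \<in> jet_space B (aproj B e)" using defs by (elim conjE)
  then show "anchor B e \<in> tangent_space B (aproj B e)" by (simp add: jet_space_def)
  have "\<forall>u v ch. vproj B u = vproj B v \<longrightarrow> lanchor B (vadd B u v) ch = lanchor B u ch + lanchor B v ch"
    using defs by (elim conjE)
  then show "vproj B u = vproj B v \<Longrightarrow> lanchor B (vadd B u v) ch = lanchor B u ch + lanchor B v ch" by blast
  have "\<forall>a v ch. lanchor B (vscale B a v) ch = a *\<^sub>R lanchor B v ch"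
    using defs by (elim conjE)
  then show "lanchor B (vscale B a v) ch = a *\<^sub>R lanchor B v ch" by blast
  have "\<forall>e v ch. aproj B e = vproj B v \<longrightarrow> anchor B (atrans B e v) ch = anchor B e ch + lanchor B v ch"
    using defs by (elim conjE)
  then show "aproj B e = vproj B v \<Longrightarrow> anchor B (atrans B e v) ch = anchor B e ch + lanchor B v ch" by blast
  have "\<forall>(U, \<psi>)\<in>atriv B. \<forall>(W, c)\<in>charts B.
      smooth_map_times B (U \<inter> W) (\<lambda>x y. anchor B (inv_into (afibre B x) \<psi> y) (W, c))"
    using defs by (elim conjE)
  then show "(U, \<psi>) \<in> atriv B \<Longrightarrow> (W, c) \<in> charts B \<Longrightarrow>
      smooth_map_times B (U \<inter> W) (\<lambda>x y. anchor B (inv_into (afibre B x) \<psi> y) (W, c))"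
    by blast
qed

definition rho :: "('m \<Rightarrow> 'v) \<Rightarrow> ('m \<Rightarrow> real) \<Rightarrow> 'm \<Rightarrow> real" where
  "rho \<sigma> f x = dir_deriv B x (lanchor B (\<sigma> x)) f"

lemma anchor_act_strans:
  "\<zeta> \<in> asec B \<Longrightarrow> \<sigma> \<in> vsec B \<Longrightarrow> f \<in> Cinf B \<Longrightarrow>
    anchor_act B (strans B \<zeta> \<sigma>) f x = anchor_act B \<zeta> f x + rho \<sigma> f x"
  unfolding anchor_act_def rho_def strans_def
  by (rule dir_deriv_add_vec[OF smooth_mfd]) (auto intro!: anchorD(4) simp: asec_proj vsec_proj)

lemma rho_sadd:
  "\<sigma> \<in> vsec B \<Longrightarrow> \<eta> \<in> vsec B \<Longrightarrow> f \<in> Cinf B \<Longrightarrow> rho (sadd B \<sigma> \<eta>) f x = rho \<sigma> f x + rho \<eta> f x"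
  unfolding rho_def sadd_def
  by (rule dir_deriv_add_vec[OF smooth_mfd]) (auto intro!: anchorD(2) simp: vsec_proj)

lemma rho_sscale:
  "f \<in> Cinf B \<Longrightarrow> rho (sscale B g \<sigma>) f x = g x * rho \<sigma> f x"
  unfolding rho_def sscale_def
  by (rule dir_deriv_scale_vec[OF smooth_mfd]) (auto intro!: anchorD(3))

lemma rho_sneg: "f \<in> Cinf B \<Longrightarrow> rho (sneg B \<sigma>) f x = - rho \<sigma> f x"
  by (simp add: sneg_def rho_sscale)

lemma anchor_act_linear:
  assumes "f \<in> Cinf B" "g \<in> Cinf B"
  shows "anchor_act B \<zeta> (\<lambda>y. f y + g y) x = anchor_act B \<zeta> f x + anchor_act B \<zeta> g x"
    and "anchor_act B \<zeta> (\<lambda>y. a * f y) x = a * anchor_act B \<zeta> f x"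
    and "rho \<sigma> (\<lambda>y. f y + g y) x = rho \<sigma> f x + rho \<sigma> g x"
    and "rho \<sigma> (\<lambda>y. a * f y) x = a * rho \<sigma> f x"
  unfolding anchor_act_def rho_def
  using dir_deriv_add_fun[OF smooth_mfd assms] dir_deriv_cmult_fun[OF smooth_mfd assms(1)] by auto

lemma anchor_act_const: "anchor_act B \<zeta> (\<lambda>_. a) x = 0"
proof -
  have "anchor_act B \<zeta> (\<lambda>_. 0) x = 0"
    using anchor_act_linear(2)[OF Cinf_const Cinf_const, of \<zeta> 0 1] by simp
  moreover have "anchor_act B \<zeta> (\<lambda>_. 1) x = 0"
  proof -
    obtain W c where d: "\<And>X f. dir_deriv B x X f = frechet_derivative (f \<circ> inv_into W c) (at (c x)) (X (W, c))"
      using dir_deriv_some_chart[OF smooth_mfd] by metis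
    show ?thesis unfolding anchor_act_def d by (simp add: o_def)
  qed
  ultimately show ?thesis
    using anchor_act_linear(2)[OF Cinf_const Cinf_const, of \<zeta> a 1] by simp
qed

text \<open>In a chart, \<open>\<lambda>(\<zeta>)(f)\<close> is the derivative of \<open>f\<close> applied to the component of the anchor along \<open>\<zeta>\<close>,
  and both depend smoothly on the point.\<close>

lemma anchor_act_Cinf [simp]:
  assumes "\<zeta> \<in> asec B" "f \<in> Cinf B"
  shows "anchor_act B \<zeta> f \<in> Cinf B"
proof -
  obtain C :: "'f set" where C: "inner_frame C" using vbundle_frame[OF vec] .
  have "\<exists>V. open V \<and> x \<in> V \<and> smooth_map B V (anchor_act B \<zeta> f)" for x
  proof -
    obtain W c where W: "(W, c) \<in> charts B" "x \<in> W" using chart_exists[OF smooth_mfd] .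
    obtain U \<psi> where U: "(U, \<psi>) \<in> atriv B" "x \<in> U" using abundle_trivialisation[OF affine] .
    define h where "h z = frechet_derivative (\<lambda>z. f (inv_into W c z)) (at z) (anchor B (\<zeta> (inv_into W c z)) (W, c))" for z
    have op: "open (U \<inter> W)"
      using chartD(1)[OF smooth_mfd W(1)] atrivD(1)[OF affine U(1)] by auto
    have opc: "open (c ` (U \<inter> W))"
      using open_chart_image[OF smooth_mfd W(1) op] by (simp add: Int_assoc)
    have "smooth_map B (U \<inter> W) (\<lambda>x. anchor B (inv_into (afibre B x) \<psi> (\<psi> (\<zeta> x))) (W, c))"
      by (rule smooth_map_times_apply[OF C smooth_mfd op anchorD(5)[OF U(1) W(1)]
            smooth_map_subset[OF asec_smooth[OF assms(1) U(1)]]]) auto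
    then have "smooth_map B (U \<inter> W) (\<lambda>x. anchor B (\<zeta> x) (W, c))"
      by (rule smooth_map_cong[OF smooth_mfd op, rotated])
        (use atriv_inv[OF affine U(1)] asec_proj[OF assms(1)] in auto)
    from smooth_mapD[OF this W(1)]
    have X: "smooth_on (c ` (U \<inter> W)) (\<lambda>z. anchor B (\<zeta> (inv_into W c z)) (W, c))"
      by (simp add: Int_assoc)
    have f: "smooth_on (c ` (U \<inter> W)) (\<lambda>z. f (inv_into W c z))"
      using smooth_mapD[OF smooth_map_subset[of B UNIV f U] W(1)] assms(2) by (simp add: Cinf_def)
    have "smooth_on (c ` (U \<inter> W)) h"
      unfolding h_def[abs_def] by (rule smooth_on_frechet_derivative[OF opc f X])
    moreover have "anchor_act B \<zeta> f y = h (c y)" if "y \<in> U \<inter> W" for y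
    proof -
      have "anchor B (\<zeta> y) \<in> tangent_space B y" using anchorD(1)[of "\<zeta> y"] asec_proj[OF assms(1)] by simp
      from dir_deriv_chart[OF smooth_mfd assms(2) this W(1)] that show ?thesis
        by (simp add: anchor_act_def h_def o_def chart_inverse[OF smooth_mfd W(1)])
    qed
    ultimately have "smooth_map B (U \<inter> W) (anchor_act B \<zeta> f)"
      by (intro smooth_map_in_chart[OF smooth_mfd W(1) op]) auto
    then show ?thesis using op W(2) U(2) by blast
  qed
  then show ?thesis unfolding Cinf_def using smooth_map_local[OF smooth_mfd] by blast
qed

lemma rho_Cinf [simp]:
  assumes "\<zeta> \<in> asec B" "\<sigma> \<in> vsec B" "f \<in> Cinf B"
  shows "rho \<sigma> f \<in> Cinf B"
proof -
  have "rho \<sigma> f = (\<lambda>x. anchor_act B (strans B \<zeta> \<sigma>) f x - anchor_act B \<zeta> f x)"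
    using assms by (simp add: anchor_act_strans fun_eq_iff)
  then show ?thesis using assms by simp
qed

lemmas eqI = section_eqI[OF vec]

lemmas crd_basic = crd_sadd[OF vec] crd_sscale[OF vec] crd_sneg[OF vec] crd_vzero[OF vec]

lemma abr_scale:
  assumes "\<zeta> \<in> asec B" "\<sigma> \<in> vsec B"
  shows "abr B \<zeta> (sscale B (\<lambda>_. a) \<sigma>) = sscale B (\<lambda>_. a) (abr B \<zeta> \<sigma>)"
proof (rule eqI)
  have "anchor_act B \<zeta> (\<lambda>_. a) = (\<lambda>_. 0)" by (simp add: anchor_act_const fun_eq_iff)
  then show "crd B (abr B \<zeta> (sscale B (\<lambda>_. a) \<sigma>)) x = crd B (sscale B (\<lambda>_. a) (abr B \<zeta> \<sigma>)) x" for x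
    using assms by (simp add: abr_leibniz crd_basic)
qed (use assms in simp_all)

lemma vzero_scale: "vzero B = sscale B (\<lambda>_. 0) (vzero B)"
  by (rule eqI) (simp_all add: crd_basic)

lemma crd_abr_strans:
  assumes "\<zeta> \<in> asec B" "\<sigma> \<in> vsec B" "\<eta> \<in> vsec B"
  shows "crd B (abr B (strans B \<zeta> \<sigma>) \<eta>) x = crd B (abr B \<zeta> \<eta>) x + crd B (vbr B \<sigma> \<eta>) x"
  using assms by (simp add: abr_strans crd_basic)

lemma crd_vbr_linear:
  assumes "\<sigma> \<in> vsec B" "\<sigma>' \<in> vsec B" "\<eta> \<in> vsec B"
  shows "crd B (vbr B (sadd B \<sigma> \<sigma>') \<eta>) x = crd B (vbr B \<sigma> \<eta>) x + crd B (vbr B \<sigma>' \<eta>) x"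
    and "crd B (vbr B \<eta> (sadd B \<sigma> \<sigma>')) x = crd B (vbr B \<eta> \<sigma>) x + crd B (vbr B \<eta> \<sigma>') x"
  using assms by (simp_all add: vbr_add crd_basic)

lemma crd_scale:
  assumes "\<zeta> \<in> asec B" "\<sigma> \<in> vsec B"
  shows "crd B (abr B \<zeta> (sscale B (\<lambda>_. a) \<sigma>)) x = a *\<^sub>R crd B (abr B \<zeta> \<sigma>) x"
    and "crd B (abr B \<zeta> (sneg B \<sigma>)) x = - crd B (abr B \<zeta> \<sigma>) x"
  using assms by (simp_all add: abr_scale sneg_def crd_basic)

lemma crd_vbr_scale:
  assumes "\<sigma> \<in> vsec B" "\<eta> \<in> vsec B"
  shows "crd B (vbr B (sscale B (\<lambda>_. a) \<sigma>) \<eta>) x = a *\<^sub>R crd B (vbr B \<sigma> \<eta>) x"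
    and "crd B (vbr B \<eta> (sscale B (\<lambda>_. a) \<sigma>)) x = a *\<^sub>R crd B (vbr B \<eta> \<sigma>) x"
    and "crd B (vbr B (sneg B \<sigma>) \<eta>) x = - crd B (vbr B \<sigma> \<eta>) x"
    and "crd B (vbr B \<eta> (sneg B \<sigma>)) x = - crd B (vbr B \<eta> \<sigma>) x"
    and "crd B (vbr B (vzero B) \<eta>) x = 0"
    and "crd B (vbr B \<eta> (vzero B)) x = 0"
proof -
  show "crd B (vbr B (sscale B (\<lambda>_. a) \<sigma>) \<eta>) x = a *\<^sub>R crd B (vbr B \<sigma> \<eta>) x"
    "crd B (vbr B \<eta> (sscale B (\<lambda>_. a) \<sigma>)) x = a *\<^sub>R crd B (vbr B \<eta> \<sigma>) x"
    "crd B (vbr B (sneg B \<sigma>) \<eta>) x = - crd B (vbr B \<sigma> \<eta>) x"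
    "crd B (vbr B \<eta> (sneg B \<sigma>)) x = - crd B (vbr B \<eta> \<sigma>) x"
    using assms by (simp_all add: vbr_scale sneg_def crd_basic)
  show "crd B (vbr B (vzero B) \<eta>) x = 0" "crd B (vbr B \<eta> (vzero B)) x = 0"
    using assms by (subst vzero_scale, simp add: vbr_scale crd_basic)+
qed

lemma crd_abr_vzero: "\<zeta> \<in> asec B \<Longrightarrow> crd B (abr B \<zeta> (vzero B)) x = 0"
  by (subst vzero_scale) (simp add: abr_scale crd_basic)

lemma crd_vbr_skew: "\<sigma> \<in> vsec B \<Longrightarrow> \<eta> \<in> vsec B \<Longrightarrow> crd B (vbr B \<sigma> \<eta>) x = - crd B (vbr B \<eta> \<sigma>) x"
  by (subst vbr_skew) (simp_all add: crd_basic)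

lemma crd_vbr_self: "\<sigma> \<in> vsec B \<Longrightarrow> crd B (vbr B \<sigma> \<sigma>) x = 0"
proof -
  assume "\<sigma> \<in> vsec B"
  from crd_vbr_skew[OF this this, of x] have "2 *\<^sub>R crd B (vbr B \<sigma> \<sigma>) x = 0"
    by (simp only: scaleR_2 eq_neg_iff_add_eq_0)
  then show ?thesis by simp
qed

lemmas crd_simps = crd_basic abr_add crd_vbr_linear crd_scale crd_vbr_scale crd_abr_vzero crd_vbr_self

lemma crd_vbr_leibniz:
  assumes "\<zeta> \<in> asec B" "\<eta> \<in> vsec B" "\<sigma> \<in> vsec B" "f \<in> Cinf B"
  shows "crd B (vbr B \<eta> (sscale B f \<sigma>)) x = f x *\<^sub>R crd B (vbr B \<eta> \<sigma>) x + rho \<eta> f x *\<^sub>R crd B \<sigma> x"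
proof -
  have "crd B (abr B (strans B \<zeta> \<eta>) (sscale B f \<sigma>)) x =
      crd B (abr B \<zeta> (sscale B f \<sigma>)) x + crd B (vbr B \<eta> (sscale B f \<sigma>)) x"
    using assms by (simp add: crd_abr_strans)
  moreover have "crd B (abr B (strans B \<zeta> \<eta>) (sscale B f \<sigma>)) x =
      f x *\<^sub>R (crd B (abr B \<zeta> \<sigma>) x + crd B (vbr B \<eta> \<sigma>) x)
      + (anchor_act B \<zeta> f x + rho \<eta> f x) *\<^sub>R crd B \<sigma> x"
    using assms by (simp add: abr_leibniz crd_basic crd_abr_strans anchor_act_strans)
  moreover have "crd B (abr B \<zeta> (sscale B f \<sigma>)) x =
      f x *\<^sub>R crd B (abr B \<zeta> \<sigma>) x + anchor_act B \<zeta> f x *\<^sub>R crd B \<sigma> x"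
    using assms by (simp add: abr_leibniz crd_basic)
  ultimately show ?thesis by (simp add: algebra_simps)
qed

text \<open>Evaluating the Jacobi identity on \<open>\<zeta>\<close>, \<open>\<eta>\<close> and \<open>f \<sigma>\<close>, every term but one cancels by the Leibniz rule,
  and what remains is the defect of the anchor times \<open>\<sigma>\<close>.  A section that does not vanish
  at the given point exists unless the bundle has rank \<open>0\<close>, in which case all brackets vanish.\<close>

lemma anchor_morphism:
  assumes J: "jacobi_mixed B" and \<zeta>: "\<zeta> \<in> asec B" and \<eta>: "\<eta> \<in> vsec B" and f: "f \<in> Cinf B"
  shows "anchor_act B \<zeta> (rho \<eta> f) x - rho \<eta> (anchor_act B \<zeta> f) x = rho (abr B \<zeta> \<eta>) f x"
proof (cases "\<exists>w :: 'f. w \<noteq> 0")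
  case True
  then obtain \<sigma> where \<sigma>: "\<sigma> \<in> vsec B" "crd B \<sigma> x \<noteq> 0"
    using vsec_nonzero_at[OF vec smooth_mfd] by metis
  have jac: "crd B (abr B \<zeta> (vbr B \<eta> \<tau>)) x = crd B (vbr B (abr B \<zeta> \<eta>) \<tau>) x + crd B (vbr B \<eta> (abr B \<zeta> \<tau>)) x"
    if "\<tau> \<in> vsec B" for \<tau>
    using J \<zeta> \<eta> that unfolding jacobi_mixed_def by (simp add: crd_basic)
  have vl: "vbr B \<eta> (sscale B f \<sigma>) = sadd B (sscale B f (vbr B \<eta> \<sigma>)) (sscale B (rho \<eta> f) \<sigma>)"
    by (rule eqI) (use \<zeta> \<eta> f \<sigma> in \<open>simp_all add: crd_basic crd_vbr_leibniz[OF \<zeta>]\<close>)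
  have r: "rho \<eta> f \<in> Cinf B" using \<zeta> \<eta> f by simp
  have "(anchor_act B \<zeta> (rho \<eta> f) x - rho \<eta> (anchor_act B \<zeta> f) x - rho (abr B \<zeta> \<eta>) f x) *\<^sub>R crd B \<sigma> x = 0"
    using jac[of "sscale B f \<sigma>"] jac[OF \<sigma>(1)] \<zeta> \<eta> f \<sigma>(1) r
    by (simp add: vl abr_leibniz abr_add crd_basic crd_vbr_leibniz[OF \<zeta>] crd_vbr_linear algebra_simps)
  then show ?thesis using \<sigma>(2) by simp
next
  case False
  have zero: "\<sigma> = vzero B" if "\<sigma> \<in> vsec B" for \<sigma>
  proof (rule eqI[OF that])
    show "crd B \<sigma> x = crd B (vzero B) x" for x using False by metis
  qed simp
  have "rho (vzero B) g = (\<lambda>y. 0)" if "g \<in> Cinf B" for g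
    using rho_sscale[OF that, of "\<lambda>_. 0" "vzero B"] vzero_scale by (simp add: fun_eq_iff)
  then show ?thesis
    using zero[OF \<eta>] zero[OF abr_closed[OF \<zeta> \<eta>]] \<zeta> f by (simp add: anchor_act_const)
qed

end

locale affine_origin = leibniz_bracket B
  for B :: "('m::{t2_space,second_countable_topology}, 'a::euclidean_space, 'v, 'f::real_inner, 'e, 'z) leib_bundle_scheme" +
  fixes \<zeta>\<^sub>0 :: "'m \<Rightarrow> 'e"
  assumes origin: "\<zeta>\<^sub>0 \<in> asec B"
begin

text \<open>The pair \<open>(a, \<sigma>)\<close> stands for the formal combination \<open>a \<zeta>\<^sub>0 + \<sigma>\<close>.  The bracket and the action
  below are the linear extensions of those of affine and vector sections, which sit in the hull as
  the pairs with first component \<open>1\<close> and \<open>0\<close>.\<close>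

definition ahull :: "(real \<times> ('m \<Rightarrow> 'v)) set" where
  "ahull = UNIV \<times> vsec B"

fun hadd :: "real \<times> ('m \<Rightarrow> 'v) \<Rightarrow> real \<times> ('m \<Rightarrow> 'v) \<Rightarrow> real \<times> ('m \<Rightarrow> 'v)" where
  "hadd (a, \<sigma>) (b, \<eta>) = (a + b, sadd B \<sigma> \<eta>)"

fun hbr :: "real \<times> ('m \<Rightarrow> 'v) \<Rightarrow> real \<times> ('m \<Rightarrow> 'v) \<Rightarrow> real \<times> ('m \<Rightarrow> 'v)" where
  "hbr (a, \<sigma>) (b, \<eta>) =
    (0, sadd B (sadd B (sscale B (\<lambda>_. a) (abr B \<zeta>\<^sub>0 \<eta>)) (sneg B (sscale B (\<lambda>_. b) (abr B \<zeta>\<^sub>0 \<sigma>))))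
          (vbr B \<sigma> \<eta>))"

fun hact :: "real \<times> ('m \<Rightarrow> 'v) \<Rightarrow> ('m \<Rightarrow> real) \<Rightarrow> 'm \<Rightarrow> real" where
  "hact (a, \<sigma>) f = (\<lambda>x. a * anchor_act B \<zeta>\<^sub>0 f x + rho \<sigma> f x)"

definition homog :: "('m \<Rightarrow> 'e) \<Rightarrow> real \<times> ('m \<Rightarrow> 'v)" where
  "homog \<zeta> = (1, sdiff B \<zeta> \<zeta>\<^sub>0)"

lemma hull_iff [simp]: "(a, \<sigma>) \<in> ahull \<longleftrightarrow> \<sigma> \<in> vsec B"
  by (simp add: ahull_def)

sublocale bracket_action ahull hadd "(0, vzero B)" hbr hact "Cinf B"
proof
  fix X Y assume "X \<in> ahull" "Y \<in> ahull"
  then obtain a \<sigma> b \<eta> where X: "X = (a, \<sigma>)" "\<sigma> \<in> vsec B" and Y: "Y = (b, \<eta>)" "\<eta> \<in> vsec B"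
    by (cases X; cases Y) auto
  show "hadd X Y \<in> ahull" "hbr X Y \<in> ahull" using X Y origin by simp_all
  have "sadd B (snd (hbr X Y)) (snd (hbr Y X)) = vzero B"
    by (rule eqI) (use X Y origin crd_vbr_skew[OF X(2) Y(2)] in \<open>simp_all add: crd_simps\<close>)
  then show "hadd (hbr X Y) (hbr Y X) = (0, vzero B)" using X Y by simp
  fix Z assume "Z \<in> ahull"
  then obtain c \<xi> where Z: "Z = (c, \<xi>)" "\<xi> \<in> vsec B" by (cases Z) auto
  have "snd (hbr (hadd X Y) Z) = sadd B (snd (hbr X Z)) (snd (hbr Y Z))"
    by (rule eqI) (use X Y Z origin in \<open>simp_all add: crd_simps algebra_simps\<close>)
  then show "hbr (hadd X Y) Z = hadd (hbr X Z) (hbr Y Z)" using X Y Z by simp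
next
  have "sadd B (vzero B) (vzero B) = vzero B" by (rule eqI) (simp_all add: crd_simps)
  then show "hadd (0, vzero B) (0, vzero B) = (0, vzero B)" by simp
next
  fix X f assume "X \<in> ahull" and f: "f \<in> Cinf B"
  then obtain a \<sigma> where X: "X = (a, \<sigma>)" "\<sigma> \<in> vsec B" by (cases X) auto
  show "hact X f \<in> Cinf B" using X f origin by simp
  fix g assume g: "g \<in> Cinf B"
  show "hact X (\<lambda>p. f p + g p) = (\<lambda>p. hact X f p + hact X g p)"
    using X anchor_act_linear[OF f g] by (simp add: fun_eq_iff algebra_simps)
next
  fix X Y f assume "X \<in> ahull" "Y \<in> ahull" and f: "f \<in> Cinf B"
  then obtain a \<sigma> b \<eta> where "X = (a, \<sigma>)" "\<sigma> \<in> vsec B" "Y = (b, \<eta>)" "\<eta> \<in> vsec B"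
    by (cases X; cases Y) auto
  then show "hact (hadd X Y) f = (\<lambda>p. hact X f p + hact Y f p)"
    using rho_sadd f by (simp add: fun_eq_iff algebra_simps)
qed simp_all

lemma fst_hadd [simp]: "fst (hadd X Y) = fst X + fst Y"
  by (cases X; cases Y) simp

lemma fst_hbr [simp]: "fst (hbr X Y) = 0"
  by (cases X; cases Y) simp

lemma homog_hull [simp]: "\<zeta> \<in> asec B \<Longrightarrow> homog \<zeta> \<in> ahull"
  by (simp add: homog_def origin)

lemma hact_homog:
  assumes "\<zeta> \<in> asec B" "f \<in> Cinf B"
  shows "hact (homog \<zeta>) f = anchor_act B \<zeta> f"
proof
  fix x
  have "hact (homog \<zeta>) f x = anchor_act B (strans B \<zeta>\<^sub>0 (sdiff B \<zeta> \<zeta>\<^sub>0)) f x"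
    using assms origin by (simp add: homog_def anchor_act_strans)
  then show "hact (homog \<zeta>) f x = anchor_act B \<zeta> f x"
    using strans_sdiff[OF affine origin assms(1)] by simp
qed

lemma sdiff_strans:
  assumes "\<zeta> \<in> asec B" "\<sigma> \<in> vsec B" "\<zeta>' \<in> asec B"
  shows "sdiff B (strans B \<zeta> \<sigma>) \<zeta>' = sadd B (sdiff B \<zeta> \<zeta>') \<sigma>"
proof
  fix x
  obtain \<psi> :: "'e \<Rightarrow> 'f" and \<phi> :: "'v \<Rightarrow> 'f" where c:
    "\<And>\<zeta>\<^sub>1 \<zeta>\<^sub>2. \<zeta>\<^sub>1 \<in> asec B \<Longrightarrow> \<zeta>\<^sub>2 \<in> asec B \<Longrightarrow> \<phi> (sdiff B \<zeta>\<^sub>2 \<zeta>\<^sub>1 x) = \<psi> (\<zeta>\<^sub>2 x) - \<psi> (\<zeta>\<^sub>1 x)"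
    "\<And>\<zeta> \<sigma>. \<zeta> \<in> asec B \<Longrightarrow> \<sigma> \<in> vsec B \<Longrightarrow> \<psi> (strans B \<zeta> \<sigma> x) = \<psi> (\<zeta> x) + \<phi> (\<sigma> x)"
    "\<And>\<sigma> \<eta>. \<sigma> \<in> vsec B \<Longrightarrow> \<eta> \<in> vsec B \<Longrightarrow> \<phi> (sadd B \<sigma> \<eta> x) = \<phi> (\<sigma> x) + \<phi> (\<eta> x)"
    "\<And>\<sigma>. \<sigma> \<in> vsec B \<Longrightarrow> \<phi> (sneg B \<sigma> x) = - \<phi> (\<sigma> x)"
    and inj: "\<And>\<sigma> \<eta>. \<sigma> \<in> vsec B \<Longrightarrow> \<eta> \<in> vsec B \<Longrightarrow> \<phi> (\<sigma> x) = \<phi> (\<eta> x) \<Longrightarrow> \<sigma> x = \<eta> x"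
    by (rule abundle_coordinate[OF affine, where x = x]) (rule that)
  show "sdiff B (strans B \<zeta> \<sigma>) \<zeta>' x = sadd B (sdiff B \<zeta> \<zeta>') \<sigma> x"
    by (rule inj) (use assms c in simp_all)
qed

lemma sdiff_origin:
  assumes "\<zeta>\<^sub>1 \<in> asec B" "\<zeta>\<^sub>2 \<in> asec B"
  shows "sdiff B \<zeta>\<^sub>2 \<zeta>\<^sub>1 = sadd B (sdiff B \<zeta>\<^sub>2 \<zeta>\<^sub>0) (sneg B (sdiff B \<zeta>\<^sub>1 \<zeta>\<^sub>0))"
proof
  fix x
  obtain \<psi> :: "'e \<Rightarrow> 'f" and \<phi> :: "'v \<Rightarrow> 'f" where c:
    "\<And>\<zeta>\<^sub>1 \<zeta>\<^sub>2. \<zeta>\<^sub>1 \<in> asec B \<Longrightarrow> \<zeta>\<^sub>2 \<in> asec B \<Longrightarrow> \<phi> (sdiff B \<zeta>\<^sub>2 \<zeta>\<^sub>1 x) = \<psi> (\<zeta>\<^sub>2 x) - \<psi> (\<zeta>\<^sub>1 x)"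
    "\<And>\<zeta> \<sigma>. \<zeta> \<in> asec B \<Longrightarrow> \<sigma> \<in> vsec B \<Longrightarrow> \<psi> (strans B \<zeta> \<sigma> x) = \<psi> (\<zeta> x) + \<phi> (\<sigma> x)"
    "\<And>\<sigma> \<eta>. \<sigma> \<in> vsec B \<Longrightarrow> \<eta> \<in> vsec B \<Longrightarrow> \<phi> (sadd B \<sigma> \<eta> x) = \<phi> (\<sigma> x) + \<phi> (\<eta> x)"
    "\<And>\<sigma>. \<sigma> \<in> vsec B \<Longrightarrow> \<phi> (sneg B \<sigma> x) = - \<phi> (\<sigma> x)"
    and inj: "\<And>\<sigma> \<eta>. \<sigma> \<in> vsec B \<Longrightarrow> \<eta> \<in> vsec B \<Longrightarrow> \<phi> (\<sigma> x) = \<phi> (\<eta> x) \<Longrightarrow> \<sigma> x = \<eta> x"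
    by (rule abundle_coordinate[OF affine, where x = x]) (rule that)
  show "sdiff B \<zeta>\<^sub>2 \<zeta>\<^sub>1 x = sadd B (sdiff B \<zeta>\<^sub>2 \<zeta>\<^sub>0) (sneg B (sdiff B \<zeta>\<^sub>1 \<zeta>\<^sub>0)) x"
    by (rule inj) (use assms origin c in simp_all)
qed

lemma homog_strans:
  "\<zeta> \<in> asec B \<Longrightarrow> \<sigma> \<in> vsec B \<Longrightarrow> homog (strans B \<zeta> \<sigma>) = hadd (homog \<zeta>) (0, \<sigma>)"
  by (simp add: homog_def sdiff_strans origin)

lemma aabr_closed [simp]: "\<zeta>\<^sub>1 \<in> asec B \<Longrightarrow> \<zeta>\<^sub>2 \<in> asec B \<Longrightarrow> aabr B \<zeta>\<^sub>1 \<zeta>\<^sub>2 \<in> vsec B"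
  by (simp add: aabr_def)

lemma vabr_closed [simp]: "\<sigma> \<in> vsec B \<Longrightarrow> \<zeta> \<in> asec B \<Longrightarrow> vabr B \<sigma> \<zeta> \<in> vsec B"
  by (simp add: vabr_def)

lemma crd_abr_origin:
  assumes "\<zeta> \<in> asec B" "\<sigma> \<in> vsec B"
  shows "crd B (abr B \<zeta> \<sigma>) x = crd B (abr B \<zeta>\<^sub>0 \<sigma>) x + crd B (vbr B (sdiff B \<zeta> \<zeta>\<^sub>0) \<sigma>) x"
  using crd_abr_strans[OF origin sdiff_vsec[OF affine smooth_mfd origin assms(1)] assms(2), of x]
  by (simp add: strans_sdiff[OF affine origin assms(1)] assms)

lemma hbr_homog:
  assumes "\<zeta>\<^sub>1 \<in> asec B" "\<zeta>\<^sub>2 \<in> asec B"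
  shows "hbr (homog \<zeta>\<^sub>1) (homog \<zeta>\<^sub>2) = (0, aabr B \<zeta>\<^sub>1 \<zeta>\<^sub>2)"
proof -
  have "snd (hbr (homog \<zeta>\<^sub>1) (homog \<zeta>\<^sub>2)) = aabr B \<zeta>\<^sub>1 \<zeta>\<^sub>2"
  proof (rule eqI)
    show "crd B (snd (hbr (homog \<zeta>\<^sub>1) (homog \<zeta>\<^sub>2))) x = crd B (aabr B \<zeta>\<^sub>1 \<zeta>\<^sub>2) x" for x
      using assms origin
      by (simp add: homog_def aabr_def sdiff_origin[OF assms] crd_abr_origin[OF assms(1)] crd_simps)
  qed (use assms origin in \<open>simp_all add: homog_def\<close>)
  then show ?thesis by (simp add: prod_eq_iff)
qed

lemma hbr_vector_homog:
  assumes "\<zeta> \<in> asec B" "\<sigma> \<in> vsec B"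
  shows "hbr (0, \<sigma>) (homog \<zeta>) = (0, vabr B \<sigma> \<zeta>)" "hbr (homog \<zeta>) (0, \<sigma>) = (0, abr B \<zeta> \<sigma>)"
proof -
  have "snd (hbr (0, \<sigma>) (homog \<zeta>)) = vabr B \<sigma> \<zeta>"
  proof (rule eqI)
    show "crd B (snd (hbr (0, \<sigma>) (homog \<zeta>))) x = crd B (vabr B \<sigma> \<zeta>) x" for x
      using assms origin crd_vbr_skew[of \<sigma> "sdiff B \<zeta> \<zeta>\<^sub>0" x]
      by (simp add: homog_def vabr_def crd_abr_origin[OF assms(1)] crd_simps)
  qed (use assms origin in \<open>simp_all add: homog_def\<close>)
  then show "hbr (0, \<sigma>) (homog \<zeta>) = (0, vabr B \<sigma> \<zeta>)" by (simp add: prod_eq_iff)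
  have "snd (hbr (homog \<zeta>) (0, \<sigma>)) = abr B \<zeta> \<sigma>"
  proof (rule eqI)
    show "crd B (snd (hbr (homog \<zeta>) (0, \<sigma>))) x = crd B (abr B \<zeta> \<sigma>) x" for x
      using assms origin by (simp add: homog_def crd_abr_origin[OF assms(1)] crd_simps)
  qed (use assms origin in \<open>simp_all add: homog_def\<close>)
  then show "hbr (homog \<zeta>) (0, \<sigma>) = (0, abr B \<zeta> \<sigma>)" by (simp add: prod_eq_iff)
qed

text \<open>By trilinearity the identity reduces to the mixed one at \<open>\<zeta>\<^sub>0\<close> and to the Jacobi identity for three
  vector sections, which is the difference of the mixed identities at \<open>\<zeta>\<^sub>0 + \<sigma>\<close> and at \<open>\<zeta>\<^sub>0\<close>.\<close>

lemma hull_jacobi: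
  assumes J: "jacobi_mixed B" and "X \<in> ahull" "Y \<in> ahull" "Z \<in> ahull"
  shows "hbr X (hbr Y Z) = hadd (hbr (hbr X Y) Z) (hbr Y (hbr X Z))"
proof -
  obtain a \<sigma> b \<eta> c \<xi> where X: "X = (a, \<sigma>)" "\<sigma> \<in> vsec B" and Y: "Y = (b, \<eta>)" "\<eta> \<in> vsec B"
    and Z: "Z = (c, \<xi>)" "\<xi> \<in> vsec B"
    using assms(2-4) by (cases X; cases Y; cases Z) auto
  have mixed: "crd B (abr B \<zeta> (vbr B \<sigma> \<eta>)) x = crd B (vbr B (abr B \<zeta> \<sigma>) \<eta>) x + crd B (vbr B \<sigma> (abr B \<zeta> \<eta>)) x"
    if "\<zeta> \<in> asec B" "\<sigma> \<in> vsec B" "\<eta> \<in> vsec B" for \<zeta> \<sigma> \<eta> x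
    using J that unfolding jacobi_mixed_def by (simp add: crd_basic)
  have vector: "crd B (vbr B \<sigma> (vbr B \<eta> \<xi>)) x =
      crd B (vbr B (vbr B \<sigma> \<eta>) \<xi>) x + crd B (vbr B \<eta> (vbr B \<sigma> \<xi>)) x" for x
  proof -
    have "crd B (abr B (strans B \<zeta>\<^sub>0 \<sigma>) (vbr B \<eta> \<xi>)) x =
        crd B (abr B \<zeta>\<^sub>0 (vbr B \<eta> \<xi>)) x + crd B (vbr B \<sigma> (vbr B \<eta> \<xi>)) x"
      using X Y Z origin by (simp add: crd_abr_strans)
    moreover have "crd B (abr B (strans B \<zeta>\<^sub>0 \<sigma>) (vbr B \<eta> \<xi>)) x =
        crd B (vbr B (abr B \<zeta>\<^sub>0 \<eta>) \<xi>) x + crd B (vbr B (vbr B \<sigma> \<eta>) \<xi>) x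
        + (crd B (vbr B \<eta> (abr B \<zeta>\<^sub>0 \<xi>)) x + crd B (vbr B \<eta> (vbr B \<sigma> \<xi>)) x)"
      using X Y Z origin
      by (subst mixed) (simp_all add: abr_strans crd_basic crd_vbr_linear)
    ultimately show ?thesis
      using mixed[OF origin Y(2) Z(2), of x] by (simp add: algebra_simps)
  qed
  have skew: "crd B (vbr B \<eta> (abr B \<zeta>\<^sub>0 \<sigma>)) x = - crd B (vbr B (abr B \<zeta>\<^sub>0 \<sigma>) \<eta>) x" for x
    using X Y origin by (intro crd_vbr_skew) simp_all
  have "snd (hbr X (hbr Y Z)) = snd (hadd (hbr (hbr X Y) Z) (hbr Y (hbr X Z)))"
  proof (rule eqI)
    show "crd B (snd (hbr X (hbr Y Z))) x = crd B (snd (hadd (hbr (hbr X Y) Z) (hbr Y (hbr X Z)))) x" for x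
      using X Y Z origin
      by (simp add: crd_simps mixed vector skew algebra_simps)
  qed (use X Y Z origin in simp_all)
  then show ?thesis by (rule prod_eqI[rotated]) simp
qed

text \<open>As for the Jacobi identity, the case of two vector sections is the difference of two instances of
  the mixed case.\<close>

lemma hull_rep:
  assumes J: "jacobi_mixed B" and "X \<in> ahull" "Y \<in> ahull" and f: "f \<in> Cinf B"
  shows "hact X (hact Y f) x - hact Y (hact X f) x = hact (hbr X Y) f x"
proof -
  obtain a \<sigma> b \<eta> where X: "X = (a, \<sigma>)" "\<sigma> \<in> vsec B" and Y: "Y = (b, \<eta>)" "\<eta> \<in> vsec B"
    using assms(2,3) by (cases X; cases Y) auto
  have lr: "anchor_act B \<zeta>\<^sub>0 (rho \<tau> f) x - rho \<tau> (anchor_act B \<zeta>\<^sub>0 f) x = rho (abr B \<zeta>\<^sub>0 \<tau>) f x"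
    if "\<tau> \<in> vsec B" for \<tau>
    by (rule anchor_morphism[OF J origin that f])
  have sum: "anchor_act B (strans B \<zeta>\<^sub>0 \<sigma>) f = (\<lambda>x. anchor_act B \<zeta>\<^sub>0 f x + rho \<sigma> f x)"
    using anchor_act_strans[OF origin X(2) f] by (simp add: fun_eq_iff)
  have vector: "rho \<sigma> (rho \<eta> f) x = rho \<eta> (rho \<sigma> f) x + rho (vbr B \<sigma> \<eta>) f x"
    using anchor_morphism[OF J _ Y(2) f, of "strans B \<zeta>\<^sub>0 \<sigma>" x] lr[OF Y(2)] X Y origin f
    by (simp add: sum anchor_act_strans anchor_act_linear abr_strans rho_sadd)
  have affine: "anchor_act B \<zeta>\<^sub>0 (rho \<tau> f) x = rho \<tau> (anchor_act B \<zeta>\<^sub>0 f) x + rho (abr B \<zeta>\<^sub>0 \<tau>) f x"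
    if "\<tau> \<in> vsec B" for \<tau>
    using lr[OF that] by simp
  have act: "hact (s, \<tau>) (hact (t, \<upsilon>) f) x = s * (t * anchor_act B \<zeta>\<^sub>0 (anchor_act B \<zeta>\<^sub>0 f) x)
      + s * anchor_act B \<zeta>\<^sub>0 (rho \<upsilon> f) x + t * rho \<tau> (anchor_act B \<zeta>\<^sub>0 f) x + rho \<tau> (rho \<upsilon> f) x"
    if "\<tau> \<in> vsec B" "\<upsilon> \<in> vsec B" for s t \<tau> \<upsilon>
    using that origin f anchor_act_linear(1,3)[of "\<lambda>x. t * anchor_act B \<zeta>\<^sub>0 f x" "rho \<upsilon> f"]
      anchor_act_linear(2,4)[of "anchor_act B \<zeta>\<^sub>0 f" "anchor_act B \<zeta>\<^sub>0 f"]
    by (simp add: algebra_simps)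
  have br: "hact (hbr X Y) f x = a * rho (abr B \<zeta>\<^sub>0 \<eta>) f x - b * rho (abr B \<zeta>\<^sub>0 \<sigma>) f x + rho (vbr B \<sigma> \<eta>) f x"
    using X Y origin f by (simp add: rho_sadd rho_sscale rho_sneg)
  show ?thesis
    unfolding br unfolding X(1) Y(1) act[OF X(2) Y(2)] act[OF Y(2) X(2)] vector affine[OF X(2)] affine[OF Y(2)]
    by (simp only: distrib_left) (simp add: mult.left_commute)
qed

end

section \<open>Forms as cochains on the hull\<close>

lemma vform_closed: "vform B k \<omega> \<Longrightarrow> \<sigma>s \<in> tuples k (vsec B) \<Longrightarrow> \<omega> \<sigma>s \<in> Cinf B"
  unfolding vform_def by blast

lemma vform_add:
  assumes "vform B k \<omega>" "length us + Suc (length vs) = k" "set us \<subseteq> vsec B" "set vs \<subseteq> vsec B"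
    and "\<sigma> \<in> vsec B" "\<eta> \<in> vsec B"
  shows "\<omega> (us @ sadd B \<sigma> \<eta> # vs) x = \<omega> (us @ \<sigma> # vs) x + \<omega> (us @ \<eta> # vs) x"
proof -
  have "\<forall>\<sigma>s\<in>tuples k (vsec B). \<forall>i<k. \<forall>\<sigma>\<in>vsec B. \<forall>\<eta>\<in>vsec B. \<forall>x.
        \<omega> (\<sigma>s[i := sadd B \<sigma> \<eta>]) x = \<omega> (\<sigma>s[i := \<sigma>]) x + \<omega> (\<sigma>s[i := \<eta>]) x"
    using assms(1) unfolding vform_def by (elim conjE)
  moreover have "us @ \<sigma> # vs \<in> tuples k (vsec B)" "length us < k"
    using assms by (auto simp: tuples_def)
  ultimately have "\<omega> ((us @ \<sigma> # vs)[length us := sadd B \<sigma> \<eta>]) x =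
      \<omega> ((us @ \<sigma> # vs)[length us := \<sigma>]) x + \<omega> ((us @ \<sigma> # vs)[length us := \<eta>]) x"
    using assms(5,6) by blast
  then show ?thesis by simp
qed

lemma vform_swap:
  assumes "vform B k \<omega>" "length us + Suc (Suc (length vs)) = k" "set us \<subseteq> vsec B" "set vs \<subseteq> vsec B"
    and "\<sigma> \<in> vsec B" "\<eta> \<in> vsec B"
  shows "\<omega> (us @ \<sigma> # \<eta> # vs) x = - \<omega> (us @ \<eta> # \<sigma> # vs) x"
proof -
  have "\<forall>\<sigma>s\<in>tuples k (vsec B). \<forall>i<k. \<forall>j<k. i \<noteq> j \<longrightarrow>
        (\<forall>x. \<omega> (\<sigma>s[i := \<sigma>s ! j, j := \<sigma>s ! i]) x = - \<omega> \<sigma>s x)"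
    using assms(1) unfolding vform_def by (elim conjE)
  moreover have "us @ \<eta> # \<sigma> # vs \<in> tuples k (vsec B)" "length us < k" "Suc (length us) < k"
    "length us \<noteq> Suc (length us)"
    using assms by (auto simp: tuples_def)
  ultimately have "\<omega> ((us @ \<eta> # \<sigma> # vs)[length us := (us @ \<eta> # \<sigma> # vs) ! Suc (length us),
      Suc (length us) := (us @ \<eta> # \<sigma> # vs) ! length us]) x = - \<omega> (us @ \<eta> # \<sigma> # vs) x"
    by blast
  then show ?thesis by (simp add: nth_append list_update_append)
qed

lemma vform_contract:
  assumes "vform B (Suc k) \<omega>" "\<sigma> \<in> vsec B"
  shows "vform B k (\<lambda>\<sigma>s. \<omega> (\<sigma> # \<sigma>s))"
proof -
  note v = assms(1)[unfolded vform_def]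
  have 1: "\<forall>\<sigma>s\<in>tuples (Suc k) (vsec B). \<omega> \<sigma>s \<in> Cinf B" using v by (elim conjE)
  have 2: "\<forall>\<sigma>s\<in>tuples (Suc k) (vsec B). \<forall>i<Suc k. \<forall>j<Suc k. i \<noteq> j \<longrightarrow>
        (\<forall>x. \<omega> (\<sigma>s[i := \<sigma>s ! j, j := \<sigma>s ! i]) x = - \<omega> \<sigma>s x)" using v by (elim conjE)
  have 3: "\<forall>\<sigma>s\<in>tuples (Suc k) (vsec B). \<forall>i<Suc k. \<forall>\<sigma>\<in>vsec B. \<forall>\<eta>\<in>vsec B. \<forall>x.
        \<omega> (\<sigma>s[i := sadd B \<sigma> \<eta>]) x = \<omega> (\<sigma>s[i := \<sigma>]) x + \<omega> (\<sigma>s[i := \<eta>]) x" using v by (elim conjE)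
  have 4: "\<forall>\<sigma>s\<in>tuples (Suc k) (vsec B). \<forall>i<Suc k. \<forall>\<sigma>\<in>vsec B. \<forall>f\<in>Cinf B. \<forall>x.
        \<omega> (\<sigma>s[i := sscale B f \<sigma>]) x = f x * \<omega> (\<sigma>s[i := \<sigma>]) x" using v by (elim conjE)
  have mem: "\<sigma> # \<sigma>s \<in> tuples (Suc k) (vsec B)" if "\<sigma>s \<in> tuples k (vsec B)" for \<sigma>s
    using that assms(2) by (simp add: tuples_def)
  show ?thesis
    unfolding vform_def
  proof (intro conjI ballI allI impI)
    fix \<sigma>s assume s: "\<sigma>s \<in> tuples k (vsec B)"
    show "\<omega> (\<sigma> # \<sigma>s) \<in> Cinf B" using 1 mem[OF s] by blast
    fix i x assume i: "i < k"
    then have i': "Suc i < Suc k" by simp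
    {
      fix j assume "j < k" "i \<noteq> j"
      then have j: "Suc j < Suc k" "Suc i \<noteq> Suc j" by simp_all
      have "\<omega> ((\<sigma> # \<sigma>s)[Suc i := (\<sigma> # \<sigma>s) ! Suc j, Suc j := (\<sigma> # \<sigma>s) ! Suc i]) x = - \<omega> (\<sigma> # \<sigma>s) x"
        using 2 mem[OF s] i' j by blast
      then show "\<omega> (\<sigma> # \<sigma>s[i := \<sigma>s ! j, j := \<sigma>s ! i]) x = - \<omega> (\<sigma> # \<sigma>s) x" by simp
    next
      fix \<tau> \<eta> assume "\<tau> \<in> vsec B" "\<eta> \<in> vsec B"
      then have "\<omega> ((\<sigma> # \<sigma>s)[Suc i := sadd B \<tau> \<eta>]) x =
          \<omega> ((\<sigma> # \<sigma>s)[Suc i := \<tau>]) x + \<omega> ((\<sigma> # \<sigma>s)[Suc i := \<eta>]) x"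
        using 3 mem[OF s] i' by blast
      then show "\<omega> (\<sigma> # \<sigma>s[i := sadd B \<tau> \<eta>]) x = \<omega> (\<sigma> # \<sigma>s[i := \<tau>]) x + \<omega> (\<sigma> # \<sigma>s[i := \<eta>]) x"
        by simp
    next
      fix \<tau> f assume "\<tau> \<in> vsec B" "f \<in> Cinf B"
      then have "\<omega> ((\<sigma> # \<sigma>s)[Suc i := sscale B f \<tau>]) x = f x * \<omega> ((\<sigma> # \<sigma>s)[Suc i := \<tau>]) x"
        using 4 mem[OF s] i' by blast
      then show "\<omega> (\<sigma> # \<sigma>s[i := sscale B f \<tau>]) x = f x * \<omega> (\<sigma> # \<sigma>s[i := \<tau>]) x" by simp
    }
  qed
qed

text \<open>The wedge product of the functional \<open>(a, \<sigma>) \<mapsto> a\<close> with \<open>\<alpha>\<close>, which ignores first components; the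
  recursion expands it along the first argument.\<close>

primrec coeff_wedge :: "(('m \<Rightarrow> 'v) list \<Rightarrow> 'm \<Rightarrow> real) \<Rightarrow> (real \<times> ('m \<Rightarrow> 'v)) list \<Rightarrow> 'm \<Rightarrow> real" where
  "coeff_wedge \<alpha> [] = (\<lambda>x. 0)"
| "coeff_wedge \<alpha> (X # Xs) =
    (\<lambda>x. fst X * \<alpha> (map snd Xs) x - coeff_wedge (\<lambda>\<sigma>s. \<alpha> (snd X # \<sigma>s)) Xs x)"

lemma coeff_wedge_explicit:
  "coeff_wedge \<alpha> (map (Pair 1) \<sigma>s) x = (\<Sum>i<length \<sigma>s. (- 1) ^ i * \<alpha> (omit i \<sigma>s) x)"
proof (induction \<sigma>s arbitrary: \<alpha>)
  case (Cons \<sigma> \<sigma>s)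
  show ?case
    by (simp add: Cons sum.lessThan_Suc_shift sum_negf o_def del: sum.lessThan_Suc)
qed simp

context affine_origin
begin

lemma snd_vsec: "Xs \<in> lists ahull \<Longrightarrow> set (map snd Xs) \<subseteq> vsec B"
  by (induction Xs) (auto simp: ahull_def)

lemma coeff_wedge_closed:
  assumes "vform B k \<alpha>" "Xs \<in> lists ahull" "length Xs = Suc k"
  shows "coeff_wedge \<alpha> Xs \<in> Cinf B"
  using assms
proof (induction Xs arbitrary: \<alpha> k)
  case (Cons X Xs)
  have "\<alpha> (map snd Xs) \<in> Cinf B"
    by (rule vform_closed[OF Cons.prems(1)]) (use Cons.prems snd_vsec[of Xs] in \<open>auto simp: tuples_def\<close>)
  moreover have "coeff_wedge (\<lambda>\<sigma>s. \<alpha> (snd X # \<sigma>s)) Xs \<in> Cinf B"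
  proof (cases k)
    case 0
    then show ?thesis using Cons.prems by simp
  next
    case (Suc l)
    then show ?thesis
      using Cons.prems vform_contract by (intro Cons.IH[of l]) (auto simp: ahull_def)
  qed
  ultimately show ?case by simp
qed simp

text \<open>The length in the hypothesis is that of the lists on which \<open>\<alpha>\<close> is evaluated: the coefficient
  functional takes up one argument.\<close>

lemma coeff_wedge_linear:
  assumes "\<And>\<sigma>s. \<sigma>s \<in> tuples (length Xs - 1) (vsec B) \<Longrightarrow> \<alpha> \<sigma>s x = p * \<beta> \<sigma>s x + q * \<gamma> \<sigma>s x"
    and "Xs \<in> lists ahull"
  shows "coeff_wedge \<alpha> Xs x = p * coeff_wedge \<beta> Xs x + q * coeff_wedge \<gamma> Xs x"
  using assms
proof (induction Xs arbitrary: \<alpha> \<beta> \<gamma>)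
  case (Cons X Xs)
  have "map snd Xs \<in> tuples (length Xs) (vsec B)"
    using Cons.prems(2) snd_vsec[of Xs] by (simp add: tuples_def)
  then have a: "\<alpha> (map snd Xs) x = p * \<beta> (map snd Xs) x + q * \<gamma> (map snd Xs) x"
    using Cons.prems(1) by simp
  have "coeff_wedge (\<lambda>\<sigma>s. \<alpha> (snd X # \<sigma>s)) Xs x =
      p * coeff_wedge (\<lambda>\<sigma>s. \<beta> (snd X # \<sigma>s)) Xs x + q * coeff_wedge (\<lambda>\<sigma>s. \<gamma> (snd X # \<sigma>s)) Xs x"
  proof (cases Xs)
    case (Cons Y Ys)
    show ?thesis
    proof (rule Cons.IH)
      show "\<alpha> (snd X # \<sigma>s) x = p * \<beta> (snd X # \<sigma>s) x + q * \<gamma> (snd X # \<sigma>s) x"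
        if "\<sigma>s \<in> tuples (length Xs - 1) (vsec B)" for \<sigma>s
        by (rule Cons.prems(1)) (use that Cons.prems(2) Cons in \<open>auto simp: tuples_def ahull_def\<close>)
    qed (use Cons.prems in auto)
  qed simp
  with a show ?case by (simp add: algebra_simps)
qed simp

lemma coeff_wedge_add:
  assumes "vform B k \<alpha>" "Us \<in> lists ahull" "X \<in> ahull" "Y \<in> ahull" "Vs \<in> lists ahull"
    and "length Us + length Vs = k"
  shows "coeff_wedge \<alpha> (Us @ hadd X Y # Vs) x = coeff_wedge \<alpha> (Us @ X # Vs) x + coeff_wedge \<alpha> (Us @ Y # Vs) x"
  using assms(1,2,6)
proof (induction Us arbitrary: \<alpha> k)
  case Nil
  have XY: "snd (hadd X Y) = sadd B (snd X) (snd Y)" "snd X \<in> vsec B" "snd Y \<in> vsec B"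
    using assms(3,4) by (cases X; cases Y; simp)+
  have "coeff_wedge (\<lambda>\<sigma>s. \<alpha> (sadd B (snd X) (snd Y) # \<sigma>s)) Vs x =
      1 * coeff_wedge (\<lambda>\<sigma>s. \<alpha> (snd X # \<sigma>s)) Vs x + 1 * coeff_wedge (\<lambda>\<sigma>s. \<alpha> (snd Y # \<sigma>s)) Vs x"
  proof (cases Vs)
    case (Cons V Vs')
    show ?thesis
    proof (rule coeff_wedge_linear[OF _ assms(5)])
      fix \<sigma>s assume "\<sigma>s \<in> tuples (length Vs - 1) (vsec B)"
      then show "\<alpha> (sadd B (snd X) (snd Y) # \<sigma>s) x = 1 * \<alpha> (snd X # \<sigma>s) x + 1 * \<alpha> (snd Y # \<sigma>s) x"
        using vform_add[OF Nil(1), of "[]" \<sigma>s "snd X" "snd Y" x] Nil(3) Cons XY by (simp add: tuples_def)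
    qed
  qed simp
  then show ?case using XY by (simp add: algebra_simps)
next
  case (Cons U Us)
  then obtain l where l: "k = Suc l" by (cases k) auto
  have "\<alpha> (map snd Us @ sadd B (snd X) (snd Y) # map snd Vs) x =
      \<alpha> (map snd Us @ snd X # map snd Vs) x + \<alpha> (map snd Us @ snd Y # map snd Vs) x"
    by (rule vform_add[OF Cons.prems(1)])
      (use Cons.prems assms(3-5) snd_vsec[of Us] snd_vsec[of Vs] in \<open>auto simp: ahull_def\<close>)
  moreover have "snd (hadd X Y) = sadd B (snd X) (snd Y)" by (cases X; cases Y) simp
  moreover have "coeff_wedge (\<lambda>\<sigma>s. \<alpha> (snd U # \<sigma>s)) (Us @ hadd X Y # Vs) x =
      coeff_wedge (\<lambda>\<sigma>s. \<alpha> (snd U # \<sigma>s)) (Us @ X # Vs) x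
      + coeff_wedge (\<lambda>\<sigma>s. \<alpha> (snd U # \<sigma>s)) (Us @ Y # Vs) x"
    by (rule Cons.IH[of l]) (use Cons.prems l vform_contract in \<open>auto simp: ahull_def\<close>)
  ultimately show ?case by (simp add: algebra_simps)
qed

lemma coeff_wedge_swap:
  assumes "vform B k \<alpha>" "Us \<in> lists ahull" "X \<in> ahull" "Y \<in> ahull" "Vs \<in> lists ahull"
    and "Suc (length Us + length Vs) = k"
  shows "coeff_wedge \<alpha> (Us @ X # Y # Vs) x = - coeff_wedge \<alpha> (Us @ Y # X # Vs) x"
  using assms(1,2,6)
proof (induction Us arbitrary: \<alpha> k)
  case Nil
  have XY: "snd X \<in> vsec B" "snd Y \<in> vsec B"
    using assms(3,4) by (auto simp: ahull_def)
  have "coeff_wedge (\<lambda>\<sigma>s. \<alpha> (snd X # snd Y # \<sigma>s)) Vs x =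
      - 1 * coeff_wedge (\<lambda>\<sigma>s. \<alpha> (snd Y # snd X # \<sigma>s)) Vs x
      + 0 * coeff_wedge (\<lambda>\<sigma>s. \<alpha> (snd Y # snd X # \<sigma>s)) Vs x"
  proof (cases Vs)
    case (Cons V Vs')
    show ?thesis
    proof (rule coeff_wedge_linear[OF _ assms(5)])
      fix \<sigma>s assume "\<sigma>s \<in> tuples (length Vs - 1) (vsec B)"
      then show "\<alpha> (snd X # snd Y # \<sigma>s) x = - 1 * \<alpha> (snd Y # snd X # \<sigma>s) x + 0 * \<alpha> (snd Y # snd X # \<sigma>s) x"
        using vform_swap[OF Nil(1), of "[]" \<sigma>s "snd X" "snd Y" x] Nil(3) Cons XY by (simp add: tuples_def)
    qed
  qed simp
  then show ?case by simp
next
  case (Cons U Us)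
  then obtain l where l: "k = Suc l" by (cases k) auto
  have "\<alpha> (map snd Us @ snd X # snd Y # map snd Vs) x = - \<alpha> (map snd Us @ snd Y # snd X # map snd Vs) x"
    by (rule vform_swap[OF Cons.prems(1)])
      (use Cons.prems assms(3-5) snd_vsec[of Us] snd_vsec[of Vs] in \<open>auto simp: ahull_def\<close>)
  moreover have "coeff_wedge (\<lambda>\<sigma>s. \<alpha> (snd U # \<sigma>s)) (Us @ X # Y # Vs) x =
      - coeff_wedge (\<lambda>\<sigma>s. \<alpha> (snd U # \<sigma>s)) (Us @ Y # X # Vs) x"
    by (rule Cons.IH[of l]) (use Cons.prems l vform_contract in \<open>auto simp: ahull_def\<close>)
  ultimately show ?case by simp
qed

text \<open>A form on the affine sections extends to the hull, as \<open>\<omega>\<^sub>0 \<zeta>\<^sub>0\<close> wedged with the coefficient functional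
  plus the vector part; this is what the defining equation of a form says.\<close>

lemma form_extension:
  assumes "aform B k \<omega>"
  obtains \<Omega> where "cochain \<Omega>" "slot_additive \<Omega>" "alternating \<Omega>"
    "\<And>\<zeta>s. \<zeta>s \<in> tuples k (asec B) \<Longrightarrow> \<omega> \<zeta>s = \<Omega> (map homog \<zeta>s)"
proof (cases k)
  case 0
  define \<Omega> where "\<Omega> Xs = (if Xs = [] then \<omega> [] else (\<lambda>x. 0))" for Xs :: "(real \<times> ('m \<Rightarrow> 'v)) list"
  have "\<omega> [] \<in> Cinf B" using assms 0 by (simp add: aform_def)
  then have "cochain \<Omega>" "slot_additive \<Omega>" "alternating \<Omega>"
    by (auto simp: \<Omega>_def cochain_def slot_additive_def alternating_def)
  moreover have "\<omega> \<zeta>s = \<Omega> (map homog \<zeta>s)" if "\<zeta>s \<in> tuples k (asec B)" for \<zeta>s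
    using that 0 by (simp add: tuples_def \<Omega>_def)
  ultimately show ?thesis by (rule that)
next
  case (Suc l)
  obtain \<omega>v \<omega>\<^sub>0 where v: "vform B k \<omega>v" and z: "vform B l (\<omega>\<^sub>0 \<zeta>\<^sub>0)"
    and w: "\<And>\<sigma>s x. \<sigma>s \<in> tuples k (vsec B) \<Longrightarrow> \<omega> (map (strans B \<zeta>\<^sub>0) \<sigma>s) x =
             (\<Sum>i<k. (- 1) ^ i * \<omega>\<^sub>0 \<zeta>\<^sub>0 (omit i \<sigma>s) x) + \<omega>v \<sigma>s x"
    using assms Suc origin unfolding aform_def by auto
  define \<Omega> where "\<Omega> Xs = (if length Xs = k
    then (\<lambda>x. coeff_wedge (\<omega>\<^sub>0 \<zeta>\<^sub>0) Xs x + \<omega>v (map snd Xs) x) else (\<lambda>x. 0))" for Xs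
  have "cochain \<Omega>"
    unfolding cochain_def
  proof
    fix Xs assume Xs: "Xs \<in> lists ahull"
    have "coeff_wedge (\<omega>\<^sub>0 \<zeta>\<^sub>0) Xs \<in> Cinf B" "\<omega>v (map snd Xs) \<in> Cinf B" if "length Xs = k"
      using coeff_wedge_closed[OF z Xs] vform_closed[OF v, of "map snd Xs"] snd_vsec[OF Xs] that Suc
      by (auto simp: tuples_def)
    then show "\<Omega> Xs \<in> Cinf B" by (simp add: \<Omega>_def)
  qed
  moreover have "slot_additive \<Omega>"
    unfolding slot_additive_def
  proof (intro ballI ext)
    fix Us X Y Vs x assume mem: "Us \<in> lists ahull" "X \<in> ahull" "Y \<in> ahull" "Vs \<in> lists ahull"
    have "snd (hadd X Y) = sadd B (snd X) (snd Y)" "snd X \<in> vsec B" "snd Y \<in> vsec B"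
      using mem(2,3) by (cases X; cases Y; simp)+
    then show "\<Omega> (Us @ hadd X Y # Vs) x = \<Omega> (Us @ X # Vs) x + \<Omega> (Us @ Y # Vs) x"
      using coeff_wedge_add[OF z mem, of x] Suc snd_vsec[OF mem(1)] snd_vsec[OF mem(4)]
        vform_add[OF v, of "map snd Us" "map snd Vs" "snd X" "snd Y" x]
      by (auto simp: \<Omega>_def)
  qed
  moreover have "alternating \<Omega>"
    unfolding alternating_def
  proof (intro ballI ext)
    fix Us X Y Vs x assume mem: "Us \<in> lists ahull" "X \<in> ahull" "Y \<in> ahull" "Vs \<in> lists ahull"
    have XY: "snd X \<in> vsec B" "snd Y \<in> vsec B" using mem(2,3) by (auto simp: ahull_def)
    show "\<Omega> (Us @ X # Y # Vs) x = - \<Omega> (Us @ Y # X # Vs) x"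
    proof (cases "length Us + Suc (Suc (length Vs)) = k")
      case True
      then have "coeff_wedge (\<omega>\<^sub>0 \<zeta>\<^sub>0) (Us @ X # Y # Vs) x = - coeff_wedge (\<omega>\<^sub>0 \<zeta>\<^sub>0) (Us @ Y # X # Vs) x"
        using Suc by (intro coeff_wedge_swap[OF z mem]) simp
      moreover have "\<omega>v (map snd Us @ snd X # snd Y # map snd Vs) x =
          - \<omega>v (map snd Us @ snd Y # snd X # map snd Vs) x"
        using True snd_vsec[OF mem(1)] snd_vsec[OF mem(4)] XY by (intro vform_swap[OF v]) simp_all
      ultimately show ?thesis using True by (simp add: \<Omega>_def)
    qed (simp add: \<Omega>_def)
  qed
  moreover have "\<omega> \<zeta>s = \<Omega> (map homog \<zeta>s)" if "\<zeta>s \<in> tuples k (asec B)" for \<zeta>s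
  proof
    fix x
    define \<sigma>s where "\<sigma>s = map (\<lambda>\<zeta>. sdiff B \<zeta> \<zeta>\<^sub>0) \<zeta>s"
    have s: "\<sigma>s \<in> tuples k (vsec B)" using that origin by (auto simp: \<sigma>s_def tuples_def)
    have "map (strans B \<zeta>\<^sub>0) \<sigma>s = \<zeta>s"
      using that by (auto simp: \<sigma>s_def tuples_def intro!: map_idI strans_sdiff[OF affine origin])
    then have "\<omega> \<zeta>s x = (\<Sum>i<k. (- 1) ^ i * \<omega>\<^sub>0 \<zeta>\<^sub>0 (omit i \<sigma>s) x) + \<omega>v \<sigma>s x"
      using w[OF s, of x] by simp
    moreover have "map homog \<zeta>s = map (Pair 1) \<sigma>s" by (simp add: \<sigma>s_def homog_def)
    moreover have "length \<sigma>s = k" using s by (simp add: tuples_def)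
    ultimately show "\<omega> \<zeta>s x = \<Omega> (map homog \<zeta>s) x"
      by (simp add: \<Omega>_def coeff_wedge_explicit o_def)
  qed
  ultimately show ?thesis by (rule that)
qed

lemma homog_lists: "\<zeta>s \<in> tuples k (asec B) \<Longrightarrow> map homog \<zeta>s \<in> lists ahull"
  by (simp add: tuples_def in_lists_conv_set) (blast intro: homog_hull)

text \<open>On the hull, evaluation on a vector section is plain evaluation, since \<open>\<zeta> + \<sigma>\<close> corresponds to the sum
  of the elements for \<open>\<zeta>\<close> and \<open>\<sigma>\<close>.\<close>

lemma eval_vec_extension:
  assumes "\<And>\<zeta>s. \<zeta>s \<in> tuples (Suc k) (asec B) \<Longrightarrow> \<omega> \<zeta>s = \<Omega> (map homog \<zeta>s)"
    and "\<And>X Y Xs x. X \<in> ahull \<Longrightarrow> Y \<in> ahull \<Longrightarrow> Xs \<in> lists ahull \<Longrightarrow>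
      \<Omega> (hadd X Y # Xs) x = \<Omega> (X # Xs) x + \<Omega> (Y # Xs) x"
    and "\<sigma> \<in> vsec B" "\<zeta>s \<in> tuples k (asec B)"
  shows "eval_vec B \<omega> \<sigma> \<zeta>s x = \<Omega> ((0, \<sigma>) # map homog \<zeta>s) x"
proof -
  define \<zeta> where "\<zeta> = (SOME \<zeta>. \<zeta> \<in> asec B)"
  have \<zeta>: "\<zeta> \<in> asec B" unfolding \<zeta>_def using origin by (rule someI[of "\<lambda>\<zeta>. \<zeta> \<in> asec B"])
  have "strans B \<zeta> \<sigma> # \<zeta>s \<in> tuples (Suc k) (asec B)" "\<zeta> # \<zeta>s \<in> tuples (Suc k) (asec B)"
    using \<zeta> assms(3,4) by (simp_all add: tuples_def)
  moreover have "map homog \<zeta>s \<in> lists ahull" using assms(4) by (rule homog_lists)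
  ultimately have "\<omega> (strans B \<zeta> \<sigma> # \<zeta>s) x - \<omega> (\<zeta> # \<zeta>s) x = \<Omega> ((0, \<sigma>) # map homog \<zeta>s) x"
    using assms(2)[of "homog \<zeta>" "(0, \<sigma>)" "map homog \<zeta>s" x] \<zeta> assms(3)
    by (simp add: assms(1) homog_strans)
  then show ?thesis by (simp add: eval_vec_def \<zeta>_def Let_def)
qed

lemma ext_deriv_extension:
  assumes "cochain \<Omega>" "alternating \<Omega>"
    and agree: "\<And>\<zeta>s. \<zeta>s \<in> tuples k (asec B) \<Longrightarrow> \<omega> \<zeta>s = \<Omega> (map homog \<zeta>s)"
    and head: "\<And>X Y Xs x. X \<in> ahull \<Longrightarrow> Y \<in> ahull \<Longrightarrow> Xs \<in> lists ahull \<Longrightarrow>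
      \<Omega> (hadd X Y # Xs) x = \<Omega> (X # Xs) x + \<Omega> (Y # Xs) x"
    and z: "\<zeta>s \<in> tuples (Suc k) (asec B)"
  shows "ext_deriv B \<omega> \<zeta>s = cdiff \<Omega> (map homog \<zeta>s)"
proof
  fix x
  have mem: "map homog \<zeta>s \<in> lists ahull" using z by (rule homog_lists)
  have len: "length \<zeta>s = Suc k" and nth: "\<And>i. i < Suc k \<Longrightarrow> \<zeta>s ! i \<in> asec B"
    using z by (auto simp: tuples_def)
  have "anchor_act B (\<zeta>s ! i) (\<omega> (omit i \<zeta>s)) x =
      hact (map homog \<zeta>s ! i) (\<Omega> (omit i (map homog \<zeta>s))) x" if "i < Suc k" for i
  proof -
    have o: "omit i \<zeta>s \<in> tuples k (asec B)" using omit_tuples[OF z] that by simp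
    then have "map homog (omit i \<zeta>s) \<in> lists ahull" by (rule homog_lists)
    then have "\<Omega> (map homog (omit i \<zeta>s)) \<in> Cinf B" using assms(1) by (simp add: cochain_def)
    then show ?thesis using hact_homog[OF nth[OF that]] agree[OF o] that len by (simp add: omit_map)
  qed
  moreover have "eval_vec B \<omega> (aabr B (\<zeta>s ! i) (\<zeta>s ! j)) (omit i (omit j \<zeta>s)) x =
      \<Omega> (hbr (map homog \<zeta>s ! i) (map homog \<zeta>s ! j) # omit i (omit j (map homog \<zeta>s))) x"
    if ij: "j < Suc k" "i < j" for i j
  proof -
    obtain l where l: "k = Suc l" using ij by (cases k) auto
    have "omit j \<zeta>s \<in> tuples (Suc l) (asec B)"
      using omit_tuples[OF z] ij l by simp
    then have "omit i (omit j \<zeta>s) \<in> tuples l (asec B)"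
      by (rule omit_tuples) (use ij l in simp)
    then show ?thesis
      using eval_vec_extension[of l \<omega> \<Omega> "aabr B (\<zeta>s ! i) (\<zeta>s ! j)" "omit i (omit j \<zeta>s)" x]
        agree head l ij len nth[of i] nth[of j] by (simp add: omit_map hbr_homog)
  qed
  ultimately show "ext_deriv B \<omega> \<zeta>s x = cdiff \<Omega> (map homog \<zeta>s) x"
    unfolding ext_deriv_def cdiff_explicit[OF assms(2) mem] by (simp add: len)
qed

lemma ext_deriv_ext_deriv_extension:
  assumes "cochain \<Omega>" "slot_additive \<Omega>" "alternating \<Omega>"
    and agree: "\<And>\<zeta>s. \<zeta>s \<in> tuples k (asec B) \<Longrightarrow> \<omega> \<zeta>s = \<Omega> (map homog \<zeta>s)"
    and z: "\<zeta>s \<in> tuples (k + 2) (asec B)"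
  shows "ext_deriv B (ext_deriv B \<omega>) \<zeta>s = cdiff (cdiff \<Omega>) (map homog \<zeta>s)"
proof (rule ext_deriv_extension[where k = "Suc k"])
  show "cochain (cdiff \<Omega>)" by (rule cdiff_cochain[OF assms(1)])
  show "alternating (cdiff \<Omega>)" by (rule cdiff_alternating[OF assms(1-3)])
  show "ext_deriv B \<omega> \<zeta>s = cdiff \<Omega> (map homog \<zeta>s)" if "\<zeta>s \<in> tuples (Suc k) (asec B)" for \<zeta>s
    by (rule ext_deriv_extension[OF assms(1,3) agree _ that]) (use additive_head[OF assms(2)] in auto)
  show "cdiff \<Omega> (hadd X Y # Xs) x = cdiff \<Omega> (X # Xs) x + cdiff \<Omega> (Y # Xs) x"
    if "X \<in> ahull" "Y \<in> ahull" "Xs \<in> lists ahull" for X Y Xs x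
    by (rule cdiff_additive_head[OF assms(1,2) that])
  show "\<zeta>s \<in> tuples (Suc (Suc k)) (asec B)" using z by simp
qed

lemma ext_deriv_ext_deriv_zero:
  assumes "jacobi_mixed B" "aform B k \<omega>" "\<zeta>s \<in> tuples (k + 2) (asec B)"
  shows "ext_deriv B (ext_deriv B \<omega>) \<zeta>s x = 0"
proof -
  obtain \<Omega> where \<Omega>: "cochain \<Omega>" "slot_additive \<Omega>" "alternating \<Omega>"
    "\<And>\<zeta>s. \<zeta>s \<in> tuples k (asec B) \<Longrightarrow> \<omega> \<zeta>s = \<Omega> (map homog \<zeta>s)"
    using form_extension[OF assms(2)] by blast
  have "map homog \<zeta>s \<in> lists ahull" using assms(3) by (rule homog_lists)
  then show ?thesis
    using cdiff_cdiff_zero[OF hull_jacobi[OF assms(1)] hull_rep[OF assms(1)] \<Omega>(1,2), of "map homog \<zeta>s" x]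
    by (simp add: ext_deriv_ext_deriv_extension[OF \<Omega> assms(3)])
qed

end

section \<open>Equivalence of the three conditions\<close>

context affine_origin
begin

lemma aabr_skew:
  assumes "\<zeta>\<^sub>1 \<in> asec B" "\<zeta>\<^sub>2 \<in> asec B"
  shows "aabr B \<zeta>\<^sub>2 \<zeta>\<^sub>1 = sneg B (aabr B \<zeta>\<^sub>1 \<zeta>\<^sub>2)"
proof -
  have "sadd B (aabr B \<zeta>\<^sub>1 \<zeta>\<^sub>2) (aabr B \<zeta>\<^sub>2 \<zeta>\<^sub>1) = vzero B"
    using br_skew[OF homog_hull homog_hull, OF assms] hbr_homog[OF assms] hbr_homog[OF assms(2,1)] by simp
  then have "crd B (aabr B \<zeta>\<^sub>1 \<zeta>\<^sub>2) x + crd B (aabr B \<zeta>\<^sub>2 \<zeta>\<^sub>1) x = 0" for x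
    using assms by (metis aabr_closed crd_sadd[OF vec] crd_vzero[OF vec])
  then show ?thesis
    using assms by (intro eqI) (simp_all add: crd_sneg[OF vec] eq_neg_iff_add_eq_0 add.commute)
qed

lemma sdiff_self: "\<zeta> \<in> asec B \<Longrightarrow> sdiff B \<zeta> \<zeta> = vzero B"
  by (subst sdiff_origin) (auto intro!: eqI simp: origin crd_basic)

lemma sadd_vzero: "\<sigma> \<in> vsec B \<Longrightarrow> sadd B (vzero B) \<sigma> = \<sigma>"
  by (rule eqI) (simp_all add: crd_basic)

lemma sdiff_strans_origin: "\<sigma> \<in> vsec B \<Longrightarrow> sdiff B (strans B \<zeta>\<^sub>0 \<sigma>) \<zeta>\<^sub>0 = \<sigma>"
  by (simp add: sdiff_strans origin sdiff_self sadd_vzero)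

lemma section_brackets_linear:
  assumes "\<zeta> \<in> asec B" "\<sigma> \<in> vsec B" "\<eta> \<in> vsec B"
  shows "abr B \<zeta> (sneg B \<sigma>) = sneg B (abr B \<zeta> \<sigma>)"
    and "vbr B \<eta> (sneg B \<sigma>) = sneg B (vbr B \<eta> \<sigma>)"
    and "vbr B \<sigma> \<sigma> = vzero B"
    and "abr B \<zeta> (vzero B) = vzero B"
  using assms by (auto intro!: eqI simp: crd_simps)

text \<open>In the cyclic identity for \<open>\<zeta>\<^sub>0\<close>, \<open>\<zeta>\<^sub>0 + \<sigma>\<close> and \<open>\<zeta>\<^sub>0 + \<eta>\<close> the terms \<open>[\<zeta>\<^sub>0, [\<zeta>\<^sub>0, \<sigma>]]\<close> and
  \<open>[\<zeta>\<^sub>0, [\<zeta>\<^sub>0, \<eta>]]\<close> cancel, and the mixed identity remains.\<close>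

lemma jacobi_affine_imp_mixed_at_origin:
  assumes J: "jacobi_affine B" and s: "\<sigma> \<in> vsec B" "\<eta> \<in> vsec B"
  shows "abr B \<zeta>\<^sub>0 (vbr B \<sigma> \<eta>) = sadd B (vbr B (abr B \<zeta>\<^sub>0 \<sigma>) \<eta>) (vbr B \<sigma> (abr B \<zeta>\<^sub>0 \<eta>))"
proof (rule eqI)
  fix x
  let ?\<zeta>\<^sub>2 = "strans B \<zeta>\<^sub>0 \<sigma>" and ?\<zeta>\<^sub>3 = "strans B \<zeta>\<^sub>0 \<eta>"
  have 12: "aabr B \<zeta>\<^sub>0 ?\<zeta>\<^sub>2 = abr B \<zeta>\<^sub>0 \<sigma>"
    by (simp add: aabr_def sdiff_strans_origin s)
  have 31: "aabr B ?\<zeta>\<^sub>3 \<zeta>\<^sub>0 = sneg B (abr B \<zeta>\<^sub>0 \<eta>)"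
    using aabr_skew[of \<zeta>\<^sub>0 ?\<zeta>\<^sub>3] s origin by (simp add: aabr_def sdiff_strans_origin)
  have 23: "aabr B ?\<zeta>\<^sub>2 ?\<zeta>\<^sub>3 =
      sadd B (sadd B (abr B \<zeta>\<^sub>0 \<eta>) (vbr B \<sigma> \<eta>)) (sadd B (sneg B (abr B \<zeta>\<^sub>0 \<sigma>)) (sneg B (vzero B)))"
    using s origin
    by (simp add: aabr_def sdiff_origin[of ?\<zeta>\<^sub>2 ?\<zeta>\<^sub>3] sdiff_strans_origin abr_strans abr_add vbr_add
        section_brackets_linear[OF origin])
  have "crd B (sadd B (sadd B (vabr B (aabr B \<zeta>\<^sub>0 ?\<zeta>\<^sub>2) ?\<zeta>\<^sub>3) (vabr B (aabr B ?\<zeta>\<^sub>2 ?\<zeta>\<^sub>3) \<zeta>\<^sub>0))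
      (vabr B (aabr B ?\<zeta>\<^sub>3 \<zeta>\<^sub>0) ?\<zeta>\<^sub>2)) x = 0"
    using J s origin unfolding jacobi_affine_def by (simp add: crd_basic)
  then show "crd B (abr B \<zeta>\<^sub>0 (vbr B \<sigma> \<eta>)) x =
      crd B (sadd B (vbr B (abr B \<zeta>\<^sub>0 \<sigma>) \<eta>) (vbr B \<sigma> (abr B \<zeta>\<^sub>0 \<eta>))) x"
    unfolding 12 31 23 vabr_def
    using s origin crd_vbr_skew[of \<eta> "abr B \<zeta>\<^sub>0 \<sigma>" x]
    by (simp add: abr_strans crd_simps section_brackets_linear[OF origin] algebra_simps)
qed (use s origin in simp_all)

text \<open>A linear form on the vector sections becomes a form on the affine sections by letting it vanish at
  the origin.\<close>

lemma aform_of_linear_map: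
  assumes \<theta>: "\<And>\<sigma>. \<sigma> \<in> vsec B \<Longrightarrow> \<theta> \<sigma> \<in> Cinf B"
    and add: "\<And>\<sigma> \<eta> x. \<sigma> \<in> vsec B \<Longrightarrow> \<eta> \<in> vsec B \<Longrightarrow> \<theta> (sadd B \<sigma> \<eta>) x = \<theta> \<sigma> x + \<theta> \<eta> x"
    and scale: "\<And>\<sigma> f x. \<sigma> \<in> vsec B \<Longrightarrow> f \<in> Cinf B \<Longrightarrow> \<theta> (sscale B f \<sigma>) x = f x * \<theta> \<sigma> x"
  shows "aform B 1 (\<lambda>\<zeta>s. \<theta> (sdiff B (hd \<zeta>s) \<zeta>\<^sub>0))"
proof -
  have single: "\<exists>\<sigma>\<in>S. \<sigma>s = [\<sigma>]" if "\<sigma>s \<in> tuples 1 S" for \<sigma>s and S :: "'b set"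
    using that by (auto simp: tuples_def length_Suc_conv)
  have "vform B 1 (\<lambda>\<sigma>s. \<theta> (hd \<sigma>s))"
    unfolding vform_def
  proof (intro conjI ballI allI impI)
    fix \<sigma>s assume "\<sigma>s \<in> tuples 1 (vsec B)"
    then obtain \<sigma> where \<sigma>: "\<sigma> \<in> vsec B" "\<sigma>s = [\<sigma>]" using single by blast
    show "\<theta> (hd \<sigma>s) \<in> Cinf B" using \<sigma> \<theta> by simp
    fix i :: nat and x assume "i < 1"
    then have i: "i = 0" by simp
    show "\<theta> (hd (\<sigma>s[i := \<sigma>s ! j, j := \<sigma>s ! i])) x = - \<theta> (hd \<sigma>s) x" if "j < 1" "i \<noteq> j" for j
      using that i by simp
    show "\<theta> (hd (\<sigma>s[i := sadd B \<tau> \<eta>])) x = \<theta> (hd (\<sigma>s[i := \<tau>])) x + \<theta> (hd (\<sigma>s[i := \<eta>])) x"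
      if "\<tau> \<in> vsec B" "\<eta> \<in> vsec B" for \<tau> \<eta>
      using that \<sigma> i add by simp
    show "\<theta> (hd (\<sigma>s[i := sscale B f \<tau>])) x = f x * \<theta> (hd (\<sigma>s[i := \<tau>])) x"
      if "\<tau> \<in> vsec B" "f \<in> Cinf B" for \<tau> f
      using that \<sigma> i scale by simp
  qed
  moreover have "vform B 0 (\<lambda>\<sigma>s. \<theta> (sdiff B \<zeta> \<zeta>\<^sub>0))" if "\<zeta> \<in> asec B" for \<zeta>
    using \<theta> that origin by (simp add: vform_def)
  moreover have "\<theta> (sdiff B (hd (map (strans B \<zeta>) \<sigma>s)) \<zeta>\<^sub>0) x =
      (\<Sum>i<1. (- 1) ^ i * \<theta> (sdiff B \<zeta> \<zeta>\<^sub>0) x) + \<theta> (hd \<sigma>s) x"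
    if "\<zeta> \<in> asec B" "\<sigma>s \<in> tuples 1 (vsec B)" for \<zeta> \<sigma>s x
    using single[OF that(2)] that(1) origin by (auto simp: sdiff_strans add)
  moreover have "(1 :: nat) \<noteq> 0" by simp
  ultimately show ?thesis
    unfolding aform_def using origin sdiff_strans add
    by (simp only: if_False)
      (intro exI[of _ "\<lambda>\<sigma>s. \<theta> (hd \<sigma>s)"] exI[of _ "\<lambda>\<zeta> \<sigma>s. \<theta> (sdiff B \<zeta> \<zeta>\<^sub>0)"], auto)
qed

text \<open>Linear forms that separate the vectors of the fibre over \<open>x\<close>: inner products in a trivialisation,
  cut off by a bump function, whose value at \<open>x\<close> is \<open>\<beta>\<close>.\<close>

lemma test_form:
  obtains \<theta> \<beta> where "\<And>\<sigma>. \<sigma> \<in> vsec B \<Longrightarrow> \<theta> \<sigma> \<in> Cinf B"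
    "\<And>\<sigma> \<eta> y. \<sigma> \<in> vsec B \<Longrightarrow> \<eta> \<in> vsec B \<Longrightarrow> \<theta> (sadd B \<sigma> \<eta>) y = \<theta> \<sigma> y + \<theta> \<eta> y"
    "\<And>\<sigma> f y. \<sigma> \<in> vsec B \<Longrightarrow> f \<in> Cinf B \<Longrightarrow> \<theta> (sscale B f \<sigma>) y = f y * \<theta> \<sigma> y"
    "\<beta> \<noteq> 0" "\<And>\<sigma>. \<theta> \<sigma> x = \<beta> * (crd B \<sigma> x \<bullet> w)"
proof -
  obtain U \<phi> where U: "(U, \<phi>) \<in> vtriv B" "x \<in> U" and c: "\<And>\<sigma>. crd B \<sigma> x = \<phi> (\<sigma> x)"
    using crd_trivialisation[OF vec] by blast
  have op: "open U" by (rule vtrivD(1)[OF vec U(1)])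
  obtain b K where b: "b \<in> Cinf B" "closed K" "K \<subseteq> U" "b x \<noteq> 0" "\<And>y. y \<notin> K \<Longrightarrow> b y = 0"
    using Cinf_bump[OF smooth_mfd op U(2)] by metis
  define \<theta> where "\<theta> \<sigma> = (\<lambda>y. if y \<in> U then b y *\<^sub>R (\<phi> (\<sigma> y) \<bullet> w) else 0)" for \<sigma>
  show ?thesis
  proof (rule that[of \<theta> "b x"])
    fix \<sigma> assume s: "\<sigma> \<in> vsec B"
    show "\<theta> \<sigma> \<in> Cinf B"
      unfolding Cinf_def \<theta>_def mem_Collect_eq
      by (rule smooth_map_cutoff[OF smooth_mfd b(1-3) op b(5)
            smooth_map_bounded_linear[OF bounded_linear_inner_left smooth_mfd op vsec_smooth[OF s U(1)]]])
    show "\<theta> (sadd B \<sigma> \<eta>) y = \<theta> \<sigma> y + \<theta> \<eta> y" if "\<eta> \<in> vsec B" for \<eta> y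
      using vtrivD(3)[OF vec U(1), of y "\<sigma> y" "\<eta> y"] vsec_proj[OF s] vsec_proj[OF that]
      by (simp add: \<theta>_def sadd_def inner_add_left algebra_simps)
    show "\<theta> (sscale B f \<sigma>) y = f y * \<theta> \<sigma> y" for f y
      using vtrivD(4)[OF vec U(1), of y "\<sigma> y" "f y"] vsec_proj[OF s]
      by (simp add: \<theta>_def sscale_def)
  qed (use b(4) U(2) c in \<open>simp_all add: \<theta>_def\<close>)
qed

lemma ext_deriv_squared_zero_imp_rep:
  assumes D: "ext_deriv_squared_zero B" and z: "\<zeta> \<in> asec B" "\<xi> \<in> asec B" and f: "f \<in> Cinf B"
  shows "hact (homog \<zeta>) (hact (homog \<xi>) f) x - hact (homog \<xi>) (hact (homog \<zeta>) f) x =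
    hact (hbr (homog \<zeta>) (homog \<xi>)) f x"
proof -
  have form: "aform B 0 (\<lambda>_. f)" using f by (simp add: aform_def)
  obtain \<Omega> where \<Omega>: "cochain \<Omega>" "slot_additive \<Omega>" "alternating \<Omega>"
    "\<And>\<zeta>s. \<zeta>s \<in> tuples 0 (asec B) \<Longrightarrow> f = \<Omega> (map homog \<zeta>s)"
    using form_extension[OF form] by blast
  have t: "[\<zeta>, \<xi>] \<in> tuples (0 + 2) (asec B)" using z by (simp add: tuples_def)
  have "ext_deriv B (ext_deriv B (\<lambda>_. f)) [\<zeta>, \<xi>] x = 0"
    using D[unfolded ext_deriv_squared_zero_def, rule_format, OF form t] .
  then have "cdiff (cdiff \<Omega>) [homog \<zeta>, homog \<xi>] x = 0"
    using ext_deriv_ext_deriv_extension[OF \<Omega>(1-3) \<Omega>(4) t] by (simp only: list.map)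
  moreover have "\<Omega> [] = f" using \<Omega>(4)[of "[]"] by (simp add: tuples_def)
  ultimately show ?thesis
    using cdiff_cdiff_pair[OF \<Omega>(1) homog_hull homog_hull, OF z, of x] by simp
qed

text \<open>Degree \<open>0\<close> shows that the anchor respects the brackets of affine sections.  In degree \<open>1\<close> only the value
  of the form on the Jacobiator survives, and the form whose vector part at \<open>x\<close> is the inner product with
  the Jacobiator itself detects whether it vanishes at \<open>x\<close>.\<close>

lemma ext_deriv_squared_zero_imp_jacobi:
  assumes D: "ext_deriv_squared_zero B" and z: "\<zeta>\<^sub>1 \<in> asec B" "\<zeta>\<^sub>2 \<in> asec B" "\<zeta>\<^sub>3 \<in> asec B"
  shows "sadd B (sadd B (vabr B (aabr B \<zeta>\<^sub>1 \<zeta>\<^sub>2) \<zeta>\<^sub>3) (vabr B (aabr B \<zeta>\<^sub>2 \<zeta>\<^sub>3) \<zeta>\<^sub>1))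
    (vabr B (aabr B \<zeta>\<^sub>3 \<zeta>\<^sub>1) \<zeta>\<^sub>2) = vzero B" (is "?J = _")
proof (rule eqI)
  fix x
  obtain \<theta> \<beta> where \<theta>: "\<And>\<sigma>. \<sigma> \<in> vsec B \<Longrightarrow> \<theta> \<sigma> \<in> Cinf B"
    "\<And>\<sigma> \<eta> y. \<sigma> \<in> vsec B \<Longrightarrow> \<eta> \<in> vsec B \<Longrightarrow> \<theta> (sadd B \<sigma> \<eta>) y = \<theta> \<sigma> y + \<theta> \<eta> y"
    "\<And>\<sigma> f y. \<sigma> \<in> vsec B \<Longrightarrow> f \<in> Cinf B \<Longrightarrow> \<theta> (sscale B f \<sigma>) y = f y * \<theta> \<sigma> y"
    "\<beta> \<noteq> 0" "\<And>\<sigma>. \<theta> \<sigma> x = \<beta> * (crd B \<sigma> x \<bullet> crd B ?J x)"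
    using test_form[where x = x and w = "crd B ?J x"] by blast
  define \<omega> where "\<omega> \<zeta>s = \<theta> (sdiff B (hd \<zeta>s) \<zeta>\<^sub>0)" for \<zeta>s
  have form: "aform B 1 \<omega>"
    unfolding \<omega>_def[abs_def] by (rule aform_of_linear_map[OF \<theta>(1-3)])
  obtain \<Omega> where \<Omega>: "cochain \<Omega>" "slot_additive \<Omega>" "alternating \<Omega>"
    "\<And>\<zeta>s. \<zeta>s \<in> tuples 1 (asec B) \<Longrightarrow> \<omega> \<zeta>s = \<Omega> (map homog \<zeta>s)"
    using form_extension[OF form] by blast
  have vector: "\<Omega> [(0, \<tau>)] x = \<theta> \<tau> x" if "\<tau> \<in> vsec B" for \<tau>
  proof -
    have "\<omega> [strans B \<zeta>\<^sub>0 \<tau>] x = \<Omega> [homog \<zeta>\<^sub>0] x + \<Omega> [(0, \<tau>)] x"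
      using \<Omega>(4)[of "[strans B \<zeta>\<^sub>0 \<tau>]"] additive_head[OF \<Omega>(2), of "homog \<zeta>\<^sub>0" "(0, \<tau>)" "[]"] that origin
      by (simp add: tuples_def homog_strans)
    moreover have "\<omega> [strans B \<zeta>\<^sub>0 \<tau>] x = \<omega> [\<zeta>\<^sub>0] x + \<theta> \<tau> x"
      using \<theta>(2) that origin by (simp add: \<omega>_def sdiff_strans)
    moreover have "\<omega> [\<zeta>\<^sub>0] x = \<Omega> [homog \<zeta>\<^sub>0] x"
      using \<Omega>(4)[of "[\<zeta>\<^sub>0]"] origin by (simp add: tuples_def)
    ultimately show ?thesis by simp
  qed
  have t: "[\<zeta>\<^sub>1, \<zeta>\<^sub>2, \<zeta>\<^sub>3] \<in> tuples (1 + 2) (asec B)" using z by (simp add: tuples_def)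
  have "ext_deriv B (ext_deriv B \<omega>) [\<zeta>\<^sub>1, \<zeta>\<^sub>2, \<zeta>\<^sub>3] x = 0"
    using D[unfolded ext_deriv_squared_zero_def, rule_format, OF form t] .
  then have "cdiff (cdiff \<Omega>) [homog \<zeta>\<^sub>1, homog \<zeta>\<^sub>2, homog \<zeta>\<^sub>3] x = 0"
    using ext_deriv_ext_deriv_extension[OF \<Omega>(1-3) \<Omega>(4) t] by (simp only: list.map)
  moreover have "cdiff (cdiff \<Omega>) [homog \<zeta>\<^sub>1, homog \<zeta>\<^sub>2, homog \<zeta>\<^sub>3] x =
      \<Omega> [hbr (hbr (homog \<zeta>\<^sub>1) (homog \<zeta>\<^sub>2)) (homog \<zeta>\<^sub>3)] x
      + \<Omega> [hbr (homog \<zeta>\<^sub>2) (hbr (homog \<zeta>\<^sub>1) (homog \<zeta>\<^sub>3))] x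
      - \<Omega> [hbr (homog \<zeta>\<^sub>1) (hbr (homog \<zeta>\<^sub>2) (homog \<zeta>\<^sub>3))] x"
  proof (rule cdiff_cdiff_triple[OF \<Omega>(1)])
    fix U V f p assume "U \<in> {homog \<zeta>\<^sub>1, homog \<zeta>\<^sub>2, homog \<zeta>\<^sub>3}" "V \<in> {homog \<zeta>\<^sub>1, homog \<zeta>\<^sub>2, homog \<zeta>\<^sub>3}"
      and f: "f \<in> Cinf B"
    then obtain \<zeta> \<xi> where "U = homog \<zeta>" "V = homog \<xi>" "\<zeta> \<in> asec B" "\<xi> \<in> asec B"
      using z by auto
    then show "hact U (hact V f) p - hact V (hact U f) p = hact (hbr U V) f p"
      using ext_deriv_squared_zero_imp_rep[OF D _ _ f] by simp
  qed (use z in simp_all)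
  ultimately have "\<theta> (vabr B (aabr B \<zeta>\<^sub>1 \<zeta>\<^sub>2) \<zeta>\<^sub>3) x + \<theta> (abr B \<zeta>\<^sub>2 (aabr B \<zeta>\<^sub>1 \<zeta>\<^sub>3)) x
      - \<theta> (abr B \<zeta>\<^sub>1 (aabr B \<zeta>\<^sub>2 \<zeta>\<^sub>3)) x = 0"
    using z by (simp add: hbr_homog hbr_vector_homog vector)
  then have "\<beta> * ((crd B (vabr B (aabr B \<zeta>\<^sub>1 \<zeta>\<^sub>2) \<zeta>\<^sub>3) x + crd B (abr B \<zeta>\<^sub>2 (aabr B \<zeta>\<^sub>1 \<zeta>\<^sub>3)) x
      - crd B (abr B \<zeta>\<^sub>1 (aabr B \<zeta>\<^sub>2 \<zeta>\<^sub>3)) x) \<bullet> crd B ?J x) = 0"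
    unfolding \<theta>(5) by (simp only: inner_add_left inner_diff_left distrib_left right_diff_distrib)
  moreover have "crd B (vabr B (aabr B \<zeta>\<^sub>1 \<zeta>\<^sub>2) \<zeta>\<^sub>3) x + crd B (abr B \<zeta>\<^sub>2 (aabr B \<zeta>\<^sub>1 \<zeta>\<^sub>3)) x
      - crd B (abr B \<zeta>\<^sub>1 (aabr B \<zeta>\<^sub>2 \<zeta>\<^sub>3)) x = crd B ?J x"
    using z by (simp add: vabr_def aabr_skew[OF z(1,3)] crd_simps)
  ultimately have "crd B ?J x \<bullet> crd B ?J x = 0" using \<theta>(4) by (simp only: mult_eq_0_iff simp_thms)
  then show "crd B ?J x = crd B (vzero B) x" by (simp add: crd_vzero[OF vec])
qed (use z in simp_all)

end

context leibniz_bracket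
begin

lemma ext_deriv_squared_zero_imp_jacobi_affine: "ext_deriv_squared_zero B \<Longrightarrow> jacobi_affine B"
  unfolding jacobi_affine_def
proof (intro ballI)
  fix \<zeta>\<^sub>1 \<zeta>\<^sub>2 \<zeta>\<^sub>3 assume D: "ext_deriv_squared_zero B" and z: "\<zeta>\<^sub>1 \<in> asec B" "\<zeta>\<^sub>2 \<in> asec B" "\<zeta>\<^sub>3 \<in> asec B"
  interpret affine_origin B \<zeta>\<^sub>1 by unfold_locales (rule z(1))
  show "sadd B (sadd B (vabr B (aabr B \<zeta>\<^sub>1 \<zeta>\<^sub>2) \<zeta>\<^sub>3) (vabr B (aabr B \<zeta>\<^sub>2 \<zeta>\<^sub>3) \<zeta>\<^sub>1))
    (vabr B (aabr B \<zeta>\<^sub>3 \<zeta>\<^sub>1) \<zeta>\<^sub>2) = vzero B"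
    by (rule ext_deriv_squared_zero_imp_jacobi[OF D z])
qed

lemma jacobi_affine_imp_jacobi_mixed: "jacobi_affine B \<Longrightarrow> jacobi_mixed B"
  unfolding jacobi_mixed_def
proof (intro ballI)
  fix \<zeta> \<sigma> \<eta> assume J: "jacobi_affine B" and s: "\<zeta> \<in> asec B" "\<sigma> \<in> vsec B" "\<eta> \<in> vsec B"
  interpret affine_origin B \<zeta> by unfold_locales (rule s(1))
  show "abr B \<zeta> (vbr B \<sigma> \<eta>) = sadd B (vbr B (abr B \<zeta> \<sigma>) \<eta>) (vbr B \<sigma> (abr B \<zeta> \<eta>))"
    by (rule jacobi_affine_imp_mixed_at_origin[OF J s(2,3)])
qed

lemma jacobi_mixed_imp_ext_deriv_squared_zero: "jacobi_mixed B \<Longrightarrow> ext_deriv_squared_zero B"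
  unfolding ext_deriv_squared_zero_def
proof (intro allI impI ballI)
  fix k \<omega> \<zeta>s x
  assume J: "jacobi_mixed B" and \<omega>: "aform B k \<omega>" and z: "\<zeta>s \<in> tuples (k + 2) (asec B)"
  then have "hd \<zeta>s \<in> asec B" by (cases \<zeta>s) (auto simp: tuples_def)
  then interpret affine_origin B "hd \<zeta>s" by unfold_locales
  show "ext_deriv B (ext_deriv B \<omega>) \<zeta>s x = 0"
    by (rule ext_deriv_ext_deriv_zero[OF J \<omega> z])
qed

end

theorem proposition4:
  fixes B :: "('m::{t2_space,second_countable_topology}, 'a::euclidean_space, 'v, 'f::real_inner, 'e) leib_bundle"
  assumes "leibniz_bracket_bundle B"
  shows "(ext_deriv_squared_zero B \<longleftrightarrow> jacobi_affine B) \<and>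
         (ext_deriv_squared_zero B \<longleftrightarrow> jacobi_mixed B)"
proof -
  interpret leibniz_bracket B by unfold_locales (rule assms)
  show ?thesis
    using ext_deriv_squared_zero_imp_jacobi_affine jacobi_affine_imp_jacobi_mixed
      jacobi_mixed_imp_ext_deriv_squared_zero by blast
qed

end
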